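(* Let $0<p<\infty$, let $H_1,H_2$ be complex Hilbert spaces, and let $V_0:S(C_p(H_1)^+)\to S(C_p(H_2)^+)$ be a surjective isometry, i.e. a surjective map with $\|V_0(x)-V_0(y)\|_p=\|x-y\|_p$ for all $x,y\in S(C_p(H_1)^+)$. Then there exists a surjective real-linear isometry $T:C_p(H_1)\to C_p(H_2)$ (with respect to $\|\cdot\|_p$) that extends $V_0$, i.e. $T(x)=V_0(x)$ for all $x\in S(C_p(H_1)^+)$.
   Context: Hilbert spaces are not assumed separable. For a complex Hilbert space $H$ and $0<p<\infty$, the Schatten $p$-class is $C_p(H)=\{x\in\mathcal B(H): x \text{ compact},\ \sum_j s_j(x)^p<\infty\}$, where $s_j(x)$ are the singular values of $x$ (counted with multiplicity), and $\|x\|_p=(\sum_j s_j(x)^p)^{1/p}=(\mathrm{Tr}(|x|^p))^{1/p}$ (a norm for $p\ge1$, a quasi-norm for $0<p<1$). $S(C_p(H)^+)$ denotes the set of positive (semidefinite) operators $x\in C_p(H)$ with $\|x\|_p=1$. *)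

theory Defs
  imports "HOL-Analysis.Analysis"
begin

text \<open>
  The inherited real inner product is the real part of \<open>cinner\<close>, so norm, topology and
  bounded real-linear maps are those of HOL-Analysis. The form \<open>cinner\<close> is linear in its first
  argument. No separability is assumed.
\<close>

class complex_hilbert = real_inner + complete_space +
  fixes scaleC :: "complex \<Rightarrow> 'a \<Rightarrow> 'a" (infixr "*\<^sub>C" 75)
    and cinner :: "'a \<Rightarrow> 'a \<Rightarrow> complex"
  assumes scaleC_add_right: "c *\<^sub>C (u + v) = c *\<^sub>C u + c *\<^sub>C v"
    and scaleC_add_left: "(c + d) *\<^sub>C u = c *\<^sub>C u + d *\<^sub>C u"
    and scaleC_scaleC: "c *\<^sub>C d *\<^sub>C u = (c * d) *\<^sub>C u"
    and scaleR_scaleC: "r *\<^sub>R u = complex_of_real r *\<^sub>C u"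
    and cinner_commute: "cinner u v = cnj (cinner v u)"
    and cinner_add_left: "cinner (u + v) w = cinner u w + cinner v w"
    and cinner_scaleC_left: "cinner (c *\<^sub>C u) v = c * cinner u v"
    and inner_eq_Re_cinner: "inner u v = Re (cinner u v)"

global_interpretation complex_vector:
  vector_space "scaleC :: complex \<Rightarrow> 'a \<Rightarrow> 'a::complex_hilbert"
  defines cdim = complex_vector.dim
proof
  show "1 *\<^sub>C u = u" for u :: 'a
    by (metis of_real_1 scaleR_one scaleR_scaleC)
qed (simp_all add: scaleC_add_right scaleC_add_left scaleC_scaleC)

instantiation complex :: complex_hilbert
begin

definition scaleC_complex :: "complex \<Rightarrow> complex \<Rightarrow> complex"
  where "scaleC_complex c z = c * z"

definition cinner_complex :: "complex \<Rightarrow> complex \<Rightarrow> complex"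
  where "cinner_complex z w = z * cnj w"

instance
  by standard
    (auto simp: scaleC_complex_def cinner_complex_def algebra_simps scaleR_conv_of_real
      inner_complex_def)

end

text \<open>
  Elements of \<open>'h \<Rightarrow>\<^sub>L 'h\<close> are bounded and real-linear; the bounded operators on the complex
  Hilbert space are those which are moreover \<open>complex_linear\<close>.
\<close>

definition complex_linear :: "('h::complex_hilbert \<Rightarrow>\<^sub>L 'h) \<Rightarrow> bool"
  where "complex_linear x \<longleftrightarrow> (\<forall>c u. blinfun_apply x (c *\<^sub>C u) = c *\<^sub>C blinfun_apply x u)"

definition compact_operator :: "('h::complex_hilbert \<Rightarrow>\<^sub>L 'h) \<Rightarrow> bool"
  where "compact_operator x \<longleftrightarrow> complex_linear x \<and> compact (closure (blinfun_apply x ` cball 0 1))"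

definition positive_operator :: "('h::complex_hilbert \<Rightarrow>\<^sub>L 'h) \<Rightarrow> bool"
  where "positive_operator x \<longleftrightarrow> complex_linear x \<and>
    (\<forall>u. cinner (blinfun_apply x u) u \<in> \<real> \<and> 0 \<le> Re (cinner (blinfun_apply x u) u))"

definition adjoint_operator :: "('h::complex_hilbert \<Rightarrow>\<^sub>L 'h) \<Rightarrow> ('h \<Rightarrow>\<^sub>L 'h)"
  where "adjoint_operator x =
    (THE y. \<forall>u v. cinner (blinfun_apply x u) v = cinner u (blinfun_apply y v))"

text \<open>
  The singular values of \<open>x\<close> are the square roots of the eigenvalues of \<open>x\<^sup>* x\<close>, each with the
  (complex) dimension of the eigenspace as multiplicity. The value \<open>0\<close> is left out, as it does
  not contribute to the sums below. For compact \<open>x\<close> the multiplicities of the remaining ones are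
  finite, so that the convention \<open>cdim S = 0\<close> for infinite-dimensional \<open>S\<close> plays no role.
\<close>

definition singular_space :: "('h::complex_hilbert \<Rightarrow>\<^sub>L 'h) \<Rightarrow> real \<Rightarrow> 'h set"
  where "singular_space x s =
    {u. blinfun_apply (adjoint_operator x o\<^sub>L x) u = complex_of_real (s\<^sup>2) *\<^sub>C u}"

definition singular_values :: "('h::complex_hilbert \<Rightarrow>\<^sub>L 'h) \<Rightarrow> real set"
  where "singular_values x = {s. 0 < s \<and> (\<exists>u \<in> singular_space x s. u \<noteq> 0)}"

definition singular_mult :: "('h::complex_hilbert \<Rightarrow>\<^sub>L 'h) \<Rightarrow> real \<Rightarrow> nat"
  where "singular_mult x s = cdim (singular_space x s)"

definition schatten_class :: "real \<Rightarrow> ('h::complex_hilbert \<Rightarrow>\<^sub>L 'h) set"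
  where "schatten_class p = {x. compact_operator x \<and>
    (\<lambda>s. real (singular_mult x s) * s powr p) summable_on singular_values x}"

definition schatten_norm :: "real \<Rightarrow> ('h::complex_hilbert \<Rightarrow>\<^sub>L 'h) \<Rightarrow> real"
  where "schatten_norm p x =
    (\<Sum>\<^sub>\<infinity>s\<in>singular_values x. real (singular_mult x s) * s powr p) powr (1 / p)"

definition schatten_pos_sphere :: "real \<Rightarrow> ('h::complex_hilbert \<Rightarrow>\<^sub>L 'h) set"
  where "schatten_pos_sphere p =
    {x \<in> schatten_class p. positive_operator x \<and> schatten_norm p x = 1}"

definition schatten_isometry_onto ::
    "real \<Rightarrow> ('h::complex_hilbert \<Rightarrow>\<^sub>L 'h) set \<Rightarrow> ('k::complex_hilbert \<Rightarrow>\<^sub>L 'k) set \<Rightarrow>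
      (('h \<Rightarrow>\<^sub>L 'h) \<Rightarrow> ('k \<Rightarrow>\<^sub>L 'k)) \<Rightarrow> bool"
  where "schatten_isometry_onto p A B f \<longleftrightarrow> f ` A = B \<and>
    (\<forall>x\<in>A. \<forall>y\<in>A. schatten_norm p (f x - f y) = schatten_norm p (x - y))"

definition real_linear_on ::
    "'a::real_vector set \<Rightarrow> ('a \<Rightarrow> 'b::real_vector) \<Rightarrow> bool"
  where "real_linear_on A f \<longleftrightarrow>
    (\<forall>x\<in>A. \<forall>y\<in>A. f (x + y) = f x + f y) \<and> (\<forall>r. \<forall>x\<in>A. f (r *\<^sub>R x) = r *\<^sub>R f x)"

end

theory Submission imports Defs begin

text \<open>
  Two points of the positive sphere are at the maximal distance \<open>2 powr (1 / p)\<close> iff their product is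
  \<open>0\<close>, because the positive and negative parts of \<open>x - y\<close> are dominated, eigenvalue by eigenvalue, by
  \<open>x\<close> and \<open>y\<close>. So a surjective isometry preserves orthogonality; it therefore maps the rank-one
  projections \<open>P u\<close> (below \<open>rank_one u\<close>) onto rank-one projections, and since \<open>\<parallel>P u - P v\<parallel>\<close>
  determines \<open>\<bar>\<langle>u, v\<rangle>\<bar>\<close>, it is given on them by a unitary or antiunitary map, by Wigner's theorem. After conjugating with that map, all \<open>P u\<close> are fixed. A
  finite-rank \<open>x\<close> and its image then have the same support and the same distances to all \<open>P u\<close>.
  A maximizer \<open>u\<close> of this distance on an invariant subspace must be an eigenvector of both
  (by Klein's inequality, as \<open>x - P u\<close> has only one negative eigenvalue), the distance at \<open>u\<close> gives the
  eigenvalue, and one continues on the orthogonal complement. Finite-rank elements are dense.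
\<close>

section \<open>Complex Hilbert spaces\<close>

text \<open>The exponent shapes the argument. For \<open>p < 1\<close> there is no triangle
  inequality, for \<open>p = 1\<close> the norm is not strictly convex, and for
  \<open>p \<le> 1\<close> the function \<open>\<bar>t\<bar> powr p\<close> has no derivative at
  \<open>0\<close>. So distances are never added; eigenvalues are counted above levels, and only
  quadratic forms are added. Distances to projections are studied at a maximum because there a lower
  bound for nearby values suffices, and the graph of \<open>\<bar>t\<bar> powr p\<close> is touched
  from below by a (possibly degenerate) parabola at every point, the cusp included. Klein's
  inequality lifts this scalar bound to traces without differentiating eigenvalues. The slope of the
  parabola need not determine the eigenvalue (for \<open>p = 1\<close> it is a mere sign), hence the
  recourse to the single negative eigenvalue. Maxima need compact unit spheres, hence finite rank
  first. The distance at an eigenvector recovers the eigenvalue \<open>a\<close> because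
  \<open>1 - a powr p + (1 - a) powr p\<close> is strictly decreasing on \<open>[0, 1]\<close>.
  Without separability, eigenvectors come as orthonormal sets from Zorn's lemma, and sums over them
  are unordered.\<close>

lemma cinner_scaleC_right: "cinner u (c *\<^sub>C v) = cnj c * cinner u v"
  by (metis cinner_commute cinner_scaleC_left complex_cnj_mult)

lemma cinner_self: "cinner u u = complex_of_real ((norm u)\<^sup>2)"
proof -
  have "Im (cinner u u) = 0"
    using cinner_commute[of u u] by (metis add.inverse_inverse cnj.simps(2) equal_neg_zero)
  then show ?thesis
    by (simp add: complex_eq_iff inner_eq_Re_cinner[symmetric] power2_norm_eq_inner)
qed

lemma norm_scaleC: "norm (c *\<^sub>C (u::'a::complex_hilbert)) = cmod c * norm u"
proof -
  have "complex_of_real ((norm (c *\<^sub>C u))\<^sup>2) = complex_of_real ((cmod c * norm u)\<^sup>2)"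
    by (simp only: cinner_self[of "c *\<^sub>C u", symmetric] cinner_scaleC_left cinner_scaleC_right
        cinner_self[of u] power_mult_distrib of_real_mult complex_norm_square[of c] mult_ac)
  then show ?thesis
    by (metis norm_ge_zero of_real_eq_iff power2_eq_imp_eq zero_le_mult_iff)
qed

lemma cmod_cinner_le: "cmod (cinner u v) \<le> norm u * norm v"
proof (cases "cinner u v = 0")
  case False
  \<comment> \<open>The phase that turns \<open>cinner u v\<close> into its modulus, so that the
    real Cauchy-Schwarz inequality applies.\<close>
  define c where "c = cnj (cinner u v) / cmod (cinner u v)"
  have c: "cmod c = 1" using False by (simp add: c_def norm_divide)
  have "cinner (c *\<^sub>C u) v = cmod (cinner u v)"
    using False
    by (simp add: cinner_scaleC_left c_def field_simps complex_norm_square[symmetric] power2_eq_square)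
  then have "cmod (cinner u v) = inner (c *\<^sub>C u) v" by (simp add: inner_eq_Re_cinner)
  also have "\<dots> \<le> norm (c *\<^sub>C u) * norm v" by (rule norm_cauchy_schwarz)
  finally show ?thesis by (simp add: norm_scaleC c)
qed simp

text \<open>Real scalars do not see the conjugation in the second argument, so as a real-bilinear
  form \<open>cinner\<close> inherits the rules for sums, limits and continuity.\<close>

interpretation cinner: bounded_bilinear "cinner :: 'a::complex_hilbert \<Rightarrow> 'a \<Rightarrow> complex"
proof
  show "cinner (a + a') b = cinner a b + cinner a' b" for a a' b :: 'a by (rule cinner_add_left)
  show "cinner a (b + b') = cinner a b + cinner a b'" for a b b' :: 'a
    by (metis cinner_add_left cinner_commute complex_cnj_add)
  show "cinner (r *\<^sub>R a) b = r *\<^sub>R cinner a b" for r and a b :: 'a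
    by (simp add: scaleR_scaleC[of _ a] cinner_scaleC_left scaleR_conv_of_real)
  show "cinner a (r *\<^sub>R b) = r *\<^sub>R cinner a b" for r and a b :: 'a
    by (simp add: scaleR_scaleC[of _ b] cinner_scaleC_right scaleR_conv_of_real)
  show "\<exists>K. \<forall>(a::'a) b. norm (cinner a b) \<le> norm a * norm b * K"
    using cmod_cinner_le by (metis mult.right_neutral)
qed

interpretation scaleC: bounded_bilinear "scaleC :: complex \<Rightarrow> 'a::complex_hilbert \<Rightarrow> 'a"
proof
  show "(r *\<^sub>R a) *\<^sub>C b = r *\<^sub>R a *\<^sub>C b" for r a and b :: 'a
    by (simp only: scaleR_scaleC[of r "a *\<^sub>C b"] scaleC_scaleC scaleR_conv_of_real)
  show "a *\<^sub>C (r *\<^sub>R b) = r *\<^sub>R (a *\<^sub>C b)" for r a and b :: 'a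
    by (simp only: scaleR_scaleC[of _ b] scaleR_scaleC[of _ "a *\<^sub>C b"] scaleC_scaleC mult.commute)
  show "\<exists>K. \<forall>a (b::'a). norm (a *\<^sub>C b) \<le> norm a * norm b * K"
    by (intro exI[of _ 1]) (simp add: norm_scaleC)
qed (simp_all add: scaleC_add_left scaleC_add_right)

lemma cinner_scaleR_left: "cinner (r *\<^sub>R u) v = complex_of_real r * cinner u v"
  by (simp add: cinner.scaleR_left scaleR_conv_of_real)

lemma cinner_scaleR_right: "cinner u (r *\<^sub>R v) = complex_of_real r * cinner u v"
  by (simp add: cinner.scaleR_right scaleR_conv_of_real)

lemma scaleC_scaleR: "c *\<^sub>C (r *\<^sub>R u) = r *\<^sub>R (c *\<^sub>C (u::'a::complex_hilbert))"
  by (rule scaleC.scaleR_right)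

lemma cinner_eq_zero_commute: "cinner u v = 0 \<longleftrightarrow> cinner v u = 0"
  by (metis cinner_commute complex_cnj_zero_iff)

lemma cmod_cinner_commute: "cmod (cinner u v) = cmod (cinner v u)"
  by (metis cinner_commute complex_mod_cnj)

lemma cinner_mult_commute: "cinner u v * cinner v u = complex_of_real ((cmod (cinner u v))\<^sup>2)"
  by (metis cinner_commute complex_norm_square)

text \<open>The remainder of \<open>u\<close> after projection onto the unit vector \<open>v\<close>
  has squared norm \<open>(norm u)^2 - (cmod (cinner u v))^2\<close>.\<close>

lemma cauchy_schwarz_equality:
  assumes "cmod (cinner u v) = norm u * norm v" "norm v = 1"
  shows "u = cinner u v *\<^sub>C v"
proof -
  define c where "c = cinner u v"
  have vu: "cinner v u = cnj c" by (simp add: c_def cinner_commute[of v u])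
  have "cinner (u - c *\<^sub>C v) (u - c *\<^sub>C v) = cinner u u - c * cnj c"
    using assms(2)
    by (simp add: cinner.diff_left cinner.diff_right cinner_scaleC_left cinner_scaleC_right
        cinner_self[of v] vu c_def[symmetric])
  also have "\<dots> = 0"
    using assms by (simp add: cinner_self complex_norm_square[symmetric] c_def)
  finally show ?thesis by (simp add: cinner_self c_def)
qed

section \<open>The Riesz representation and adjoints\<close>

lemma riesz_representation:
  fixes f :: "'a::{real_inner,complete_space} \<Rightarrow> real"
  assumes "bounded_linear f"
  shows "\<exists>y. \<forall>u. f u = inner u y"
proof -
  interpret f: bounded_linear f by fact
  define N where "N = onorm f"
  \<comment> \<open>Variational choice: at a minimizer \<open>y\<close> the derivative
    \<open>inner z y - f z\<close> vanishes in every direction \<open>z\<close>.\<close>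
  define g where "g u = inner u u / 2 - f u" for u
  have fN: "\<bar>f u\<bar> \<le> N * norm u" for u
    using onorm[OF assms, of u] by (simp add: N_def)
  have "g u \<ge> - (N\<^sup>2 / 2)" for u
  proof -
    have "0 \<le> (norm u - N)\<^sup>2" by simp
    moreover have "f u \<le> N * norm u" using fN[of u] by linarith
    ultimately show ?thesis
      unfolding g_def power2_norm_eq_inner[symmetric] power2_diff by (simp add: mult.commute)
  qed
  then have bdd: "bdd_below (range g)" by (metis bdd_belowI2)
  define m where "m = Inf (range g)"
  have mle: "m \<le> g u" for u unfolding m_def by (rule cInf_lower) (use bdd in auto)
  have "\<exists>u. g u < m + 1 / real (Suc n)" for n
  proof -
    have "Inf (range g) < m + 1 / real (Suc n)" by (simp add: m_def)
    then show ?thesis using cInf_lessD[of "range g"] by blast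
  qed
  then obtain u where u: "\<And>n. g (u n) < m + 1 / real (Suc n)" by metis
  \<comment> \<open>Parallelogram law: the midpoint has value at least \<open>m\<close> too, so
    minimizing sequences are Cauchy.\<close>
  have par: "(norm (v - w))\<^sup>2 \<le> 4 * (g v + g w - 2 * m)" for v w
  proof -
    have "(norm (v - w))\<^sup>2 / 8 = (g v + g w) / 2 - g ((1/2) *\<^sub>R (v + w))"
      by (simp add: g_def f.add f.scaleR power2_norm_eq_inner inner_simps inner_commute[of w v]
          add_divide_distrib diff_divide_distrib)
    then show ?thesis using mle[of "(1/2) *\<^sub>R (v + w)"] by (simp add: field_simps)
  qed
  have "Cauchy u"
  proof (rule metric_CauchyI)
    fix e :: real assume e: "0 < e"
    \<comment> \<open>Each of the two values exceeds \<open>m\<close> by less than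
      \<open>e^2 / 8\<close>, and \<open>par\<close> multiplies their sum by
      \<open>4\<close>.\<close>
    obtain M where M: "inverse (real (Suc M)) < e\<^sup>2 / 8"
      using reals_Archimedean[of "e\<^sup>2 / 8"] e by auto
    have "dist (u n) (u k) < e" if "n \<ge> M" "k \<ge> M" for n k
    proof -
      have *: "1 / real (Suc j) \<le> inverse (real (Suc M))" if "j \<ge> M" for j
        using that by (simp add: field_simps)
      have "(norm (u n - u k))\<^sup>2 \<le> 4 * (g (u n) + g (u k) - 2 * m)" by (rule par)
      also have "\<dots> < e\<^sup>2" using u[of n] u[of k] M *[OF that(1)] *[OF that(2)]
        by (simp only: right_diff_distrib distrib_left)
      finally show ?thesis using e by (simp add: dist_norm power2_less_imp_less)
    qed
    then show "\<exists>M. \<forall>n\<ge>M. \<forall>k\<ge>M. dist (u n) (u k) < e" by blast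
  qed
  then obtain y where y: "u \<longlonglongrightarrow> y" using Cauchy_convergent convergent_def by blast
  have "(\<lambda>n. g (u n)) \<longlonglongrightarrow> g y"
    unfolding g_def by (intro tendsto_intros y f.tendsto) auto
  moreover have "(\<lambda>n. g (u n)) \<longlonglongrightarrow> m"
  proof (rule tendsto_sandwich[where f = "\<lambda>_. m"])
    show "(\<lambda>n. m + 1 / real (Suc n)) \<longlonglongrightarrow> m"
      using tendsto_add[OF tendsto_const LIMSEQ_inverse_real_of_nat, of m]
      by (simp only: inverse_eq_divide add_0_right)
    show "\<forall>\<^sub>F n in sequentially. m \<le> g (u n)" using mle by simp
    show "\<forall>\<^sub>F n in sequentially. g (u n) \<le> m + 1 / real (Suc n)"
      using u by (intro always_eventually allI less_imp_le)
  qed simp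
  ultimately have gy: "g y = m" by (rule LIMSEQ_unique)
  have "f z = inner z y" for z
  proof (cases "z = 0")
    case False
    define d where "d = inner z y - f z"
    \<comment> \<open>Minimizes the quadratic polynomial
      \<open>t \<mapsto> g (y + t *\<^sub>R z)\<close>, whose linear coefficient is
      \<open>d\<close>.\<close>
    define t where "t = - d / (norm z)\<^sup>2"
    have "g (y + t *\<^sub>R z) = g y + t * d + t\<^sup>2 * (norm z)\<^sup>2 / 2"
      unfolding power2_norm_eq_inner
      by (simp add: g_def d_def f.add f.scaleR inner_simps inner_commute[of y z]
          algebra_simps power2_eq_square)
    then have "0 \<le> t * d + t\<^sup>2 * (norm z)\<^sup>2 / 2" using mle[of "y + t *\<^sub>R z"] gy by simp
    also have "\<dots> = - (d\<^sup>2 / (2 * (norm z)\<^sup>2))"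
      using False by (simp add: t_def field_simps power2_eq_square)
    finally have "d\<^sup>2 / (2 * (norm z)\<^sup>2) \<le> 0" by simp
    then have "d = 0" using False by (auto simp: divide_le_0_iff)
    then show ?thesis by (simp add: d_def)
  qed (simp add: f.zero)
  then show ?thesis by blast
qed

lemma cinner_eqI:
  assumes "\<And>v. cinner u v = cinner w v" shows "u = w"
proof -
  have "cinner (u - w) (u - w) = 0" using assms by (simp add: cinner.diff_left)
  then show ?thesis by (simp add: cinner_self)
qed

lemma cinner_eqI_right:
  assumes "\<And>v. cinner v u = cinner v w" shows "u = w"
  using assms cinner_commute cinner_eqI by metis

lemma cinner_eq_inner: "cinner u v = Complex (inner u v) (inner u (\<i> *\<^sub>C v))"
  by (simp add: complex_eq_iff inner_eq_Re_cinner cinner_scaleC_right)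

text \<open>Riesz for the real inner product matches the real parts only; testing with
  \<open>\<i> *\<^sub>C v\<close> and using complex linearity of \<open>x\<close> recovers the
  imaginary parts.\<close>

lemma adjoint_exists:
  assumes "complex_linear x"
  shows "\<exists>y. \<forall>u v. cinner (blinfun_apply x u) v = cinner u (blinfun_apply y v)"
proof -
  have "\<exists>w. \<forall>u. inner (blinfun_apply x u) v = inner u w" for v
    by (rule riesz_representation) (simp add: bounded_linear_compose[OF bounded_linear_inner_left blinfun.bounded_linear_right])
  then obtain h where h: "\<And>u v. inner (blinfun_apply x u) v = inner u (h v)" by metis
  have c: "cinner (blinfun_apply x u) v = cinner u (h v)" for u v
  proof -
    have "inner (blinfun_apply x u) (\<i> *\<^sub>C v) = - inner (blinfun_apply x (\<i> *\<^sub>C u)) v"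
      using assms
      by (simp add: complex_linear_def inner_eq_Re_cinner cinner_scaleC_left cinner_scaleC_right)
    also have "\<dots> = inner u (\<i> *\<^sub>C h v)"
      unfolding h by (simp add: inner_eq_Re_cinner cinner_scaleC_left cinner_scaleC_right)
    finally show ?thesis by (simp add: cinner_eq_inner h)
  qed
  have "bounded_linear h"
  proof (rule bounded_linear_intro)
    show "h (v + w) = h v + h w" for v w
      by (rule cinner_eqI_right) (simp add: c[symmetric] cinner.add_right)
    show "h (r *\<^sub>R v) = r *\<^sub>R h v" for r v
      by (rule cinner_eqI_right) (simp add: c[symmetric] cinner.scaleR_right)
    show "norm (h v) \<le> norm v * norm x" for v
    proof -
      have "norm (h v) * norm (h v) = inner (blinfun_apply x (h v)) v"
        by (simp add: h power2_norm_eq_inner[symmetric] power2_eq_square)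
      also have "\<dots> \<le> norm (blinfun_apply x (h v)) * norm v" by (rule norm_cauchy_schwarz)
      also have "\<dots> \<le> norm (h v) * (norm v * norm x)"
        using mult_right_mono[OF norm_blinfun[of x "h v"] norm_ge_zero[of v]] by (simp add: mult_ac)
      finally show ?thesis
        by (cases "h v = 0") (simp_all add: mult_le_cancel_left)
    qed
  qed
  then show ?thesis using c by (intro exI[of _ "Blinfun h"]) (simp add: bounded_linear_Blinfun_apply)
qed

lemma adjoint_operator_eqI:
  assumes "\<And>u v. cinner (blinfun_apply x u) v = cinner u (blinfun_apply y v)"
  shows "adjoint_operator x = y"
  unfolding adjoint_operator_def
proof (rule the_equality)
  fix z assume z: "\<forall>u v. cinner (blinfun_apply x u) v = cinner u (blinfun_apply z v)"
  have "cinner u (blinfun_apply z v) = cinner u (blinfun_apply y v)" for u v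
    using z assms by metis
  then show "z = y" by (metis blinfun_eqI cinner_eqI_right)
qed (use assms in blast)

lemma cinner_adjoint:
  assumes "complex_linear x"
  shows "cinner (blinfun_apply x u) v = cinner u (blinfun_apply (adjoint_operator x) v)"
  using adjoint_exists[OF assms] adjoint_operator_eqI by metis

section \<open>Self-adjoint compact operators\<close>

text \<open>Stated through the form and not through \<open>adjoint_operator\<close>: it makes sense
  for every bounded real-linear map, and complex linearity becomes a consequence.\<close>

definition self_adjoint :: "('h::complex_hilbert \<Rightarrow>\<^sub>L 'h) \<Rightarrow> bool"
  where "self_adjoint A \<longleftrightarrow> (\<forall>u v. cinner (A u) v = cinner u (A v))"

lemma self_adjointD: "self_adjoint A \<Longrightarrow> cinner (blinfun_apply A u) v = cinner u (blinfun_apply A v)"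
  by (simp add: self_adjoint_def)

lemma self_adjoint_inner: "self_adjoint A \<Longrightarrow> inner (blinfun_apply A u) v = inner u (blinfun_apply A v)"
  by (simp add: inner_eq_Re_cinner self_adjointD)

lemma self_adjoint_complex_linear:
  assumes "self_adjoint A" shows "complex_linear A"
  unfolding complex_linear_def
proof (intro allI)
  fix c u
  show "A (c *\<^sub>C u) = c *\<^sub>C A u"
    by (rule cinner_eqI) (simp add: self_adjointD[OF assms] cinner_scaleC_left)
qed

lemma self_adjoint_scaleC: "self_adjoint A \<Longrightarrow> blinfun_apply A (c *\<^sub>C u) = c *\<^sub>C blinfun_apply A u"
  using self_adjoint_complex_linear complex_linear_def by blast

lemma self_adjoint_adjoint: "self_adjoint A \<Longrightarrow> adjoint_operator A = A"
  by (rule adjoint_operator_eqI) (rule self_adjointD)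

lemma self_adjoint_diff: "self_adjoint A \<Longrightarrow> self_adjoint B \<Longrightarrow> self_adjoint (A - B)"
  by (simp add: self_adjoint_def blinfun.diff_left cinner.diff_left cinner.diff_right)

lemma self_adjoint_add: "self_adjoint A \<Longrightarrow> self_adjoint B \<Longrightarrow> self_adjoint (A + B)"
  by (simp add: self_adjoint_def blinfun.add_left cinner.add_left cinner.add_right)

lemma self_adjoint_scaleR: "self_adjoint A \<Longrightarrow> self_adjoint (r *\<^sub>R A)"
  by (simp add: self_adjoint_def blinfun.scaleR_left cinner.scaleR_left cinner.scaleR_right)

lemma self_adjoint_uminus: "self_adjoint A \<Longrightarrow> self_adjoint (- A)"
  by (simp add: self_adjoint_def blinfun.minus_left cinner.minus_left cinner.minus_right)

lemma self_adjoint_zero: "self_adjoint 0"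
  by (simp add: self_adjoint_def cinner.zero_left cinner.zero_right)

lemma self_adjoint_sum: "(\<And>i. i \<in> I \<Longrightarrow> self_adjoint (A i)) \<Longrightarrow> self_adjoint (sum A I)"
  by (induction I rule: infinite_finite_induct) (simp_all add: self_adjoint_zero self_adjoint_add)

lemma self_adjoint_cinner_real:
  "self_adjoint A \<Longrightarrow> cinner (blinfun_apply A u) u = complex_of_real (inner (blinfun_apply A u) u)"
  using cinner_commute[of u "blinfun_apply A u"] self_adjointD[of A u u]
  by (simp add: complex_eq_iff inner_eq_Re_cinner)

text \<open>A real form forces symmetry over the complex numbers: the defect \<open>S\<close>
  vanishes on the diagonal, and polarizing with \<open>u\<close> and with
  \<open>\<i> *\<^sub>C u\<close> yields \<open>S u v + S v u = 0\<close> and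
  \<open>S u v - S v u = 0\<close>.\<close>

lemma positive_operator_iff:
  "positive_operator A \<longleftrightarrow> self_adjoint A \<and> (\<forall>u. 0 \<le> inner (blinfun_apply A u) u)"
proof
  assume A: "positive_operator A"
  then have lin: "A (c *\<^sub>C u) = c *\<^sub>C A u" for c u
    by (simp add: positive_operator_def complex_linear_def)
  define S where "S u v = cinner (A u) v - cinner u (A v)" for u v
  have S0: "S u u = 0" for u
  proof -
    have "cinner (A u) u \<in> \<real>" using A by (simp add: positive_operator_def)
    then have "cnj (cinner (A u) u) = cinner (A u) u" by (simp add: Reals_cnj_iff)
    then show ?thesis using cinner_commute[of u "A u"] by (simp add: S_def)
  qed
  have "S u v = 0" for u v
  proof -
    have add: "S (a + b) (a + b) = S a a + S a b + S b a + S b b" for a b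
      by (simp add: S_def blinfun.add_right cinner.add_left cinner.add_right)
    have "S u v + S v u = 0" using add[of u v] by (simp add: S0)
    moreover have "S (\<i> *\<^sub>C u) v + S v (\<i> *\<^sub>C u) = 0" using add[of "\<i> *\<^sub>C u" v] by (simp add: S0)
    then have "\<i> * (S u v - S v u) = 0"
      by (simp add: S_def lin cinner_scaleC_left cinner_scaleC_right algebra_simps)
    ultimately show ?thesis by simp
  qed
  then show "self_adjoint A \<and> (\<forall>u. 0 \<le> inner (A u) u)"
    using A by (simp add: S_def self_adjoint_def positive_operator_def inner_eq_Re_cinner)
next
  assume "self_adjoint A \<and> (\<forall>u. 0 \<le> inner (A u) u)"
  then show "positive_operator A"
    by (metis Reals_of_real inner_eq_Re_cinner positive_operator_def self_adjoint_cinner_real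
        self_adjoint_complex_linear)
qed

text \<open>Testing nonnegativity of the form at \<open>v - (1/K) B v\<close> with \<open>K > \<parallel>B\<parallel>\<close>.\<close>

lemma norm_le_nonneg_form:
  fixes B :: "'a::real_inner \<Rightarrow>\<^sub>L 'a"
  assumes sym: "\<And>u v. inner (B u) v = inner u (B v)"
    and S: "subspace S" "\<And>v. v \<in> S \<Longrightarrow> B v \<in> S"
    and pos: "\<And>v. v \<in> S \<Longrightarrow> 0 \<le> inner (B v) v" and v: "v \<in> S"
  shows "(norm (B v))\<^sup>2 \<le> (norm B + 1) * inner (B v) v"
proof -
  define K where "K = norm B + 1"
  have K: "K > 0" by (simp add: K_def add_nonneg_pos)
  define N where "N = inner (B v) (B v)"
  have N0: "N \<ge> 0" by (simp add: N_def)
  have "v - (1/K) *\<^sub>R B v \<in> S" using S v by (simp add: subspace_diff subspace_scale)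
  from pos[OF this] have "0 \<le> inner (B v) v - 2 * N / K + inner (B (B v)) (B v) / K\<^sup>2"
    by (simp add: blinfun.diff_right blinfun.scaleR_right inner_simps sym[of "B v" v] N_def
        power2_eq_square diff_divide_distrib)
  moreover have "inner (B (B v)) (B v) \<le> K * N"
  proof -
    have "inner (B (B v)) (B v) \<le> norm (B (B v)) * norm (B v)" by (rule norm_cauchy_schwarz)
    also have "\<dots> \<le> (norm B * norm (B v)) * norm (B v)"
      by (intro mult_right_mono norm_blinfun norm_ge_zero)
    also have "\<dots> = norm B * N" by (simp add: N_def power2_norm_eq_inner[symmetric] power2_eq_square)
    also have "\<dots> \<le> K * N" using N0 by (simp add: K_def mult_right_mono)
    finally show ?thesis .
  qed
  then have "inner (B (B v)) (B v) / K\<^sup>2 \<le> N / K"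
    using K by (simp add: field_simps power2_eq_square)
  ultimately have "N / K \<le> inner (B v) v" by simp
  then show ?thesis using K by (simp add: field_simps N_def K_def power2_norm_eq_inner)
qed

text \<open>A zero of a nonnegative form is a minimum, and the preceding estimate turns it into the
  linear equation \<open>B v = 0\<close>. Later extremal arguments use this in place of a
  derivative.\<close>

lemma zero_form_imp_zero:
  fixes B :: "'a::real_inner \<Rightarrow>\<^sub>L 'a"
  assumes "\<And>u v. inner (B u) v = inner u (B v)" "subspace S" "\<And>v. v \<in> S \<Longrightarrow> B v \<in> S"
    "\<And>v. v \<in> S \<Longrightarrow> 0 \<le> inner (B v) v" "v \<in> S" "inner (B v) v = 0"
  shows "B v = 0"
  using norm_le_nonneg_form[OF assms(1-5)] assms(6) by simp

lemma positive_zero_form: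
  assumes "positive_operator x" "inner (blinfun_apply x v) v = 0"
  shows "blinfun_apply x v = 0"
  by (rule zero_form_imp_zero[of x UNIV])
     (use assms in \<open>auto simp: positive_operator_iff self_adjoint_inner\<close>)

section \<open>Compact operators and the existence of eigenvectors\<close>

lemma compact_operator_subseq:
  assumes "compact_operator A" "\<And>n. norm (v n) \<le> 1"
  obtains l r where "strict_mono (r :: nat \<Rightarrow> nat)" "(\<lambda>n. blinfun_apply A (v (r n))) \<longlonglongrightarrow> l"
proof -
  have "seq_compact (closure (A ` cball 0 1))"
    using assms(1) by (simp add: compact_operator_def compact_imp_seq_compact)
  moreover have "\<forall>n. A (v n) \<in> closure (A ` cball 0 1)"
    using assms(2) closure_subset by fastforce
  ultimately obtain l r where "strict_mono r" "((\<lambda>n. A (v n)) \<circ> r) \<longlonglongrightarrow> l"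
    by (rule seq_compactE)
  then show ?thesis using that by (simp add: comp_def)
qed

lemma compact_closure_subset:
  fixes K :: "'a::t2_space set"
  assumes "compact K" "X \<subseteq> K" shows "compact (closure X)"
proof -
  have "closure X \<subseteq> K" using assms by (simp add: closure_minimal compact_imp_closed)
  then show ?thesis using compact_Int_closed[OF assms(1) closed_closure, of X] by (simp add: Int_absorb1)
qed

lemma compact_operator_diff:
  assumes "compact_operator A" "compact_operator B"
  shows "compact_operator (A - B)"
proof -
  let ?K = "{u - v | u v. u \<in> closure (A ` cball 0 1) \<and> v \<in> closure (B ` cball 0 1)}"
  have K: "compact ?K"
    using assms compact_differences unfolding compact_operator_def by blast
  have "(A - B) ` cball 0 1 \<subseteq> ?K"
    by (auto simp: blinfun.diff_left intro!: closure_subset[THEN subsetD])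
  then have "compact (closure ((A - B) ` cball 0 1))" by (rule compact_closure_subset[OF K])
  then show ?thesis using assms
    by (auto simp: compact_operator_def complex_linear_def blinfun.diff_left scaleC.diff_right)
qed

lemma compact_operator_zero: "compact_operator 0"
proof -
  have "blinfun_apply (0 :: 'a \<Rightarrow>\<^sub>L 'a) ` cball 0 1 = {0}" by (auto intro!: image_eqI[of _ _ 0])
  then show ?thesis by (simp add: compact_operator_def complex_linear_def)
qed

lemma compact_operator_uminus: "compact_operator A \<Longrightarrow> compact_operator (- A)"
  using compact_operator_diff[OF compact_operator_zero] by simp

lemma compact_operator_add: "compact_operator A \<Longrightarrow> compact_operator B \<Longrightarrow> compact_operator (A + B)"
  using compact_operator_diff[OF _ compact_operator_uminus, of A B] by simp

lemma compact_operator_sum: "(\<And>i. i \<in> I \<Longrightarrow> compact_operator (A i)) \<Longrightarrow> compact_operator (sum A I)"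
  by (induction I rule: infinite_finite_induct) (simp_all add: compact_operator_zero compact_operator_add)

text \<open>If \<open>v n\<close> is a maximizing sequence for the form on the unit sphere of \<open>S\<close>, with supremum
  \<open>\<mu>\<close>, then \<open>(\<mu> - A) (v n)\<close> tends to \<open>0\<close>, and compactness of \<open>A\<close> yields a limit point because
  \<open>\<mu> \<noteq> 0\<close>.\<close>

lemma exists_eigenvector_above:
  assumes A: "self_adjoint A" "compact_operator A"
    and S: "closed S" "subspace S" "\<And>v. v \<in> S \<Longrightarrow> blinfun_apply A v \<in> S"
    and t: "0 \<le> t" and w: "w \<in> S" "t * (norm w)\<^sup>2 < inner (blinfun_apply A w) w"
  shows "\<exists>e\<in>S. \<exists>\<mu>>t.  norm e = 1 \<and> blinfun_apply A e = \<mu> *\<^sub>R e"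
proof -
  define Q where "Q = {inner (A v) v | v. v \<in> S \<and> norm v = 1}"
  have w0: "w \<noteq> 0" using w by (auto simp: blinfun.zero_right)
  have bdd: "bdd_above Q"
  proof (rule bdd_aboveI)
    fix q assume "q \<in> Q"
    then obtain v where v: "q = inner (A v) v" "norm v = 1" by (auto simp: Q_def)
    have "q \<le> norm (A v) * norm v" using v norm_cauchy_schwarz by blast
    then show "q \<le> norm A" using norm_blinfun[of A v] v by simp
  qed
  define \<mu> where "\<mu> = Sup Q"
  have scale: "inner (A v) v = (norm v)\<^sup>2 * inner (A (v /\<^sub>R norm v)) (v /\<^sub>R norm v)" if "v \<noteq> 0" for v
    using that by (simp add: blinfun.scaleR_right power2_eq_square field_simps)
  have unit: "inner (A (v /\<^sub>R norm v)) (v /\<^sub>R norm v) \<in> Q" if "v \<in> S" "v \<noteq> 0" for v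
    unfolding Q_def using that S(2) by (auto simp: subspace_scale intro!: exI[of _ "v /\<^sub>R norm v"])
  have le: "inner (A v) v \<le> \<mu> * (norm v)\<^sup>2" if "v \<in> S" for v
  proof (cases "v = 0")
    case False
    then have "inner (A (v /\<^sub>R norm v)) (v /\<^sub>R norm v) \<le> \<mu>"
      unfolding \<mu>_def using bdd that unit by (intro cSup_upper) auto
    then show ?thesis
      using scale[OF False] False mult_left_mono[of _ \<mu> "(norm v)\<^sup>2"] by (simp add: mult.commute)
  qed (simp add: blinfun.zero_right)
  have "t * (norm w)\<^sup>2 < \<mu> * (norm w)\<^sup>2" using le[OF w(1)] w(2) by simp
  then have \<mu>t: "\<mu> > t" using w0 by simp
  have "\<exists>v. v \<in> S \<and> norm v = 1 \<and> \<mu> - 1 / real (Suc n) < inner (A v) v" for n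
  proof -
    have "\<mu> - 1 / real (Suc n) < Sup Q" by (simp add: \<mu>_def)
    moreover have "Q \<noteq> {}" using unit w0 w by blast
    ultimately obtain q where "q \<in> Q" "\<mu> - 1 / real (Suc n) < q" using less_cSupD by blast
    then show ?thesis by (auto simp: Q_def)
  qed
  then obtain v where v: "\<And>n. v n \<in> S" "\<And>n. norm (v n) = 1"
    "\<And>n. \<mu> - 1 / real (Suc n) < inner (A (v n)) (v n)" by metis
  \<comment> \<open>As \<open>\<mu>\<close> is the supremum of the form of \<open>A\<close>, the
    form of \<open>B\<close> is nonnegative on \<open>S\<close>; so the norm of
    \<open>B (v n)\<close> is controlled by the form at \<open>v n\<close>, which is at most
    \<open>1 / real (Suc n)\<close>.\<close>
  define B where "B = \<mu> *\<^sub>R id_blinfun - A"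
  have Bv: "B u = \<mu> *\<^sub>R u - A u" for u by (simp add: B_def blinfun.diff_left blinfun.scaleR_left)
  have Bn: "(norm (B (v n)))\<^sup>2 \<le> (norm B + 1) * (1 / real (Suc n))" for n
  proof -
    have "(norm (B (v n)))\<^sup>2 \<le> (norm B + 1) * inner (B (v n)) (v n)"
    proof (rule norm_le_nonneg_form[where S = S])
      show "inner (B u) w = inner u (B w)" for u w
        by (simp add: Bv inner_simps self_adjoint_inner[OF A(1)])
      show "0 \<le> inner (B u) u" if "u \<in> S" for u
        using le[OF that] by (simp add: Bv inner_simps power2_norm_eq_inner)
    qed (use S v in \<open>simp_all add: Bv subspace_diff subspace_scale\<close>)
    also have "inner (B (v n)) (v n) \<le> 1 / real (Suc n)"
      using v(3)[of n] v(2)[of n] by (simp add: Bv inner_simps power2_norm_eq_inner[symmetric])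
    finally show ?thesis by (simp add: mult_left_mono add_nonneg_nonneg)
  qed
  have B0: "(\<lambda>n. B (v n)) \<longlonglongrightarrow> 0"
  proof -
    have "(\<lambda>n. (norm B + 1) * (1 / real (Suc n))) \<longlonglongrightarrow> 0"
      using tendsto_mult_right_zero[OF LIMSEQ_inverse_real_of_nat] by (simp add: inverse_eq_divide)
    then have "(\<lambda>n. (norm (B (v n)))\<^sup>2) \<longlonglongrightarrow> 0"
      by (rule tendsto_sandwich[where f = "\<lambda>_. 0", rotated -1]) (use Bn in auto)
    then have "(\<lambda>n. sqrt ((norm (B (v n)))\<^sup>2)) \<longlonglongrightarrow> sqrt 0" by (rule tendsto_real_sqrt)
    then show ?thesis by (simp add: tendsto_norm_zero_iff)
  qed
  obtain l r where r: "strict_mono (r :: nat \<Rightarrow> nat)" and l: "(\<lambda>n. A (v (r n))) \<longlonglongrightarrow> l"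
    using compact_operator_subseq[OF A(2)] v(2) by (metis order_refl)
  have Br: "(\<lambda>n. B (v (r n))) \<longlonglongrightarrow> 0" using LIMSEQ_subseq_LIMSEQ[OF B0 r] by (simp add: comp_def)
  \<comment> \<open>Since \<open>\<mu> *\<^sub>R v = B v + A v\<close>, convergence of
    \<open>A (v (r n))\<close> carries over to the vectors themselves.\<close>
  define e where "e = l /\<^sub>R \<mu>"
  have \<mu>0: "\<mu> > 0" using \<mu>t t by simp
  have ve: "(\<lambda>n. v (r n)) \<longlonglongrightarrow> e"
  proof -
    have "(\<lambda>n. (B (v (r n)) + A (v (r n))) /\<^sub>R \<mu>) \<longlonglongrightarrow> (0 + l) /\<^sub>R \<mu>"
      by (intro tendsto_intros Br l)
    then show ?thesis using \<mu>0 by (simp add: Bv e_def)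
  qed
  have "e \<in> S" by (rule closed_sequentially[OF S(1) v(1) ve])
  moreover have "norm e = 1"
    using tendsto_norm[OF ve] v(2) by (simp add: LIMSEQ_const_iff)
  moreover have "B e = 0"
  proof -
    have "(\<lambda>n. B (v (r n))) \<longlonglongrightarrow> B e"
      by (intro blinfun.tendsto tendsto_const ve)
    with Br show ?thesis by (rule LIMSEQ_unique[symmetric])
  qed
  ultimately show ?thesis using \<mu>t by (auto simp: Bv intro!: bexI[of _ e] exI[of _ \<mu>])
qed

section \<open>Orthonormal sets and the spectral theorem\<close>

definition orthonormal :: "'a::complex_hilbert set \<Rightarrow> bool"
  where "orthonormal E \<longleftrightarrow> (\<forall>e\<in>E. norm e = 1) \<and> (\<forall>e\<in>E. \<forall>f\<in>E. e \<noteq> f \<longrightarrow> cinner e f = 0)"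

definition perp :: "'a::complex_hilbert set \<Rightarrow> 'a set"
  where "perp E = {v. \<forall>e\<in>E. cinner v e = 0}"

lemma perpD: "v \<in> perp E \<Longrightarrow> e \<in> E \<Longrightarrow> cinner v e = 0"
  by (simp add: perp_def)

lemma closed_perp: "closed (perp E)"
proof -
  have "closed {v. cinner v e = 0}" for e :: 'a
    by (intro closed_Collect_eq continuous_intros cinner.continuous_on)
  moreover have "perp E = (\<Inter>e\<in>E. {v. cinner v e = 0})" by (auto simp: perp_def)
  ultimately show ?thesis by auto
qed

lemma subspace_perp: "subspace (perp E)"
  by (simp add: perp_def subspace_def cinner.zero_left cinner.add_left cinner.scaleR_left)

lemma scaleC_perp: "v \<in> perp E \<Longrightarrow> c *\<^sub>C v \<in> perp E"
  by (simp add: perp_def cinner_scaleC_left)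

lemma orthonormal_norm: "orthonormal E \<Longrightarrow> e \<in> E \<Longrightarrow> norm e = 1"
  by (simp add: orthonormal_def)

lemma orthonormal_cinner: "orthonormal E \<Longrightarrow> e \<in> E \<Longrightarrow> f \<in> E \<Longrightarrow> cinner e f = (if e = f then 1 else 0)"
  by (auto simp: orthonormal_def cinner_self)

lemma orthonormal_subset: "orthonormal E \<Longrightarrow> F \<subseteq> E \<Longrightarrow> orthonormal F"
  by (auto simp: orthonormal_def)

lemma orthonormal_Un:
  assumes "orthonormal E" "orthonormal F" "F \<subseteq> perp E"
  shows "orthonormal (E \<union> F)"
proof -
  have "cinner f e = 0" "cinner e f = 0" if "e \<in> E" "f \<in> F" for e f
    using assms(3) that by (auto simp: perp_def cinner_eq_zero_commute[of e])
  then show ?thesis using assms(1,2) by (simp add: orthonormal_def ball_Un)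
qed

lemma orthonormal_insert: "orthonormal E \<Longrightarrow> norm v = 1 \<Longrightarrow> v \<in> perp E \<Longrightarrow> orthonormal (insert v E)"
  by (auto simp: orthonormal_def perp_def cinner_eq_zero_commute)

lemma orthonormal_disjoint_perp: "orthonormal E \<Longrightarrow> E \<inter> perp E = {}"
  by (auto simp: orthonormal_def perp_def cinner_self)

text \<open>Zorn's lemma, with a predicate \<open>Q\<close> so that one maximality argument serves
  eigenvectors in a subspace, bases of a subspace, and common eigenvectors of two operators. In each
  use a nonzero complement is shown to contain a unit vector with \<open>Q\<close>.\<close>

lemma orthonormal_extend:
  assumes "orthonormal E" "\<And>e. e \<in> E \<Longrightarrow> Q e"
  obtains M where "E \<subseteq> M" "orthonormal M" "\<And>e. e \<in> M \<Longrightarrow> Q e"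
    "\<And>v. v \<in> perp M \<Longrightarrow> norm v = 1 \<Longrightarrow> \<not> Q v"
proof -
  define \<A> where "\<A> = {F. E \<subseteq> F \<and> orthonormal F \<and> (\<forall>e\<in>F. Q e)}"
  have "\<exists>M\<in>\<A>. \<forall>X\<in>\<A>. M \<subseteq> X \<longrightarrow> X = M"
  proof (rule subset_Zorn_nonempty)
    show "\<A> \<noteq> {}" using assms by (auto simp: \<A>_def)
    fix \<C> assume C: "\<C> \<noteq> {}" "subset.chain \<A> \<C>"
    then have sub: "\<C> \<subseteq> \<A>" by (simp add: subset_chain_def)
    have "orthonormal (\<Union>\<C>)"
      unfolding orthonormal_def
    proof (intro conjI ballI impI)
      fix e f assume "e \<in> \<Union>\<C>" "f \<in> \<Union>\<C>" and ne: "e \<noteq> f"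
      then obtain X Y where "X \<in> \<C>" "Y \<in> \<C>" "e \<in> X" "f \<in> Y" by blast
      moreover have "X \<subseteq> Y \<or> Y \<subseteq> X" using C(2) calculation by (auto simp: subset_chain_def)
      ultimately obtain Z where "Z \<in> \<C>" "e \<in> Z" "f \<in> Z" by blast
      then show "cinner e f = 0" using sub ne by (auto simp: \<A>_def orthonormal_def)
    qed (use sub in \<open>auto simp: \<A>_def orthonormal_def\<close>)
    then show "\<Union>\<C> \<in> \<A>" using C(1) sub by (auto simp: \<A>_def)
  qed
  then obtain M where M: "M \<in> \<A>" "\<And>X. X \<in> \<A> \<Longrightarrow> M \<subseteq> X \<Longrightarrow> X = M" by blast
  have "\<not> Q v" if v: "v \<in> perp M" "norm v = 1" for v
  proof
    assume "Q v"
    then have "insert v M \<in> \<A>" using M(1) v by (auto simp: \<A>_def orthonormal_insert)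
    then have "v \<in> M" using M(2) by blast
    then show False using M(1) v orthonormal_disjoint_perp by (auto simp: \<A>_def)
  qed
  then show ?thesis using M(1) that by (auto simp: \<A>_def)
qed

lemma cinner_orthonormal_sum:
  assumes "orthonormal F" "finite F" "f \<in> F"
  shows "cinner (\<Sum>e\<in>F. c e *\<^sub>C e) f = c f"
proof -
  have "cinner (\<Sum>e\<in>F. c e *\<^sub>C e) f = (\<Sum>e\<in>F. if e = f then c e else 0)"
    unfolding cinner.sum_left cinner_scaleC_left
    by (rule sum.cong) (use assms in \<open>auto simp: orthonormal_cinner\<close>)
  then show ?thesis using assms by simp
qed

lemma perp_remainder:
  assumes "orthonormal F" "finite F"
  shows "v - (\<Sum>e\<in>F. cinner v e *\<^sub>C e) \<in> perp F"
  using assms by (auto simp: perp_def cinner.diff_left cinner_orthonormal_sum)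

lemma cinner_sum_perp:
  assumes "finite F" "v \<in> perp F" shows "cinner v (\<Sum>e\<in>F. c e *\<^sub>C e) = 0"
  using assms by (simp add: cinner.sum_right cinner_scaleC_right perp_def)

lemma cinner_orthonormal_sums:
  assumes "orthonormal F" "finite F"
  shows "cinner (\<Sum>e\<in>F. c e *\<^sub>C e) (\<Sum>e\<in>F. d e *\<^sub>C e) = (\<Sum>e\<in>F. c e * cnj (d e))"
  unfolding cinner.sum_right cinner_scaleC_right
  using assms by (simp add: cinner_orthonormal_sum mult.commute)

lemma norm_orthonormal_sum:
  assumes "orthonormal F" "finite F"
  shows "(norm (\<Sum>e\<in>F. c e *\<^sub>C e))\<^sup>2 = (\<Sum>e\<in>F. (cmod (c e))\<^sup>2)"
proof -
  have "complex_of_real ((norm (\<Sum>e\<in>F. c e *\<^sub>C e))\<^sup>2) = complex_of_real (\<Sum>e\<in>F. (cmod (c e))\<^sup>2)"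
    unfolding cinner_self[symmetric, of "\<Sum>e\<in>F. c e *\<^sub>C e"] cinner_orthonormal_sums[OF assms]
      of_real_sum complex_norm_square ..
  then show ?thesis by (simp only: of_real_eq_iff)
qed

lemma bessel:
  assumes "orthonormal F" "finite F"
  shows "(\<Sum>e\<in>F. (cmod (cinner v e))\<^sup>2) \<le> (norm v)\<^sup>2"
proof -
  define s where "s = (\<Sum>e\<in>F. cinner v e *\<^sub>C e)"
  have "cinner (v - s) s = 0"
    unfolding s_def by (rule cinner_sum_perp[OF assms(2) perp_remainder[OF assms]])
  then have "inner (v - s) s = 0" by (simp add: inner_eq_Re_cinner)
  then have "(norm ((v - s) + s))\<^sup>2 = (norm (v - s))\<^sup>2 + (norm s)\<^sup>2"
    by (simp only: power2_norm_eq_inner inner_simps inner_commute[of s "v - s"]) (simp add: inner_simps inner_commute[of s v])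
  then show ?thesis by (simp add: s_def norm_orthonormal_sum[OF assms])
qed

lemma orthonormal_span_expand:
  assumes "orthonormal F" "finite F" "v \<in> complex_vector.span F"
  shows "v = (\<Sum>e\<in>F. cinner v e *\<^sub>C e)"
proof -
  obtain c where "v = (\<Sum>e\<in>F. c e *\<^sub>C e)"
    using assms(3) by (auto simp: complex_vector.span_finite[OF assms(2)])
  then show ?thesis by (simp add: cinner_orthonormal_sum[OF assms(1,2)])
qed

lemma orthonormal_sum_in_span: "(\<Sum>e\<in>F. c e *\<^sub>C e) \<in> complex_vector.span F"
  by (intro complex_vector.span_sum complex_vector.span_scale complex_vector.span_base)

lemma parseval:
  assumes "orthonormal F" "finite F" "v \<in> complex_vector.span F"
  shows "(\<Sum>e\<in>F. (cmod (cinner v e))\<^sup>2) = (norm v)\<^sup>2"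
  using norm_orthonormal_sum[OF assms(1,2), of "cinner v"] orthonormal_span_expand[OF assms] by simp

lemma orthonormal_independent_finite:
  assumes "orthonormal F" "finite F" shows "complex_vector.independent F"
proof (rule complex_vector.independent_if_scalars_zero[OF assms(2)])
  fix c f assume "(\<Sum>e\<in>F. c e *\<^sub>C e) = 0" "f \<in> F"
  then show "c f = 0" using cinner_orthonormal_sum[OF assms, of f c] by (simp add: cinner.zero_left)
qed

lemma span_Int_perp:
  assumes "orthonormal F" "finite F" "v \<in> complex_vector.span F" "v \<in> perp F"
  shows "v = 0"
  using orthonormal_span_expand[OF assms(1-3)] assms(4) by (simp add: perp_def)

interpretation complex_vector_pair: vector_space_pair
  "scaleC :: complex \<Rightarrow> 'a \<Rightarrow> 'a::complex_hilbert" "scaleC :: complex \<Rightarrow> 'b \<Rightarrow> 'b::complex_hilbert"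
  by unfold_locales

text \<open>Dimension count: otherwise the orthogonal projection \<open>L\<close> onto the span of
  \<open>X\<close> would be injective on the span of \<open>E\<close>, and \<open>card E\<close>
  independent vectors would lie in a space of dimension at most \<open>card X\<close>. This is the
  core of the min-max comparison below.\<close>

lemma exists_perp_in_span:
  assumes E: "orthonormal E" "finite E" and X: "orthonormal X" "finite X" and "card X < card E"
  shows "\<exists>v\<in>complex_vector.span E. v \<noteq> 0 \<and> v \<in> perp X"
proof (rule ccontr)
  assume contr: "\<not> ?thesis"
  define L where "L v = (\<Sum>f\<in>X. cinner v f *\<^sub>C f)" for v
  have lin: "Vector_Spaces.linear scaleC scaleC L"
    by unfold_locales
       (auto simp: L_def cinner.add_left scaleC_add_left sum.distrib cinner_scaleC_left
         complex_vector.scale_sum_right)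
  have "v = 0" if "v \<in> complex_vector.span E" "L v = 0" for v
  proof -
    have "v \<in> perp X" using perp_remainder[OF X, of v] that(2) by (simp add: L_def)
    then show ?thesis using contr that(1) by blast
  qed
  then have inj: "inj_on L (complex_vector.span E)"
    by (subst complex_vector_pair.linear_inj_on_iff_eq_0[OF lin]) (auto simp: complex_vector.subspace_span)
  have "complex_vector.independent (L ` E)"
    by (rule complex_vector_pair.linear_independent_injective_image[OF lin])
       (use orthonormal_independent_finite[OF E] inj in auto)
  moreover have "L ` E \<subseteq> complex_vector.span X"
    by (auto simp: L_def orthonormal_sum_in_span)
  ultimately have "card (L ` E) \<le> card X"
    using complex_vector.independent_span_bound[OF X(2)] by blast
  moreover have "card (L ` E) = card E"
    by (rule card_image, rule inj_on_subset[OF inj]) (rule complex_vector.span_superset)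
  ultimately show False using assms(5) by simp
qed

text \<open>The Rayleigh quotient at a unit vector, thus the eigenvalue if \<open>e\<close> is a
  unit eigenvector. It depends on operator and vector alone, so no list of eigenvalues has to
  accompany an eigenbasis.\<close>

definition ev :: "('h::complex_hilbert \<Rightarrow>\<^sub>L 'h) \<Rightarrow> 'h \<Rightarrow> real"
  where "ev A e = inner (A e) e"

text \<open>Part of the kernel may be left out of \<open>E\<close>, so finite-rank operators are
  diagonalized by finite sets. Completeness is added separately, as
  \<open>perp E = {0}\<close>.\<close>

definition diagonalizes :: "'h set \<Rightarrow> ('h::complex_hilbert \<Rightarrow>\<^sub>L 'h) \<Rightarrow> bool"
  where "diagonalizes E A \<longleftrightarrow>
    orthonormal E \<and> (\<forall>e\<in>E. A e = ev A e *\<^sub>R e) \<and> (\<forall>v\<in>perp E. A v = 0)"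

lemma diagonalizesD:
  assumes "diagonalizes E A"
  shows "orthonormal E" "e \<in> E \<Longrightarrow> A e = ev A e *\<^sub>R e" "v \<in> perp E \<Longrightarrow> A v = 0"
  using assms by (auto simp: diagonalizes_def)

lemma ev_eqI: "blinfun_apply A e = a *\<^sub>R e \<Longrightarrow> norm e = 1 \<Longrightarrow> ev A e = a"
  by (simp add: ev_def power2_norm_eq_inner[symmetric])

lemma eigenvector_perp_invariant:
  assumes "self_adjoint A" "\<And>e. e \<in> E \<Longrightarrow> blinfun_apply A e = ev A e *\<^sub>R e" "v \<in> perp E"
  shows "blinfun_apply A v \<in> perp E"
  using assms(2,3) by (auto simp: perp_def self_adjointD[OF assms(1)] cinner.scaleR_right)

lemma eigenvectors_orthogonal:
  assumes "self_adjoint A" "blinfun_apply A e = a *\<^sub>R e" "blinfun_apply A f = b *\<^sub>R f" "a \<noteq> b"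
  shows "cinner e f = 0"
proof -
  have "complex_of_real a * cinner e f = complex_of_real b * cinner e f"
    using self_adjointD[OF assms(1), of e f]
    by (simp add: assms(2,3) cinner_scaleR_left cinner_scaleR_right)
  then show ?thesis using assms(4) by simp
qed

text \<open>Take a maximal orthonormal set of eigenvectors in \<open>S\<close> above
  \<open>E\<close>. On the invariant complement \<open>T\<close> a nonzero value of the form, of
  either sign, would produce a further eigenvector; if the form vanishes, so does \<open>A\<close>,
  and every unit vector of \<open>T\<close> would be an eigenvector for \<open>0\<close>. The
  prescribed \<open>E\<close> allows known eigenvectors to be kept.\<close>

lemma spectral_theorem_subspace:
  assumes A: "self_adjoint A" "compact_operator A"
    and S: "closed S" "subspace S" "\<And>v. v \<in> S \<Longrightarrow> blinfun_apply A v \<in> S"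
    and E: "orthonormal E" "E \<subseteq> S" "\<And>e. e \<in> E \<Longrightarrow> blinfun_apply A e = ev A e *\<^sub>R e"
  obtains M where "E \<subseteq> M" "orthonormal M" "M \<subseteq> S"
    "\<And>e. e \<in> M \<Longrightarrow> blinfun_apply A e = ev A e *\<^sub>R e" "S \<inter> perp M = {0}"
proof -
  obtain M where M: "E \<subseteq> M" "orthonormal M" "\<And>e. e \<in> M \<Longrightarrow> e \<in> S \<and> A e = ev A e *\<^sub>R e"
    and max: "\<And>v. v \<in> perp M \<Longrightarrow> norm v = 1 \<Longrightarrow> \<not> (v \<in> S \<and> A v = ev A v *\<^sub>R v)"
    using orthonormal_extend[OF E(1), of "\<lambda>e. e \<in> S \<and> A e = ev A e *\<^sub>R e"] E(2,3) by blast
  define T where "T = S \<inter> perp M"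
  have T: "closed T" "subspace T" "\<And>v. v \<in> T \<Longrightarrow> A v \<in> T"
    using S closed_perp subspace_perp M(3) eigenvector_perp_invariant[OF A(1), of M]
    by (auto simp: T_def closed_Int subspace_def)
  have no: "\<not> (norm e = 1 \<and> A e = a *\<^sub>R e)" if "e \<in> T" for e a
  proof
    assume e: "norm e = 1 \<and> A e = a *\<^sub>R e"
    then have "A e = ev A e *\<^sub>R e" using ev_eqI[of A e a] by simp
    then show False using max[of e] that e by (simp add: T_def)
  qed
  have form: "inner (A v) v = 0" if v: "v \<in> T" for v
  proof (rule ccontr)
    assume "inner (A v) v \<noteq> 0"
    then consider "0 * (norm v)\<^sup>2 < inner (A v) v" | "0 * (norm v)\<^sup>2 < inner ((- A) v) v"
      by (force simp: blinfun.minus_left)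
    then show False
    proof cases
      case 1
      then show False using exists_eigenvector_above[OF A T order_refl v] no by blast
    next
      case 2
      have "\<And>v. v \<in> T \<Longrightarrow> (- A) v \<in> T" using T(2,3) by (simp add: blinfun.minus_left subspace_neg)
      then obtain e \<mu> where e: "e \<in> T" "norm e = 1" "(- A) e = \<mu> *\<^sub>R e"
        using exists_eigenvector_above[OF self_adjoint_uminus[OF A(1)] compact_operator_uminus[OF A(2)]
          T(1,2) _ order_refl v 2] by blast
      then have "A e = (- \<mu>) *\<^sub>R e"
        by (simp add: blinfun.minus_left) (metis minus_minus)
      then show False using no e by blast
    qed
  qed
  have "v = 0" if v: "v \<in> T" for v
  proof (rule ccontr)
    assume "v \<noteq> 0"
    define e where "e = v /\<^sub>R norm v"
    have e: "e \<in> T" "norm e = 1" using \<open>v \<noteq> 0\<close> v T(2) by (auto simp: e_def subspace_scale)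
    have "A e = 0"
      by (rule zero_form_imp_zero[of A T]) (use T form e self_adjoint_inner[OF A(1)] in auto)
    then show False using no[of e 0] e by simp
  qed
  moreover have "0 \<in> T" using T(2) by (rule subspace_0)
  ultimately have "S \<inter> perp M = {0}" by (auto simp: T_def)
  then show ?thesis using that M by blast
qed

lemma spectral_theorem:
  assumes A: "self_adjoint A" "compact_operator A"
    and E: "orthonormal E" "\<And>e. e \<in> E \<Longrightarrow> blinfun_apply A e = ev A e *\<^sub>R e"
  obtains M where "E \<subseteq> M" "diagonalizes M A" "perp M = {0}"
proof -
  obtain M where "E \<subseteq> M" "orthonormal M" "\<And>e. e \<in> M \<Longrightarrow> A e = ev A e *\<^sub>R e" "perp M = {0}"
    using spectral_theorem_subspace[OF A closed_UNIV subspace_UNIV _ E(1) _ E(2)]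
    by (metis Int_UNIV_left UNIV_I subset_UNIV)
  then show ?thesis by (intro that[of M]) (auto simp: diagonalizes_def blinfun.zero_right)
qed

text \<open>A violation would give an eigenvector above \<open>t\<close> that is orthogonal to the
  large members of \<open>E\<close>. It is orthogonal to the others as well, their eigenvalues being
  different, and so \<open>A\<close> would kill it.\<close>

lemma form_le_perp_large:
  assumes A: "self_adjoint A" "compact_operator A" and E: "diagonalizes E A"
    and t: "0 \<le> t" and v: "v \<in> perp {e \<in> E. ev A e > t}"
  shows "inner (blinfun_apply A v) v \<le> t * (norm v)\<^sup>2"
proof (rule ccontr)
  assume "\<not> ?thesis"
  then have "t * (norm v)\<^sup>2 < inner (A v) v" by simp
  then obtain e \<mu> where e: "e \<in> perp {e \<in> E. ev A e > t}" "\<mu> > t" "norm e = 1" "A e = \<mu> *\<^sub>R e"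
    using exists_eigenvector_above[OF A closed_perp subspace_perp _ t v]
      eigenvector_perp_invariant[OF A(1), of "{e \<in> E. ev A e > t}"] diagonalizesD[OF E] by blast
  have "cinner e f = 0" if f: "f \<in> E" for f
  proof (cases "ev A f > t")
    case False
    then show ?thesis
      using eigenvectors_orthogonal[OF A(1) e(4) diagonalizesD(2)[OF E f]] e(2) by auto
  qed (use e(1) f in \<open>auto simp: perp_def\<close>)
  then have "A e = 0" using diagonalizesD(3)[OF E] by (simp add: perp_def)
  then show False using e t by auto
qed

text \<open>Orthonormal eigenvectors with eigenvalues of modulus at least \<open>t\<close> have
  images at mutual distance at least \<open>t\<close>, which excludes a convergent
  subsequence.\<close>

lemma finite_large_eigenvalues:
  assumes A: "compact_operator A" and E: "diagonalizes E A" and t: "0 < t"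
  shows "finite {e \<in> E. t \<le> \<bar>ev A e\<bar>}"
proof (rule ccontr)
  assume "infinite {e \<in> E. t \<le> \<bar>ev A e\<bar>}"
  then obtain f :: "nat \<Rightarrow> 'a" where f: "inj f" "range f \<subseteq> {e \<in> E. t \<le> \<bar>ev A e\<bar>}"
    using infinite_countable_subset by blast
  have on: "orthonormal E" using E by (rule diagonalizesD)
  have fE: "f n \<in> E" "t \<le> \<bar>ev A (f n)\<bar>" for n using f(2) by auto
  obtain l r where r: "strict_mono (r :: nat \<Rightarrow> nat)" and l: "(\<lambda>n. A (f (r n))) \<longlonglongrightarrow> l"
    using compact_operator_subseq[OF A, of f] orthonormal_norm[OF on fE(1)] by (metis order_refl)
  have "Cauchy (\<lambda>n. A (f (r n)))" using l LIMSEQ_imp_Cauchy by blast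
  then obtain N where N: "\<And>m n. m \<ge> N \<Longrightarrow> n \<ge> N \<Longrightarrow> dist (A (f (r m))) (A (f (r n))) < t"
    using t by (meson metric_CauchyD)
  let ?e = "f (r N)" and ?e' = "f (r (Suc N))"
  have ne: "?e \<noteq> ?e'" using f(1) r by (metis injD less_irrefl lessI strict_mono_less)
  have "inner ?e ?e' = 0" using orthonormal_cinner[OF on fE(1) fE(1)] ne
    by (simp add: inner_eq_Re_cinner)
  then have "(norm (A ?e - A ?e'))\<^sup>2 = (ev A ?e)\<^sup>2 + (ev A ?e')\<^sup>2"
    using orthonormal_norm[OF on fE(1)]
    by (simp add: diagonalizesD(2)[OF E fE(1)] power2_norm_eq_inner inner_simps inner_commute[of ?e' ?e])
       (simp add: power2_norm_eq_inner[symmetric] power2_eq_square)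
  moreover have "t\<^sup>2 \<le> (ev A ?e)\<^sup>2"
    using fE(2) t by (metis abs_of_pos power2_abs abs_le_square_iff)
  ultimately have "t\<^sup>2 \<le> (norm (A ?e - A ?e'))\<^sup>2" by (simp add: add_increasing2)
  then have "t \<le> dist (A ?e) (A ?e')" by (simp add: dist_norm abs_le_square_iff[symmetric] t)
  then show False using N[of N "Suc N"] by simp
qed

section \<open>Schatten sums\<close>

text \<open>The \<open>p\<close>-th power of the norm: additive over eigenvectors, and a faithful
  record of distances for every \<open>p\<close>.\<close>

definition schatten_sum :: "real \<Rightarrow> ('h::complex_hilbert \<Rightarrow>\<^sub>L 'h) \<Rightarrow> real"
  where "schatten_sum p x = (\<Sum>\<^sub>\<infinity>s\<in>singular_values x. real (singular_mult x s) * s powr p)"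

lemma schatten_norm_eq: "schatten_norm p x = schatten_sum p x powr (1 / p)"
  by (simp add: schatten_norm_def schatten_sum_def)

lemma schatten_sum_nonneg: "0 \<le> schatten_sum p x"
  unfolding schatten_sum_def by (intro infsum_nonneg) auto

text \<open>The operators may act on different spaces, as is required to compare
  \<open>V x - V y\<close> with \<open>x - y\<close>.\<close>

lemma schatten_norm_eq_iff:
  assumes "0 < p"
  shows "schatten_norm p x = schatten_norm p y \<longleftrightarrow> schatten_sum p x = schatten_sum p y"
proof -
  have "(schatten_norm p z) powr p = schatten_sum p z" for z :: "'c::complex_hilbert \<Rightarrow>\<^sub>L 'c"
    using assms schatten_sum_nonneg[of p z] by (simp add: schatten_norm_eq powr_powr)
  moreover have "(schatten_norm p z) powr p = schatten_sum p z" for z :: "'d::complex_hilbert \<Rightarrow>\<^sub>L 'd"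
    using assms schatten_sum_nonneg[of p z] by (simp add: schatten_norm_eq powr_powr)
  ultimately show ?thesis by (metis schatten_norm_eq)
qed

lemma schatten_norm_eq_1_iff:
  assumes "0 < p" shows "schatten_norm p x = 1 \<longleftrightarrow> schatten_sum p x = 1"
proof -
  have "(schatten_norm p x) powr p = schatten_sum p x"
    using assms schatten_sum_nonneg[of p x] by (simp add: schatten_norm_eq powr_powr)
  then show ?thesis by (metis powr_one_eq_one schatten_norm_eq)
qed

lemma diagonalizes_cinner:
  assumes "self_adjoint A" "diagonalizes E A" "e \<in> E"
  shows "cinner (blinfun_apply A u) e = complex_of_real (ev A e) * cinner u e"
  by (simp add: self_adjointD[OF assms(1)] diagonalizesD(2)[OF assms(2,3)] cinner_scaleR_right)

text \<open>For \<open>v\<close> orthogonal to the retained vectors, \<open>A v\<close> is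
  orthogonal to all of \<open>E\<close>; hence \<open>A (A v) = 0\<close>, and
  \<open>A v = 0\<close> by symmetry.\<close>

lemma diagonalizes_nonzero:
  assumes "self_adjoint A" "diagonalizes E A"
  shows "diagonalizes {e \<in> E. ev A e \<noteq> 0} A"
  unfolding diagonalizes_def
proof (intro conjI ballI)
  fix v assume v: "v \<in> perp {e \<in> E. ev A e \<noteq> 0}"
  have "A v \<in> perp E"
    using v by (auto simp: perp_def diagonalizes_cinner[OF assms])
  then have "A (A v) = 0" using diagonalizesD(3)[OF assms(2)] by blast
  then have "cinner (A v) (A v) = 0" by (simp add: self_adjointD[OF assms(1), of v] cinner.zero_right)
  then show "A v = 0" by (simp add: cinner_self)
qed (use diagonalizesD[OF assms(2)] in \<open>auto intro: orthonormal_subset\<close>)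

text \<open>Here the adjoint times \<open>A\<close> is the square of \<open>A\<close>, so the
  eigenvalues \<open>s\<close> and \<open>- s\<close> share one singular space. The remainder of a
  singular vector after projection onto the span of \<open>F\<close> is orthogonal to all of
  \<open>E\<close>, because the other squares differ from \<open>s^2\<close>.\<close>

lemma singular_space_eq_span:
  assumes A: "self_adjoint A" "compact_operator A" and E: "diagonalizes E A" and s: "0 < s"
  defines "F \<equiv> {e \<in> E. \<bar>ev A e\<bar> = s}"
  shows "singular_space A s = complex_vector.span F" "finite F"
proof -
  have on: "orthonormal E" using E by (rule diagonalizesD)
  have onF: "orthonormal F" by (rule orthonormal_subset[OF on]) (auto simp: F_def)
  show fin: "finite F"
    by (rule finite_subset[OF _ finite_large_eigenvalues[OF A(2) E s]]) (auto simp: F_def)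
  have sing: "u \<in> singular_space A s \<longleftrightarrow> A (A u) = (s\<^sup>2) *\<^sub>R u" for u
    by (simp add: singular_space_def self_adjoint_adjoint[OF A(1)] scaleR_scaleC[of "s\<^sup>2" u])
  have sub: "complex_vector.subspace (singular_space A s)"
    by (rule complex_vector.subspaceI)
       (simp_all add: sing blinfun.zero_right blinfun.add_right scaleR_add_right
         self_adjoint_scaleC[OF A(1)] scaleC_scaleR)
  have F: "F \<subseteq> singular_space A s"
  proof
    fix e assume "e \<in> F"
    then have "e \<in> E" "(ev A e)\<^sup>2 = s\<^sup>2" by (auto simp: F_def power2_eq_iff)
    then show "e \<in> singular_space A s"
      by (simp add: sing diagonalizesD(2)[OF E] blinfun.scaleR_right power2_eq_square)
  qed
  show "singular_space A s = complex_vector.span F"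
  proof
    show "complex_vector.span F \<subseteq> singular_space A s" using complex_vector.span_minimal[OF F sub] .
    show "singular_space A s \<subseteq> complex_vector.span F"
    proof
      fix u assume u: "u \<in> singular_space A s"
      define w where "w = (\<Sum>e\<in>F. cinner u e *\<^sub>C e)"
      have wspan: "w \<in> complex_vector.span F" unfolding w_def by (rule orthonormal_sum_in_span)
      then have "w \<in> singular_space A s" using complex_vector.span_minimal[OF F sub] by blast
      then have sing_uw: "A (A (u - w)) = (s\<^sup>2) *\<^sub>R (u - w)"
        using u complex_vector.subspace_diff[OF sub] sing by blast
      have "cinner (u - w) e = 0" if e: "e \<in> E" for e
      proof (cases "e \<in> F")
        case True
        then show ?thesis using perp_remainder[OF onF fin, of u] by (simp add: perp_def w_def)
      next
        case False
        have "complex_of_real ((ev A e)\<^sup>2) * cinner (u - w) e = complex_of_real (s\<^sup>2) * cinner (u - w) e"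
          using arg_cong[OF sing_uw, of "\<lambda>v. cinner v e"]
          by (simp add: diagonalizes_cinner[OF A(1) E e] cinner_scaleR_left power2_eq_square)
        moreover have "(ev A e)\<^sup>2 \<noteq> s\<^sup>2" using False e s by (auto simp: F_def power2_eq_iff)
        ultimately show ?thesis by (metis mult_cancel_right of_real_eq_iff)
      qed
      then have "A (u - w) = 0" using diagonalizesD(3)[OF E] by (simp add: perp_def)
      then have "u = w" using sing_uw s by (simp add: blinfun.zero_right)
      then show "u \<in> complex_vector.span F" using wspan by simp
    qed
  qed
qed

text \<open>The bridge from the definition to sums over eigenvectors: vectors with nonzero
  eigenvalue are grouped by its modulus \<open>s\<close>, and each group has
  \<open>singular_mult A s\<close> elements. The equivalence carries summability in both
  directions.\<close>

lemma schatten_has_sum: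
  assumes A: "self_adjoint A" "compact_operator A" and E: "diagonalizes E A"
  shows "((\<lambda>s. real (singular_mult A s) * s powr p) has_sum S) (singular_values A) \<longleftrightarrow>
    ((\<lambda>e. \<bar>ev A e\<bar> powr p) has_sum S) E"
proof -
  define F where "F s = {e \<in> E. \<bar>ev A e\<bar> = s}" for s
  let ?V = "singular_values A"
  have onF: "orthonormal (F s)" for s
    by (rule orthonormal_subset[OF diagonalizesD(1)[OF E]]) (auto simp: F_def)
  have sp: "singular_space A s = complex_vector.span (F s)" "finite (F s)" if "0 < s" for s
    using singular_space_eq_span[OF A E that] by (auto simp: F_def)
  have mult: "singular_mult A s = card (F s)" if "0 < s" for s
    using complex_vector.dim_span_eq_card_independent[OF orthonormal_independent_finite[OF onF sp(2)[OF that]]]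
    by (simp add: singular_mult_def sp(1)[OF that])
  have V: "s \<in> ?V \<longleftrightarrow> 0 < s \<and> F s \<noteq> {}" for s
  proof (cases "0 < s")
    case True
    have "(\<exists>u\<in>complex_vector.span (F s). u \<noteq> 0) \<longleftrightarrow> F s \<noteq> {}"
    proof
      assume "F s \<noteq> {}"
      then obtain e where e: "e \<in> F s" by blast
      have "e \<noteq> 0" using orthonormal_norm[OF onF e] by auto
      then show "\<exists>u\<in>complex_vector.span (F s). u \<noteq> 0" using complex_vector.span_base[OF e] by blast
    next
      assume "\<exists>u\<in>complex_vector.span (F s). u \<noteq> 0"
      then show "F s \<noteq> {}" by (intro notI) (simp add: complex_vector.span_empty)
    qed
    then show ?thesis using True by (simp add: singular_values_def sp(1))
  qed (simp add: singular_values_def)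
  let ?g = "\<lambda>e. \<bar>ev A e\<bar> powr p"
  have inner_sum: "((\<lambda>e. ?g (snd (s, e))) has_sum (real (singular_mult A s) * s powr p)) (F s)" if "s \<in> ?V" for s
  proof (rule has_sum_finiteI)
    show "finite (F s)" using sp(2)[of s] V[of s] that by simp
    have "(\<Sum>e\<in>F s. ?g e) = (\<Sum>e\<in>F s. s powr p)" by (rule sum.cong) (auto simp: F_def)
    then show "real (singular_mult A s) * s powr p = (\<Sum>e\<in>F s. ?g (snd (s, e)))"
      using mult[of s] that V[of s] by simp
  qed
  have bij: "bij_betw snd (Sigma ?V F) {e \<in> E. ev A e \<noteq> 0}"
    unfolding bij_betw_def
  proof
    show "inj_on snd (Sigma ?V F)" by (auto simp: inj_on_def F_def)
    have "e \<in> snd ` Sigma ?V F" if "e \<in> E" "ev A e \<noteq> 0" for e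
      using that V[of "\<bar>ev A e\<bar>"] by (intro image_eqI[of _ _ "(\<bar>ev A e\<bar>, e)"]) (auto simp: F_def)
    then show "snd ` Sigma ?V F = {e \<in> E. ev A e \<noteq> 0}" by (force simp: F_def V)
  qed
  \<comment> \<open>Kernel vectors contribute nothing, because \<open>0 powr p = 0\<close> by
    convention.\<close>
  have "(?g has_sum S) E \<longleftrightarrow> (?g has_sum S) {e \<in> E. ev A e \<noteq> 0}"
    by (rule has_sum_cong_neutral) auto
  also have "\<dots> \<longleftrightarrow> ((\<lambda>z. ?g (snd z)) has_sum S) (Sigma ?V F)"
    by (rule has_sum_reindex_bij_betw[OF bij, symmetric])
  also have "\<dots> \<longleftrightarrow> ((\<lambda>s. real (singular_mult A s) * s powr p) has_sum S) ?V"
  proof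
    assume "((\<lambda>z. ?g (snd z)) has_sum S) (Sigma ?V F)"
    then show "((\<lambda>s. real (singular_mult A s) * s powr p) has_sum S) ?V"
      using inner_sum by (rule has_sum_SigmaD[where f = "\<lambda>z. ?g (snd z)"])
  next
    assume S: "((\<lambda>s. real (singular_mult A s) * s powr p) has_sum S) ?V"
    show "((\<lambda>z. ?g (snd z)) has_sum S) (Sigma ?V F)"
    proof (rule has_sum_SigmaI[where f = "\<lambda>z. ?g (snd z)", OF _ S])
      show "((\<lambda>e. ?g (snd (s, e))) has_sum (real (singular_mult A s) * s powr p)) (F s)"
        if "s \<in> ?V" for s using that by (rule inner_sum)
      show "(\<lambda>z. ?g (snd z)) summable_on Sigma ?V F"
      proof (rule summable_on_SigmaI[where f = "\<lambda>z. ?g (snd z)"])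
        show "((\<lambda>e. ?g (snd (s, e))) has_sum (real (singular_mult A s) * s powr p)) (F s)"
          if "s \<in> ?V" for s using that by (rule inner_sum)
        show "(\<lambda>s. real (singular_mult A s) * s powr p) summable_on ?V"
          using S by (rule has_sum_imp_summable)
      qed simp
    qed
  qed
  finally show ?thesis by (rule sym)
qed

lemma schatten_summable_iff:
  assumes "self_adjoint A" "compact_operator A" "diagonalizes E A"
  shows "A \<in> schatten_class p \<longleftrightarrow> (\<lambda>e. \<bar>ev A e\<bar> powr p) summable_on E"
proof -
  have "(\<lambda>s. real (singular_mult A s) * s powr p) summable_on singular_values A \<longleftrightarrow>
      (\<lambda>e. \<bar>ev A e\<bar> powr p) summable_on E" (is "?f summable_on _ \<longleftrightarrow> ?g summable_on _")
  proof
    assume "?f summable_on singular_values A"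
    then obtain S where "(?f has_sum S) (singular_values A)" by (auto simp: summable_on_def)
    then have "(?g has_sum S) E" by (rule schatten_has_sum[OF assms, THEN iffD1])
    then show "?g summable_on E" by (rule has_sum_imp_summable)
  next
    assume "?g summable_on E"
    then obtain S where "(?g has_sum S) E" by (auto simp: summable_on_def)
    then have "(?f has_sum S) (singular_values A)" by (rule schatten_has_sum[OF assms, THEN iffD2])
    then show "?f summable_on singular_values A" by (rule has_sum_imp_summable)
  qed
  then show ?thesis using assms(2) by (simp add: schatten_class_def)
qed

lemma schatten_sum_eq_infsum:
  assumes "self_adjoint A" "compact_operator A" "diagonalizes E A"
  shows "schatten_sum p A = (\<Sum>\<^sub>\<infinity>e\<in>E. \<bar>ev A e\<bar> powr p)"
proof (cases "(\<lambda>e. \<bar>ev A e\<bar> powr p) summable_on E")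
  case True
  then have "((\<lambda>s. real (singular_mult A s) * s powr p) has_sum (\<Sum>\<^sub>\<infinity>e\<in>E. \<bar>ev A e\<bar> powr p))
      (singular_values A)"
    by (intro schatten_has_sum[OF assms, THEN iffD2] has_sum_infsum)
  then show ?thesis unfolding schatten_sum_def by (rule infsumI)
next
  case False
  then have "\<not> (\<lambda>s. real (singular_mult A s) * s powr p) summable_on singular_values A"
    using schatten_summable_iff[OF assms] assms(2) by (auto simp: schatten_class_def)
  then show ?thesis using False by (simp add: schatten_sum_def infsum_not_exists)
qed

lemma schatten_sum_finite:
  assumes "self_adjoint A" "compact_operator A" "diagonalizes E A" "finite E"
  shows "schatten_sum p A = (\<Sum>e\<in>E. \<bar>ev A e\<bar> powr p)"
  using schatten_sum_eq_infsum[OF assms(1-3)] assms(4) by simp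

section \<open>Comparison of sums by counting\<close>

text \<open>Only finitely many values lie in \<open>[t / 2, t)\<close>, so their maximum leaves a
  gap below \<open>t\<close>; the floor \<open>t / 2\<close> keeps \<open>t'\<close> positive. The
  gap provides the strict inequality in the contradiction arguments below.\<close>

lemma level_gap:
  fixes x :: "'a \<Rightarrow> real"
  assumes "0 < t" "\<And>s. 0 < s \<Longrightarrow> finite {f \<in> X. s \<le> x f}"
  obtains t' where "0 < t'" "t' < t" "{f \<in> X. t' < x f} = {f \<in> X. t \<le> x f}"
proof -
  let ?G = "{f \<in> X. t / 2 \<le> x f \<and> x f < t}"
  define t' where "t' = Max (insert (t / 2) (x ` ?G))"
  have fin: "finite ?G"
    by (rule finite_subset[OF _ assms(2)[of "t / 2"]]) (use assms(1) in auto)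
  have "t / 2 \<le> t'" unfolding t'_def using fin by (intro Max_ge) auto
  moreover have "t' < t" unfolding t'_def using fin assms(1) by auto
  moreover have "\<not> t' < x f" if "f \<in> X" "x f < t" for f
  proof (cases "t / 2 \<le> x f")
    case True
    then have "x f \<le> t'" unfolding t'_def using fin that by (intro Max_ge) auto
    then show ?thesis by simp
  qed (use \<open>t / 2 \<le> t'\<close> in auto)
  moreover have "0 < t'" using \<open>t / 2 \<le> t'\<close> assms(1) by simp
  ultimately show ?thesis by (intro that[of t']) (auto intro: less_le_trans leI)
qed

text \<open>Termwise domination of decreasing rearrangements, expressed by the number of values
  above each level. This avoids enumerating eigenvalues with multiplicity.\<close>

locale dominated_counts =
  fixes E :: "'a set" and a :: "'a \<Rightarrow> real" and X :: "'b set" and x :: "'b \<Rightarrow> real"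
  assumes a_pos: "e \<in> E \<Longrightarrow> 0 < a e"
    and x_nonneg: "f \<in> X \<Longrightarrow> 0 \<le> x f"
    and finE: "0 < t \<Longrightarrow> finite {e \<in> E. t \<le> a e}"
    and finX: "0 < t \<Longrightarrow> finite {f \<in> X. t \<le> x f}"
    and card_le: "0 < t \<Longrightarrow> card {e \<in> E. t \<le> a e} \<le> card {f \<in> X. t \<le> x f}"
begin

text \<open>Greedy choice in decreasing order of \<open>a\<close>: the newcomer \<open>e\<close> has
  the smallest value, so all of \<open>insert e F\<close> lies above the level \<open>a e\<close>,
  and the count at that level leaves a free target.\<close>

lemma dominating_injection:
  assumes "finite F" "F \<subseteq> E"
  shows "\<exists>\<iota>. inj_on \<iota> F \<and> (\<forall>e\<in>F. \<iota> e \<in> X \<and> a e \<le> x (\<iota> e))"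
  using assms
proof (induction F rule: finite_ranking_induct[where f = "\<lambda>e. - a e"])
  case (insert e F)
  then obtain \<iota> where \<iota>: "inj_on \<iota> F" "\<And>e. e \<in> F \<Longrightarrow> \<iota> e \<in> X \<and> a e \<le> x (\<iota> e)" by auto
  show ?case
  proof (cases "e \<in> F")
    case True
    then show ?thesis using \<iota> by (auto simp: insert_absorb)
  next
    case False
    have t: "0 < a e" using a_pos insert.prems by auto
    have "insert e F \<subseteq> {e' \<in> E. a e \<le> a e'}" using insert by auto
    then have "Suc (card F) \<le> card {e' \<in> E. a e \<le> a e'}"
      using card_mono[OF finE[OF t]] card_insert_disjoint[OF insert.hyps(1) False] by metis
    also have "\<dots> \<le> card {f \<in> X. a e \<le> x f}" by (rule card_le[OF t])
    finally have "card (\<iota> ` F) < card {f \<in> X. a e \<le> x f}"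
      using card_image[OF \<iota>(1)] by simp
    then obtain f where f: "f \<in> X" "a e \<le> x f" "f \<notin> \<iota> ` F"
      using card_mono[OF finite_imageI[OF insert.hyps(1)], of "{f \<in> X. a e \<le> x f}" \<iota>]
      by (metis (no_types, lifting) mem_Collect_eq not_le subsetI)
    have "inj_on (\<iota>(e := f)) (insert e F)"
      using \<iota>(1) f(3) False by (auto simp: inj_on_def)
    moreover have "\<forall>e'\<in>insert e F. (\<iota>(e := f)) e' \<in> X \<and> a e' \<le> x ((\<iota>(e := f)) e')"
      using \<iota>(2) f by simp
    ultimately show ?thesis by blast
  qed
qed auto

lemma powr_sum_le:
  assumes p: "0 < p" and S: "((\<lambda>f. x f powr p) has_sum S) X"
  shows "(\<lambda>e. a e powr p) summable_on E" "(\<Sum>\<^sub>\<infinity>e\<in>E. a e powr p) \<le> S"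
proof -
  have le: "(\<Sum>e\<in>F. a e powr p) \<le> S" if F: "finite F" "F \<subseteq> E" for F
  proof -
    obtain \<iota> where \<iota>: "inj_on \<iota> F" "\<And>e. e \<in> F \<Longrightarrow> \<iota> e \<in> X \<and> a e \<le> x (\<iota> e)"
      using dominating_injection[OF F] by blast
    have "(\<Sum>e\<in>F. a e powr p) \<le> (\<Sum>e\<in>F. x (\<iota> e) powr p)"
      using \<iota>(2) p by (intro sum_mono powr_mono2) (use F(2) a_pos less_imp_le in blast)+
    also have "\<dots> = (\<Sum>f\<in>\<iota> ` F. x f powr p)" by (simp add: sum.reindex[OF \<iota>(1)])
    also have "\<dots> \<le> S" by (rule finite_sum_le_has_sum[OF S]) (use F \<iota> in auto)
    finally show ?thesis .
  qed
  show *: "(\<lambda>e. a e powr p) summable_on E"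
    by (rule nonneg_bdd_above_summable_on) (use le in \<open>auto simp: bdd_above_def\<close>)
  show "(\<Sum>\<^sub>\<infinity>e\<in>E. a e powr p) \<le> S" by (rule infsum_le_finite_sums[OF * le])
qed

end

text \<open>If the counts differ at level \<open>t\<close>, then lowering one of the values \<open>x f \<ge> t\<close> below \<open>t\<close>
  keeps the domination but decreases the sum.\<close>

lemma (in dominated_counts) card_eq_of_sum_eq:
  assumes p: "0 < p" and S: "((\<lambda>f. x f powr p) has_sum S) X"
    and eq: "S \<le> (\<Sum>\<^sub>\<infinity>e\<in>E. a e powr p)" and t: "0 < t"
  shows "card {e \<in> E. t \<le> a e} = card {f \<in> X. t \<le> x f}"
proof (rule ccontr)
  assume "\<not> ?thesis"
  then have less: "card {e \<in> E. t \<le> a e} < card {f \<in> X. t \<le> x f}" using card_le[OF t] by simp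
  let ?Xt = "{f \<in> X. t \<le> x f}"
  have "finite ?Xt" "?Xt \<noteq> {}" using finX[OF t] less by (blast, metis card.empty not_less_zero)
  note fin = this
  \<comment> \<open>The smallest of the values above \<open>t\<close>: lowering it to
    \<open>t'\<close> affects only levels in \<open>(t', x f0]\<close>.\<close>
  obtain f0 where f0: "f0 \<in> ?Xt" "\<And>f. f \<in> ?Xt \<Longrightarrow> x f0 \<le> x f"
  proof (rule that)
    show "arg_min_on x ?Xt \<in> ?Xt" by (rule arg_min_if_finite(1)[OF fin])
    show "x (arg_min_on x ?Xt) \<le> x f" if "f \<in> ?Xt" for f
      using arg_min_if_finite(2)[OF fin, of x] that by (meson not_le)
  qed
  obtain t' where t': "0 < t'" "t' < t" "{e \<in> E. t' < a e} = {e \<in> E. t \<le> a e}"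
    using level_gap[OF t finE] by metis
  define x' where "x' = x(f0 := t')"
  have finX': "finite {f \<in> X. s \<le> x' f}" if "0 < s" for s
    by (rule finite_subset[of _ "insert f0 {f \<in> X. s \<le> x f}"]) (use finX[OF that] in \<open>auto simp: x'_def\<close>)
  have card1: "card {e \<in> E. t \<le> a e} \<le> card (?Xt - {f0})" using less f0(1) by simp
  have "dominated_counts E a X x'"
  proof
    fix s :: real assume s: "0 < s"
    show "card {e \<in> E. s \<le> a e} \<le> card {f \<in> X. s \<le> x' f}"
    proof (cases "s \<le> t' \<or> x f0 < s")
      case True
      then have "{f \<in> X. s \<le> x f} \<subseteq> {f \<in> X. s \<le> x' f}" using t' f0 by (auto simp: x'_def)
      then have "card {f \<in> X. s \<le> x f} \<le> card {f \<in> X. s \<le> x' f}" by (rule card_mono[OF finX'[OF s]])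
      then show ?thesis using card_le[OF s] by simp
    next
      case False
      \<comment> \<open>At these levels \<open>E\<close> counts no more than at \<open>t\<close>,
        where the counts differ, and all of \<open>?Xt\<close> except \<open>f0\<close> is still
        above \<open>s\<close>; the loss of \<open>f0\<close> is affordable.\<close>
      have "{e \<in> E. s \<le> a e} \<subseteq> {e \<in> E. t \<le> a e}" using t'(3) False by force
      then have "card {e \<in> E. s \<le> a e} \<le> card {e \<in> E. t \<le> a e}" by (rule card_mono[OF finE[OF t]])
      also note card1
      also have "card (?Xt - {f0}) \<le> card {f \<in> X. s \<le> x' f}"
        by (rule card_mono[OF finX'[OF s]]) (use f0 False in \<open>force simp: x'_def\<close>)
      finally show ?thesis .
    qed
    show "finite {e \<in> E. s \<le> a e}" "finite {f \<in> X. s \<le> x' f}" using finE finX' s by blast+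
  next
    show "0 < a e" if "e \<in> E" for e using that by (rule a_pos)
    show "0 \<le> x' f" if "f \<in> X" for f using that x_nonneg t'(1) by (simp add: x'_def)
  qed
  then interpret x': dominated_counts E a X x' .
  define S0 where "S0 = (\<Sum>\<^sub>\<infinity>f\<in>X - {f0}. x f powr p)"
  have "(\<lambda>f. x f powr p) summable_on X - {f0}"
    by (rule summable_on_subset[of _ X]) (use S has_sum_imp_summable in auto)
  then have S0: "((\<lambda>f. x f powr p) has_sum S0) (X - {f0})" by (simp add: S0_def)
  have S0': "((\<lambda>f. x' f powr p) has_sum S0) (X - {f0})"
    by (rule has_sum_cong[THEN iffD1, OF _ S0]) (auto simp: x'_def)
  have ins: "insert f0 (X - {f0}) = X" using f0(1) by auto
  have "((\<lambda>f. x f powr p) has_sum (x f0 powr p + S0)) X"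
    using has_sum_insert[OF _ S0, of f0] ins by simp
  then have "S = x f0 powr p + S0" using S has_sum_unique by blast
  moreover have "((\<lambda>f. x' f powr p) has_sum (t' powr p + S0)) X"
    using has_sum_insert[OF _ S0', of f0] ins by (simp add: x'_def)
  then have "(\<Sum>\<^sub>\<infinity>e\<in>E. a e powr p) \<le> t' powr p + S0" by (rule x'.powr_sum_le(2)[OF p])
  moreover have "t' powr p < x f0 powr p" using t' f0(1) p by (intro powr_less_mono2) auto
  ultimately show False using eq by simp
qed

section \<open>Orthogonality as maximal distance\<close>

lemma diagonalization_exists:
  assumes "self_adjoint A" "compact_operator A"
  obtains E where "diagonalizes E A" "perp E = {0}"
proof (rule spectral_theorem[OF assms, of "{}"])
  show "orthonormal {}" by (simp add: orthonormal_def)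
qed (use that in simp_all)

lemma ev_minus: "ev (- A) e = - ev A e"
  by (simp add: ev_def blinfun.minus_left)

lemma diagonalizes_uminus: "diagonalizes E A \<Longrightarrow> diagonalizes E (- A)"
  by (simp add: diagonalizes_def ev_minus blinfun.minus_left)

lemma form_orthonormal_sum:
  assumes E: "diagonalizes E A" and F: "finite F" "F \<subseteq> E" and A: "self_adjoint A"
  shows "inner (A (\<Sum>e\<in>F. c e *\<^sub>C e)) (\<Sum>e\<in>F. c e *\<^sub>C e) = (\<Sum>e\<in>F. ev A e * (cmod (c e))\<^sup>2)"
proof -
  have on: "orthonormal F" by (rule orthonormal_subset[OF diagonalizesD(1)[OF E] F(2)])
  have "A (\<Sum>e\<in>F. c e *\<^sub>C e) = (\<Sum>e\<in>F. (complex_of_real (ev A e) * c e) *\<^sub>C e)"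
    unfolding blinfun.sum_right self_adjoint_scaleC[OF A]
    by (intro sum.cong refl) (use F(2) in \<open>auto simp: diagonalizesD(2)[OF E] scaleR_scaleC[of "ev A _"]
        scaleC_scaleC mult.commute\<close>)
  then have "cinner (A (\<Sum>e\<in>F. c e *\<^sub>C e)) (\<Sum>e\<in>F. c e *\<^sub>C e) =
      (\<Sum>e\<in>F. (complex_of_real (ev A e) * c e) * cnj (c e))"
    by (simp add: cinner_orthonormal_sums[OF on F(1)])
  also have "\<dots> = complex_of_real (\<Sum>e\<in>F. ev A e * (cmod (c e))\<^sup>2)"
    unfolding of_real_sum by (intro sum.cong refl) (simp add: complex_norm_square[symmetric] mult.assoc)
  finally show ?thesis by (simp only: inner_eq_Re_cinner Re_complex_of_real)
qed

lemma ev_nonneg: "positive_operator x \<Longrightarrow> 0 \<le> ev x e"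
  by (simp add: positive_operator_iff ev_def)

text \<open>Min-max: with too many large eigenvalues of \<open>A\<close>, some nonzero
  \<open>v\<close> in the span of their eigenvectors is orthogonal to the large eigenvectors of
  \<open>x\<close>. The form of \<open>A\<close> at \<open>v\<close> is then at least
  \<open>t * (norm v)^2\<close>, that of \<open>x\<close> at most
  \<open>t' * (norm v)^2\<close>.\<close>

lemma weyl_counting:
  assumes A: "self_adjoint A" "compact_operator A" "diagonalizes E A"
    and x: "positive_operator x" "compact_operator x" "diagonalizes X x"
    and le: "\<And>v. inner (A v) v \<le> inner (x v) v" and t: "0 < t"
  shows "card {e \<in> E. t \<le> ev A e} \<le> card {f \<in> X. t \<le> ev x f}"
proof (rule ccontr)
  assume less: "\<not> ?thesis"
  have sx: "self_adjoint x" using x(1) by (simp add: positive_operator_iff)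
  have finX: "finite {f \<in> X. s \<le> ev x f}" if "0 < s" for s
    by (rule finite_subset[OF _ finite_large_eigenvalues[OF x(2,3) that]]) auto
  have finE: "finite {e \<in> E. t \<le> ev A e}"
    by (rule finite_subset[OF _ finite_large_eigenvalues[OF A(2,3) t]]) auto
  obtain t' where t': "0 < t'" "t' < t" "{f \<in> X. t' < ev x f} = {f \<in> X. t \<le> ev x f}"
    using level_gap[OF t finX] by metis
  let ?F = "{e \<in> E. t \<le> ev A e}" and ?G = "{f \<in> X. t' < ev x f}"
  have onF: "orthonormal ?F" by (rule orthonormal_subset[OF diagonalizesD(1)[OF A(3)]]) auto
  have onG: "orthonormal ?G" by (rule orthonormal_subset[OF diagonalizesD(1)[OF x(3)]]) auto
  have "\<exists>v\<in>complex_vector.span ?F. v \<noteq> 0 \<and> v \<in> perp ?G"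
    by (rule exists_perp_in_span[OF onF finE onG]) (use less t'(3) finX[OF t] in auto)
  then obtain v where v: "v \<in> complex_vector.span ?F" "v \<noteq> 0" "v \<in> perp ?G" by blast
  have "t * (norm v)\<^sup>2 = (\<Sum>e\<in>?F. t * (cmod (cinner v e))\<^sup>2)"
    by (simp add: parseval[OF onF finE v(1), symmetric] sum_distrib_left)
  also have "\<dots> \<le> (\<Sum>e\<in>?F. ev A e * (cmod (cinner v e))\<^sup>2)"
    by (intro sum_mono mult_right_mono) auto
  also have "\<dots> = inner (A v) v"
    using form_orthonormal_sum[OF A(3) finE _ A(1), of "cinner v"]
      orthonormal_span_expand[OF onF finE v(1)] by simp
  also have "\<dots> \<le> inner (x v) v" by (rule le)
  also have "\<dots> \<le> t' * (norm v)\<^sup>2"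
    by (rule form_le_perp_large[OF sx x(2,3) _ v(3)]) (use t' in simp)
  finally show False using t'(2) v(2) by simp
qed

lemma weyl_dominated_counts:
  assumes "self_adjoint A" "compact_operator A" "diagonalizes E A"
    and "positive_operator x" "compact_operator x" "diagonalizes X x"
    and "\<And>v. inner (blinfun_apply A v) v \<le> inner (blinfun_apply x v) v"
  shows "dominated_counts {e \<in> E. 0 < ev A e} (ev A) X (ev x)"
proof
  fix t :: real assume t: "0 < t"
  have eq: "{e \<in> {e \<in> E. 0 < ev A e}. t \<le> ev A e} = {e \<in> E. t \<le> ev A e}" using t by auto
  show "finite {e \<in> {e \<in> E. 0 < ev A e}. t \<le> ev A e}"
    by (rule finite_subset[OF _ finite_large_eigenvalues[OF assms(2,3) t]]) auto
  show "finite {f \<in> X. t \<le> ev x f}"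
    by (rule finite_subset[OF _ finite_large_eigenvalues[OF assms(5,6) t]]) auto
  show "card {e \<in> {e \<in> E. 0 < ev A e}. t \<le> ev A e} \<le> card {f \<in> X. t \<le> ev x f}"
    unfolding eq by (rule weyl_counting[OF assms t])
qed (use ev_nonneg[OF assms(4)] in auto)

text \<open>Splitting a unit vector \<open>e\<close> along \<open>?G\<close> bounds the form by
  \<open>t\<close> plus the sum of \<open>(ev x f - t) * (cmod (cinner e f))^2\<close>. After
  summation over \<open>F\<close>, Bessel bounds the weight of each nonnegative
  \<open>ev x f - t\<close> by \<open>1\<close>, and equal cardinalities make the terms with
  \<open>t\<close> cancel.\<close>

lemma ky_fan:
  assumes x: "positive_operator x" "compact_operator x" "diagonalizes X x" and t: "0 < t"
    and F: "orthonormal F" "finite F" "card F = card {f \<in> X. t \<le> ev x f}"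
  shows "(\<Sum>e\<in>F. inner (x e) e) \<le> (\<Sum>f\<in>{f \<in> X. t \<le> ev x f}. ev x f)"
proof -
  let ?G = "{f \<in> X. t \<le> ev x f}"
  have sx: "self_adjoint x" using x(1) by (simp add: positive_operator_iff)
  have finG: "finite ?G"
    by (rule finite_subset[OF _ finite_large_eigenvalues[OF x(2,3) t]]) auto
  have onG: "orthonormal ?G" by (rule orthonormal_subset[OF diagonalizesD(1)[OF x(3)]]) auto
  have le: "inner (x e) e \<le> t + (\<Sum>f\<in>?G. (ev x f - t) * (cmod (cinner e f))\<^sup>2)" if "norm e = 1" for e
  proof -
    define s where "s = (\<Sum>f\<in>?G. cinner e f *\<^sub>C f)"
    define r where "r = e - s"
    have r: "r \<in> perp ?G" unfolding r_def s_def by (rule perp_remainder[OF onG finG])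
    have xr: "x r \<in> perp ?G"
      by (rule eigenvector_perp_invariant[OF sx _ r]) (simp add: diagonalizesD(2)[OF x(3)])
    have 0: "inner r s = 0" "inner (x r) s = 0"
      unfolding inner_eq_Re_cinner s_def using cinner_sum_perp[OF finG r] cinner_sum_perp[OF finG xr]
      by simp_all
    have e: "e = s + r" by (simp add: r_def)
    have "inner (x e) e = inner (x s) s + inner (x r) r"
      unfolding e using 0
      by (simp add: blinfun.add_right inner_simps self_adjoint_inner[OF sx, of s r] inner_commute[of s "x r"])
    moreover have "inner (x r) r \<le> t * (norm r)\<^sup>2"
      by (rule form_le_perp_large[OF sx x(2,3)]) (use t r in \<open>auto simp: perp_def\<close>)
    moreover have "(norm r)\<^sup>2 = 1 - (norm s)\<^sup>2"
      using that 0(1) unfolding norm_eq_1 e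
      by (simp add: power2_norm_eq_inner inner_simps inner_commute[of s r])
    moreover have "(norm s)\<^sup>2 = (\<Sum>f\<in>?G. (cmod (cinner e f))\<^sup>2)"
      unfolding s_def by (rule norm_orthonormal_sum[OF onG finG])
    moreover have "inner (x s) s = (\<Sum>f\<in>?G. ev x f * (cmod (cinner e f))\<^sup>2)"
      unfolding s_def by (rule form_orthonormal_sum[OF x(3) finG _ sx]) auto
    ultimately have "inner (x e) e \<le> (\<Sum>f\<in>?G. ev x f * (cmod (cinner e f))\<^sup>2) +
        t * (1 - (\<Sum>f\<in>?G. (cmod (cinner e f))\<^sup>2))"
      by simp
    then show ?thesis by (simp add: left_diff_distrib right_diff_distrib sum_subtractf sum_distrib_left)
  qed
  have "(\<Sum>e\<in>F. inner (x e) e) \<le> (\<Sum>e\<in>F. t + (\<Sum>f\<in>?G. (ev x f - t) * (cmod (cinner e f))\<^sup>2))"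
    by (intro sum_mono le orthonormal_norm[OF F(1)])
  also have "\<dots> = real (card F) * t + (\<Sum>f\<in>?G. (ev x f - t) * (\<Sum>e\<in>F. (cmod (cinner f e))\<^sup>2))"
    unfolding sum.distrib sum_distrib_left
    by (subst sum.swap) (simp add: cmod_cinner_commute)
  also have "\<dots> \<le> real (card F) * t + (\<Sum>f\<in>?G. (ev x f - t) * 1)"
  proof (intro add_left_mono sum_mono mult_left_mono)
    fix f assume "f \<in> ?G"
    then show "(\<Sum>e\<in>F. (cmod (cinner f e))\<^sup>2) \<le> 1" "0 \<le> ev x f - t"
      using bessel[OF F(1,2), of f] orthonormal_norm[OF onG] by auto
  qed
  also have "\<dots> = (\<Sum>f\<in>?G. ev x f)" by (simp add: sum_subtractf F(3))
  finally show ?thesis .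
qed

section \<open>Points of the positive sphere and their differences\<close>

lemma pos_sphereD:
  assumes "x \<in> schatten_pos_sphere p"
  shows "positive_operator x" "self_adjoint x" "compact_operator x" "x \<in> schatten_class p"
  using assms by (auto simp: schatten_pos_sphere_def schatten_class_def positive_operator_iff)

lemma pos_sphere_has_sum:
  assumes "0 < p" "x \<in> schatten_pos_sphere p" "diagonalizes X x"
  shows "((\<lambda>f. ev x f powr p) has_sum 1) X"
proof -
  note x = pos_sphereD[OF assms(2)]
  have "schatten_sum p x = 1"
    using assms(1,2) by (simp add: schatten_pos_sphere_def schatten_norm_eq_1_iff)
  moreover have "(\<lambda>e. \<bar>ev x e\<bar> powr p) summable_on X"
    using x(4) schatten_summable_iff[OF x(2,3) assms(3)] by blast
  ultimately have "((\<lambda>f. \<bar>ev x f\<bar> powr p) has_sum 1) X"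
    using schatten_sum_eq_infsum[OF x(2,3) assms(3)] has_sum_infsum by metis
  then show ?thesis using ev_nonneg[OF x(1)] by simp
qed

lemma form_diff_le:
  assumes "positive_operator y" shows "inner (blinfun_apply (x - y) v) v \<le> inner (blinfun_apply x v) v"
  using assms by (simp add: positive_operator_iff blinfun.diff_left inner_simps)

text \<open>If the sum over the positive part is \<open>1\<close>, then \<open>x - y\<close> and \<open>x\<close> have equally many eigenvalues above
  each level, so Ky Fan's inequality bounds the trace of \<open>x\<close> on the corresponding eigenvectors of
  \<open>x - y\<close> by that of \<open>x - y\<close>, and the form of \<open>y\<close> vanishes there.\<close>

lemma positive_part_sum:
  assumes p: "0 < p" and x: "x \<in> schatten_pos_sphere p" and y: "y \<in> schatten_pos_sphere p"
    and E: "diagonalizes E (x - y)"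
  shows "(\<lambda>e. ev (x - y) e powr p) summable_on {e \<in> E. 0 < ev (x - y) e}"
    and "(\<Sum>\<^sub>\<infinity>e\<in>{e \<in> E. 0 < ev (x - y) e}. ev (x - y) e powr p) \<le> 1"
    and "1 \<le> (\<Sum>\<^sub>\<infinity>e\<in>{e \<in> E. 0 < ev (x - y) e}. ev (x - y) e powr p) \<Longrightarrow>
      e \<in> E \<Longrightarrow> 0 < ev (x - y) e \<Longrightarrow> y e = 0"
proof -
  note x' = pos_sphereD[OF x] and y' = pos_sphereD[OF y]
  let ?A = "x - y" and ?E = "{e \<in> E. 0 < ev (x - y) e}"
  obtain X where X: "diagonalizes X x" "perp X = {0}"
    by (rule diagonalization_exists[OF x'(2,3)])
  have sA: "self_adjoint ?A" using x' y' by (simp add: self_adjoint_diff)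
  have cA: "compact_operator ?A" using x' y' by (simp add: compact_operator_diff)
  interpret dominated_counts ?E "ev ?A" X "ev x"
    by (rule weyl_dominated_counts[OF sA cA E x'(1,3) X(1) form_diff_le[OF y'(1)]])
  note S = pos_sphere_has_sum[OF p x X(1)]
  show "(\<lambda>e. ev ?A e powr p) summable_on ?E" "(\<Sum>\<^sub>\<infinity>e\<in>?E. ev ?A e powr p) \<le> 1"
    using powr_sum_le[OF p S] by auto
  assume eq: "1 \<le> (\<Sum>\<^sub>\<infinity>e\<in>?E. ev ?A e powr p)" and e: "e \<in> E" "0 < ev ?A e"
  define t where "t = ev ?A e"
  have t: "0 < t" using e by (simp add: t_def)
  let ?F = "{e \<in> ?E. t \<le> ev ?A e}" and ?G = "{f \<in> X. t \<le> ev x f}"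
  have onF: "orthonormal ?F" by (rule orthonormal_subset[OF diagonalizesD(1)[OF E]]) auto
  have card: "card {e \<in> ?E. s \<le> ev ?A e} = card {f \<in> X. s \<le> ev x f}" if "0 < s" for s
    by (rule card_eq_of_sum_eq[OF p S eq that])
  \<comment> \<open>Equal counts reverse the domination, so an injection \<open>\<iota>\<close>
    matches \<open>?G\<close> with \<open>?F\<close> and the eigenvalues of \<open>x\<close> over
    \<open>?G\<close> sum to at most those of \<open>x - y\<close> over \<open>?F\<close>.\<close>
  have "dominated_counts {f \<in> X. 0 < ev x f} (ev x) ?E (ev ?A)"
  proof
    fix s :: real assume s: "0 < s"
    have "{f \<in> {f \<in> X. 0 < ev x f}. s \<le> ev x f} = {f \<in> X. s \<le> ev x f}" using s by auto
    then show "finite {f \<in> {f \<in> X. 0 < ev x f}. s \<le> ev x f}"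
      "card {f \<in> {f \<in> X. 0 < ev x f}. s \<le> ev x f} \<le> card {e \<in> ?E. s \<le> ev ?A e}"
      using finX[OF s] card[OF s] by auto
    show "finite {e \<in> ?E. s \<le> ev ?A e}" by (rule finE[OF s])
  qed auto
  then interpret rev: dominated_counts "{f \<in> X. 0 < ev x f}" "ev x" ?E "ev ?A" .
  have "\<exists>\<iota>. inj_on \<iota> ?G \<and> (\<forall>f\<in>?G. \<iota> f \<in> ?E \<and> ev x f \<le> ev ?A (\<iota> f))"
    by (rule rev.dominating_injection) (use finX[OF t] t in auto)
  then obtain \<iota> where \<iota>: "inj_on \<iota> ?G" "\<And>f. f \<in> ?G \<Longrightarrow> \<iota> f \<in> ?E \<and> ev x f \<le> ev ?A (\<iota> f)" by blast
  have "\<iota> ` ?G \<subseteq> ?F" using \<iota>(2) by force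
  then have im: "\<iota> ` ?G = ?F"
    using card_image[OF \<iota>(1)] card[OF t] finE[OF t] by (intro card_subset_eq) auto
  have "(\<Sum>f\<in>?G. ev x f) \<le> (\<Sum>f\<in>?G. ev ?A (\<iota> f))" using \<iota>(2) by (intro sum_mono) auto
  also have "\<dots> = (\<Sum>e\<in>?F. ev ?A e)" unfolding im[symmetric] by (simp add: sum.reindex[OF \<iota>(1)])
  finally have "(\<Sum>e\<in>?F. inner (x e) e) \<le> (\<Sum>e\<in>?F. ev ?A e)"
    using ky_fan[OF x'(1,3) X(1) t onF finE[OF t] card[OF t]] by linarith
  then have "(\<Sum>e\<in>?F. inner (y e) e) \<le> 0"
    by (simp add: ev_def blinfun.diff_left inner_simps sum_subtractf)
  moreover have nn: "0 \<le> inner (y e) e" for e using y'(1) by (simp add: positive_operator_iff)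
  ultimately have "(\<Sum>e\<in>?F. inner (y e) e) = 0" using sum_nonneg[of ?F "\<lambda>e. inner (y e) e"] by force
  then have "\<forall>e\<in>?F. inner (y e) e = 0" using finE[OF t] nn by (subst (asm) sum_nonneg_eq_0_iff) auto
  then have "inner (y e) e = 0" using e by (simp add: t_def)
  then show "y e = 0" by (rule positive_zero_form[OF y'(1)])
qed

text \<open>The eigenvalues are split by sign. Summability for the difference comes from the two
  parts separately, so no quasi-triangle inequality enters; with the bound \<open>1\<close> for each
  part, the distance sum is at most \<open>2\<close>.\<close>

lemma pos_sphere_diff_sum:
  assumes p: "0 < p" and x: "x \<in> schatten_pos_sphere p" and y: "y \<in> schatten_pos_sphere p"
    and E: "diagonalizes E (x - y)"
  shows "((\<lambda>e. \<bar>ev (x - y) e\<bar> powr p) has_sum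
     ((\<Sum>\<^sub>\<infinity>e\<in>{e \<in> E. 0 < ev (x - y) e}. ev (x - y) e powr p) +
      (\<Sum>\<^sub>\<infinity>e\<in>{e \<in> E. 0 < ev (y - x) e}. ev (y - x) e powr p))) E"
proof -
  have m: "ev (y - x) e = - ev (x - y) e" for e using ev_minus[of "x - y" e] by simp
  have E': "diagonalizes E (y - x)" using diagonalizes_uminus[OF E] by simp
  let ?P = "{e \<in> E. 0 < ev (x - y) e}" and ?N = "{e \<in> E. 0 < ev (y - x) e}"
  have P: "((\<lambda>e. \<bar>ev (x - y) e\<bar> powr p) has_sum (\<Sum>\<^sub>\<infinity>e\<in>?P. ev (x - y) e powr p)) ?P"
    by (rule has_sum_cong[THEN iffD1, OF _ has_sum_infsum[OF positive_part_sum(1)[OF p x y E]]]) simp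
  have N: "((\<lambda>e. \<bar>ev (x - y) e\<bar> powr p) has_sum (\<Sum>\<^sub>\<infinity>e\<in>?N. ev (y - x) e powr p)) ?N"
    by (rule has_sum_cong[THEN iffD1, OF _ has_sum_infsum[OF positive_part_sum(1)[OF p y x E']]])
       (simp add: m)
  have "((\<lambda>e. \<bar>ev (x - y) e\<bar> powr p) has_sum
      ((\<Sum>\<^sub>\<infinity>e\<in>?P. ev (x - y) e powr p) + (\<Sum>\<^sub>\<infinity>e\<in>?N. ev (y - x) e powr p))) (?P \<union> ?N)"
    by (rule has_sum_Un_disjoint[OF P N]) (auto simp: m)
  then show ?thesis
    by (rule has_sum_cong_neutral[THEN iffD1, rotated -1]) (auto simp: m)
qed

lemma pos_sphere_diff_compact:
  assumes "x \<in> schatten_pos_sphere p" "y \<in> schatten_pos_sphere p"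
  shows "self_adjoint (x - y)" "compact_operator (x - y)"
  using pos_sphereD[OF assms(1)] pos_sphereD[OF assms(2)]
  by (simp_all add: self_adjoint_diff compact_operator_diff)

text \<open>Both parts must have sum \<open>1\<close>, so \<open>y\<close> vanishes on the positive
  eigenvectors of \<open>x - y\<close> and \<open>x\<close> on the negative ones. On its kernel only
  \<open>x e = y e\<close> is clear; there \<open>x\<close> vanishes because its positive
  eigenvectors already use up the whole sum.\<close>

lemma orthogonal_of_max_distance:
  assumes p: "0 < p" and x: "x \<in> schatten_pos_sphere p" and y: "y \<in> schatten_pos_sphere p"
    and dist: "schatten_sum p (x - y) = 2"
  shows "x (y v) = 0"
proof -
  note x' = pos_sphereD[OF x] and y' = pos_sphereD[OF y]
  note A = pos_sphere_diff_compact[OF x y]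
  have m: "ev (y - x) e = - ev (x - y) e" for e using ev_minus[of "x - y" e] by simp
  obtain E where E: "diagonalizes E (x - y)" "perp E = {0}"
    by (rule diagonalization_exists[OF A])
  have E': "diagonalizes E (y - x)" using diagonalizes_uminus[OF E(1)] by simp
  let ?P = "{e \<in> E. 0 < ev (x - y) e}" and ?N = "{e \<in> E. 0 < ev (y - x) e}"
  have "(\<Sum>\<^sub>\<infinity>e\<in>?P. ev (x - y) e powr p) + (\<Sum>\<^sub>\<infinity>e\<in>?N. ev (y - x) e powr p) = 2"
    using infsumI[OF pos_sphere_diff_sum[OF p x y E(1)]] schatten_sum_eq_infsum[OF A E(1), of p] dist
    by simp
  then have eqP: "(\<Sum>\<^sub>\<infinity>e\<in>?P. ev (x - y) e powr p) = 1" and "(\<Sum>\<^sub>\<infinity>e\<in>?N. ev (y - x) e powr p) = 1"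
    using positive_part_sum(2)[OF p x y E(1)] positive_part_sum(2)[OF p y x E'] by linarith+
  then have yP: "y e = 0" if "e \<in> E" "0 < ev (x - y) e" for e
    using positive_part_sum(3)[OF p x y E(1)] that by simp
  have xN: "x e = 0" if "e \<in> E" "ev (x - y) e < 0" for e
    using positive_part_sum(3)[OF p y x E'] that \<open>(\<Sum>\<^sub>\<infinity>e\<in>?N. ev (y - x) e powr p) = 1\<close> by (simp add: m)
  have eig: "x e - y e = ev (x - y) e *\<^sub>R e" if "e \<in> E" for e
    using diagonalizesD(2)[OF E(1) that] by (simp add: blinfun.diff_left)
  have xP: "x e = ev (x - y) e *\<^sub>R e" if "e \<in> ?P" for e using eig[of e] yP[of e] that by simp
  have evP: "ev x e = ev (x - y) e" if "e \<in> ?P" for e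
    using ev_eqI[OF xP[OF that]] orthonormal_norm[OF diagonalizesD(1)[OF E(1)], of e] that by simp
  have onP: "orthonormal ?P" by (rule orthonormal_subset[OF diagonalizesD(1)[OF E(1)]]) auto
  \<comment> \<open>The set \<open>?P\<close> consists of eigenvectors of \<open>x\<close> whose
    powers already sum to \<open>1\<close>; every further member of an eigenbasis must therefore
    have eigenvalue \<open>0\<close>.\<close>
  obtain X where X: "?P \<subseteq> X" "diagonalizes X x" "perp X = {0}"
    using spectral_theorem[OF x'(2,3) onP] xP evP by metis
  have zero: "ev x f = 0" if f: "f \<in> X" "f \<notin> ?P" for f
  proof -
    have P1: "((\<lambda>e. ev x e powr p) has_sum 1) ?P"
      using has_sum_infsum[OF positive_part_sum(1)[OF p x y E(1)]] unfolding eqP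
      by (rule has_sum_cong[THEN iffD1, rotated]) (simp add: evP)
    have "((\<lambda>e. ev x e powr p) has_sum (ev x f powr p + 1)) (insert f ?P)"
      by (rule has_sum_insert[OF f(2) P1])
    then have "ev x f powr p + 1 \<le> 1"
      by (rule has_sum_mono2[OF _ pos_sphere_has_sum[OF p x X(2)]]) (use X(1) f in auto)
    then show ?thesis by simp
  qed
  have x0: "x e = 0" if e: "e \<in> E" "ev (x - y) e = 0" for e
  proof -
    have "cinner (x e) f = 0" if f: "f \<in> X" for f
    proof (cases "f \<in> ?P")
      case True
      then have "cinner e f = 0"
        using orthonormal_cinner[OF diagonalizesD(1)[OF E(1)] e(1), of f] e(2) by auto
      then show ?thesis by (simp add: diagonalizes_cinner[OF x'(2) X(2) f])
    qed (simp add: diagonalizes_cinner[OF x'(2) X(2) f] zero[OF f])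
    then have "x e \<in> perp X" by (simp add: perp_def)
    then show ?thesis using X(3) by simp
  qed
  have yx: "y (x e) = 0" if e: "e \<in> E" for e
  proof -
    consider "0 < ev (x - y) e" | "ev (x - y) e < 0" | "ev (x - y) e = 0" by linarith
    then show ?thesis
    proof cases
      case 1
      then show ?thesis using xP[of e] yP[OF e 1] e by (simp add: blinfun.scaleR_right)
    qed (simp_all add: xN[OF e] x0[OF e] blinfun.zero_right)
  qed
  have "x (y v) \<in> perp E"
    by (auto simp: perp_def self_adjointD[OF x'(2)] self_adjointD[OF y'(2)] yx cinner.zero_right)
  then show ?thesis using E(2) by simp
qed

text \<open>Without kernel vectors the eigenvectors of \<open>x\<close> and of \<open>y\<close> are
  mutually orthogonal, so together they diagonalize \<open>x - y\<close> and the two sums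
  add.\<close>

lemma max_distance_of_orthogonal:
  assumes p: "0 < p" and x: "x \<in> schatten_pos_sphere p" and y: "y \<in> schatten_pos_sphere p"
    and xy: "\<And>v. x (y v) = 0"
  shows "schatten_sum p (x - y) = 2"
proof -
  note x' = pos_sphereD[OF x] and y' = pos_sphereD[OF y]
  obtain X0 where "diagonalizes X0 x" "perp X0 = {0}"
    by (rule diagonalization_exists[OF x'(2,3)])
  obtain X where X: "diagonalizes X x" "\<And>e. e \<in> X \<Longrightarrow> ev x e \<noteq> 0"
  proof (rule that)
    show "diagonalizes {e \<in> X0. ev x e \<noteq> 0} x"
      by (rule diagonalizes_nonzero[OF x'(2) \<open>diagonalizes X0 x\<close>])
  qed simp
  obtain Y0 where "diagonalizes Y0 y" "perp Y0 = {0}"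
    by (rule diagonalization_exists[OF y'(2,3)])
  obtain Y where Y: "diagonalizes Y y" "\<And>e. e \<in> Y \<Longrightarrow> ev y e \<noteq> 0"
  proof (rule that)
    show "diagonalizes {e \<in> Y0. ev y e \<noteq> 0} y"
      by (rule diagonalizes_nonzero[OF y'(2) \<open>diagonalizes Y0 y\<close>])
  qed simp
  have xY: "x e = 0" if "e \<in> Y" for e
    using xy[of e] Y(2)[OF that] by (simp add: diagonalizesD(2)[OF Y(1) that] blinfun.scaleR_right)
  have yx: "y (x v) = 0" for v
    by (rule cinner_eqI[where 'a = 'a])
       (simp add: self_adjointD[OF x'(2)] self_adjointD[OF y'(2)] xy cinner.zero_left cinner.zero_right)
  have yX: "y e = 0" if "e \<in> X" for e
    using yx[of e] X(2)[OF that] by (simp add: diagonalizesD(2)[OF X(1) that] blinfun.scaleR_right)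
  have YX: "Y \<subseteq> perp X"
  proof
    fix f assume f: "f \<in> Y"
    have "cinner f e = 0" if e: "e \<in> X" for e
      using diagonalizes_cinner[OF x'(2) X(1) e, of f] X(2)[OF e] xY[OF f] by (simp add: cinner.zero_left)
    then show "f \<in> perp X" by (simp add: perp_def)
  qed
  have on: "orthonormal (X \<union> Y)"
    by (rule orthonormal_Un[OF diagonalizesD(1)[OF X(1)] diagonalizesD(1)[OF Y(1)] YX])
  have dX: "(x - y) e = ev x e *\<^sub>R e" if "e \<in> X" for e
    using yX[OF that] by (simp add: blinfun.diff_left diagonalizesD(2)[OF X(1) that])
  have dY: "(x - y) e = (- ev y e) *\<^sub>R e" if "e \<in> Y" for e
    using xY[OF that] by (simp add: blinfun.diff_left diagonalizesD(2)[OF Y(1) that])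
  have evX: "ev (x - y) e = ev x e" if "e \<in> X" for e
    by (rule ev_eqI[OF dX[OF that]]) (use on that in \<open>auto simp: orthonormal_def\<close>)
  have evY: "ev (x - y) e = - ev y e" if "e \<in> Y" for e
    by (rule ev_eqI[OF dY[OF that]]) (use on that in \<open>auto simp: orthonormal_def\<close>)
  have E: "diagonalizes (X \<union> Y) (x - y)"
    unfolding diagonalizes_def
  proof (intro conjI ballI on)
    show "(x - y) e = ev (x - y) e *\<^sub>R e" if "e \<in> X \<union> Y" for e
      using that dX dY evX evY by auto
    show "(x - y) v = 0" if v: "v \<in> perp (X \<union> Y)" for v
      using diagonalizesD(3)[OF X(1), of v] diagonalizesD(3)[OF Y(1), of v] v
      by (simp add: blinfun.diff_left perp_def)
  qed
  have "((\<lambda>e. \<bar>ev (x - y) e\<bar> powr p) has_sum (1 + 1)) (X \<union> Y)"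
  proof (rule has_sum_Un_disjoint)
    show "((\<lambda>e. \<bar>ev (x - y) e\<bar> powr p) has_sum 1) X"
      by (rule has_sum_cong[THEN iffD1, OF _ pos_sphere_has_sum[OF p x X(1)]])
         (simp add: evX ev_nonneg[OF x'(1)])
    show "((\<lambda>e. \<bar>ev (x - y) e\<bar> powr p) has_sum 1) Y"
      by (rule has_sum_cong[THEN iffD1, OF _ pos_sphere_has_sum[OF p y Y(1)]])
         (simp add: evY ev_nonneg[OF y'(1)])
    show "X \<inter> Y = {}" using YX orthonormal_disjoint_perp[OF diagonalizesD(1)[OF X(1)]] by auto
  qed
  then show ?thesis
    using schatten_sum_eq_infsum[OF pos_sphere_diff_compact[OF x y] E, of p] infsumI by fastforce
qed

section \<open>Rank-one projections\<close>

text \<open>The projection onto the line of \<open>u\<close> if \<open>u\<close> is a unit vector,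
  and in general \<open>(norm u)^2\<close> times it. The scaling serves later to absorb nonnegative
  coefficients.\<close>

definition rank_one :: "'h::complex_hilbert \<Rightarrow> ('h \<Rightarrow>\<^sub>L 'h)"
  where "rank_one u = Blinfun (\<lambda>v. cinner v u *\<^sub>C u)"

lemma rank_one_apply: "blinfun_apply (rank_one u) v = cinner v u *\<^sub>C u"
  unfolding rank_one_def
  by (intro bounded_linear_Blinfun_apply[THEN fun_cong]
      bounded_linear_compose[OF scaleC.bounded_linear_left cinner.bounded_linear_left])

lemma self_adjoint_rank_one: "self_adjoint (rank_one u)"
  by (simp add: self_adjoint_def rank_one_apply cinner_scaleC_left cinner_scaleC_right
      cinner_commute[of u])

lemma form_rank_one: "inner (blinfun_apply (rank_one u) v) v = (cmod (cinner v u))\<^sup>2"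
proof -
  have "cinner (rank_one u v) v = complex_of_real ((cmod (cinner v u))\<^sup>2)"
    by (simp only: rank_one_apply cinner_scaleC_left cinner_mult_commute)
  then show ?thesis by (simp only: inner_eq_Re_cinner Re_complex_of_real)
qed

lemma positive_rank_one: "positive_operator (rank_one u)"
  by (simp add: positive_operator_iff self_adjoint_rank_one form_rank_one)

lemma compact_rank_one: "compact_operator (rank_one u)"
proof -
  let ?K = "(\<lambda>c. c *\<^sub>C u) ` cball 0 (norm u)"
  have K: "compact ?K"
    by (intro compact_continuous_image compact_cball linear_continuous_on scaleC.bounded_linear_left)
  have "rank_one u ` cball 0 1 \<subseteq> ?K"
  proof
    fix w assume "w \<in> rank_one u ` cball 0 1"
    then obtain v where v: "norm v \<le> 1" "w = cinner v u *\<^sub>C u" by (auto simp: rank_one_apply)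
    have "cmod (cinner v u) \<le> norm v * norm u" by (rule cmod_cinner_le)
    also have "\<dots> \<le> norm u" using v(1) by (simp add: mult_left_le_one_le)
    finally show "w \<in> ?K" using v(2) by auto
  qed
  then have "compact (closure (rank_one u ` cball 0 1))" by (rule compact_closure_subset[OF K])
  then show ?thesis
    using self_adjoint_complex_linear[OF self_adjoint_rank_one] by (simp add: compact_operator_def)
qed

lemma rank_one_unit:
  assumes "norm u = 1"
  shows "rank_one u u = u" "ev (rank_one u) u = 1" "diagonalizes {u} (rank_one u)"
proof -
  show 1: "rank_one u u = u" using assms by (simp add: rank_one_apply cinner_self)
  show 2: "ev (rank_one u) u = 1" using assms 1 by (intro ev_eqI) auto
  show "diagonalizes {u} (rank_one u)"
    using assms 1 2 by (simp add: diagonalizes_def orthonormal_def perp_def rank_one_apply)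
qed

lemma pos_sphereI:
  assumes "0 < p" "positive_operator x" "compact_operator x" "diagonalizes X x"
    "((\<lambda>f. ev x f powr p) has_sum 1) X"
  shows "x \<in> schatten_pos_sphere p"
proof -
  have sx: "self_adjoint x" using assms(2) by (simp add: positive_operator_iff)
  have s: "((\<lambda>f. \<bar>ev x f\<bar> powr p) has_sum 1) X" using assms(5) ev_nonneg[OF assms(2)] by simp
  have "x \<in> schatten_class p"
    using schatten_summable_iff[OF sx assms(3,4)] has_sum_imp_summable[OF s] by blast
  moreover have "schatten_norm p x = 1"
    using schatten_sum_eq_infsum[OF sx assms(3,4), of p] infsumI[OF s] assms(1)
    by (simp add: schatten_norm_eq_1_iff)
  ultimately show ?thesis using assms(2) by (simp add: schatten_pos_sphere_def)
qed

lemma rank_one_in_sphere: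
  assumes "0 < p" "norm u = 1" shows "rank_one u \<in> schatten_pos_sphere p"
  by (rule pos_sphereI[OF assms(1) positive_rank_one compact_rank_one rank_one_unit(3)[OF assms(2)]])
     (simp add: rank_one_unit[OF assms(2)] has_sum_finite_iff)

lemma rank_one_scaleC: "cmod c = 1 \<Longrightarrow> rank_one (c *\<^sub>C u) = rank_one u"
proof (rule blinfun_eqI)
  fix v assume "cmod c = 1"
  then have "cnj c * c = 1" by (metis complex_norm_square mult.commute of_real_1 power_one)
  then show "rank_one (c *\<^sub>C u) v = rank_one u v"
    by (simp add: rank_one_apply cinner_scaleC_right scaleC_scaleC mult.assoc[symmetric] mult.commute)
qed

lemma cauchy_schwarz_equality_parallel:
  assumes "cmod (cinner u v) = norm u * norm v" "v \<noteq> 0"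
  obtains c where "u = c *\<^sub>C v"
proof -
  let ?v = "v /\<^sub>R norm v"
  have "u = cinner u ?v *\<^sub>C ?v"
    by (rule cauchy_schwarz_equality) (use assms in \<open>auto simp: cinner.scaleR_right\<close>)
  also have "\<dots> = (cinner u ?v / norm v) *\<^sub>C v"
    by (subst scaleR_scaleC) (simp add: scaleC_scaleC divide_inverse)
  finally show ?thesis using that by blast
qed

lemma rank_one_eq_of_parallel:
  assumes "norm u = 1" "norm v = 1" "cmod (cinner u v) = 1"
  shows "rank_one u = rank_one v"
proof -
  have "u = cinner u v *\<^sub>C v" by (rule cauchy_schwarz_equality) (use assms in auto)
  then show ?thesis using rank_one_scaleC[OF assms(3), of v] by simp
qed

lemma schatten_sum_zero: "schatten_sum p 0 = 0"
proof -
  have "diagonalizes {} (0 :: 'a \<Rightarrow>\<^sub>L 'a)" by (simp add: diagonalizes_def orthonormal_def)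
  from schatten_sum_finite[OF self_adjoint_zero compact_operator_zero this] show ?thesis by simp
qed

text \<open>The square of \<open>P u - P v\<close> is the scalar \<open>1 - (cmod (cinner u v))\<^sup>2\<close> on the span of \<open>u\<close> and
  \<open>v\<close>.\<close>

lemma schatten_sum_rank_one_diff:
  assumes u: "norm u = 1" and v: "norm v = 1"
  shows "schatten_sum p (rank_one u - rank_one v) = 2 * sqrt (1 - (cmod (cinner u v))\<^sup>2) powr p"
proof (cases "cmod (cinner u v) = 1")
  case True
  then show ?thesis using rank_one_eq_of_parallel[OF u v] by (simp add: schatten_sum_zero)
next
  case False
  let ?A = "rank_one u - rank_one v"
  define c where "c = cinner u v"
  have "cmod c \<le> 1" using cmod_cinner_le[of u v] u v by (simp add: c_def)
  then have c1: "cmod c < 1" using False by (simp add: c_def)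
  define s where "s = sqrt (1 - (cmod c)\<^sup>2)"
  have "(cmod c)\<^sup>2 < 1" using power_strict_mono[OF c1 norm_ge_zero, of 2] by simp
  then have s: "0 < s" and s2: "s\<^sup>2 = 1 - (cmod c)\<^sup>2" by (auto simp: s_def)
  have sA: "self_adjoint ?A" by (intro self_adjoint_diff self_adjoint_rank_one)
  have A: "?A w = cinner w u *\<^sub>C u - cinner w v *\<^sub>C v" for w
    by (simp add: blinfun.diff_left rank_one_apply)
  have vu: "cinner v u = cnj c" by (simp add: c_def cinner_commute[of v u])
  have cc: "c * cnj c = 1 - complex_of_real (s\<^sup>2)" by (simp add: s2 complex_norm_square[symmetric])
  have Au: "?A u = u - c *\<^sub>C v" using u by (simp add: A cinner_self c_def)
  have Av: "?A v = cnj c *\<^sub>C u - v" using v by (simp add: A cinner_self vu)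
  have AAu: "?A (?A u) = complex_of_real (s\<^sup>2) *\<^sub>C u"
  proof -
    have "?A (?A u) = ?A u - c *\<^sub>C ?A v"
      by (simp only: Au blinfun.diff_right self_adjoint_scaleC[OF sA])
    also have "\<dots> = u - (c * cnj c) *\<^sub>C u" by (simp add: Au Av scaleC.diff_right scaleC_scaleC)
    finally show ?thesis by (simp add: cc scaleC.diff_left)
  qed
  have AAv: "?A (?A v) = complex_of_real (s\<^sup>2) *\<^sub>C v"
  proof -
    have "?A (?A v) = cnj c *\<^sub>C ?A u - ?A v"
      by (simp only: Av blinfun.diff_right self_adjoint_scaleC[OF sA])
    also have "\<dots> = v - (c * cnj c) *\<^sub>C v"
      by (simp add: Au Av scaleC.diff_right scaleC_scaleC mult.commute)
    finally show ?thesis by (simp add: cc scaleC.diff_left)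
  qed
  have sing: "w \<in> singular_space ?A t \<longleftrightarrow> ?A (?A w) = complex_of_real (t\<^sup>2) *\<^sub>C w" for w t
    by (simp add: singular_space_def self_adjoint_adjoint[OF sA])
  let ?S = "complex_vector.span {u, v}"
  have sub: "complex_vector.subspace (singular_space ?A s)"
    by (rule complex_vector.subspaceI)
       (simp_all add: sing blinfun.zero_right blinfun.add_right self_adjoint_scaleC[OF sA]
         scaleC_add_right scaleC_scaleC mult.commute)
  have Sle: "?S \<subseteq> singular_space ?A s"
    by (rule complex_vector.span_minimal[OF _ sub]) (use AAu AAv sing in blast)
  have range: "?A w \<in> ?S" for w
    unfolding A by (intro complex_vector.span_diff complex_vector.span_scale complex_vector.span_base) auto
  \<comment> \<open>A singular vector for a positive value lies in the range of \<open>?A\<close>,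
    hence in the span of \<open>u\<close> and \<open>v\<close>; so \<open>s\<close> is the only
    singular value and has multiplicity two.\<close>
  have in_S: "w \<in> ?S" if "w \<in> singular_space ?A t" "0 < t" for w t
  proof -
    have "w = inverse (complex_of_real (t\<^sup>2)) *\<^sub>C ?A (?A w)"
      using that by (simp add: sing scaleC_scaleC)
    then show ?thesis using complex_vector.span_scale[OF range] by metis
  qed
  then have S: "singular_space ?A s = ?S" using Sle s by blast
  have u0: "u \<noteq> 0" "v \<noteq> 0" using u v by auto
  have vals: "singular_values ?A = {s}"
  proof
    show "singular_values ?A \<subseteq> {s}"
    proof
      fix t assume "t \<in> singular_values ?A"
      then obtain w where t: "0 < t" and w: "w \<in> singular_space ?A t" "w \<noteq> 0"
        by (auto simp: singular_values_def)
      have "w \<in> singular_space ?A s" using in_S[OF w(1) t] Sle by blast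
      then have "complex_of_real (t\<^sup>2) *\<^sub>C w = complex_of_real (s\<^sup>2) *\<^sub>C w"
        using w(1) by (simp only: sing)
      then have "complex_of_real (t\<^sup>2) = complex_of_real (s\<^sup>2)"
        using w(2) complex_vector.scale_right_imp_eq by metis
      then have "t\<^sup>2 = s\<^sup>2" by (simp only: of_real_eq_iff)
      then show "t \<in> {s}" using t s by (simp add: power2_eq_iff)
    qed
    have "u \<in> singular_space ?A s" using AAu sing by blast
    then show "{s} \<subseteq> singular_values ?A" using s u0 by (auto simp: singular_values_def)
  qed
  have "u \<notin> complex_vector.span {v}"
  proof
    assume "u \<in> complex_vector.span {v}"
    then obtain k where k: "u = k *\<^sub>C v" by (auto simp: complex_vector.span_singleton)
    then have "cmod k = 1" using u v by (simp add: norm_scaleC)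
    then have "cmod c = 1" using v by (simp add: c_def k cinner_scaleC_left cinner_self norm_mult)
    then show False using c1 by simp
  qed
  moreover have "u \<noteq> v" using calculation complex_vector.span_base[of v "{v}"] by auto
  ultimately have ind: "complex_vector.independent {u, v}" "u \<noteq> v"
    using u0 by (simp_all add: complex_vector.independent_insert complex_vector.dependent_single)
  have "singular_mult ?A s = card {u, v}"
    unfolding singular_mult_def S by (rule complex_vector.dim_span_eq_card_independent[OF ind(1)])
  then have "singular_mult ?A s = 2" using ind(2) by simp
  then show ?thesis by (simp add: schatten_sum_def vals s_def c_def)
qed

lemma rank_one_diff_sum_eq_imp:
  assumes "0 < p" "norm u = 1" "norm v = 1" "norm u' = 1" "norm v' = 1"
    and "schatten_sum p (rank_one u - rank_one v) = schatten_sum p (rank_one u' - rank_one v')"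
  shows "cmod (cinner u v) = cmod (cinner u' v')"
proof -
  let ?s = "\<lambda>a b. sqrt (1 - (cmod (cinner a b))\<^sup>2)"
  have le: "0 \<le> 1 - (cmod (cinner u v))\<^sup>2" "0 \<le> 1 - (cmod (cinner u' v'))\<^sup>2"
    using cmod_cinner_le[of u v] cmod_cinner_le[of u' v'] assms by (simp_all add: power_le_one)
  have "?s u v powr p = ?s u' v' powr p"
    using assms by (simp add: schatten_sum_rank_one_diff)
  then have "(?s u v powr p) powr (1 / p) = (?s u' v' powr p) powr (1 / p)" by simp
  then have "?s u v = ?s u' v'" using le assms by (simp add: powr_powr)
  then have "(cmod (cinner u v))\<^sup>2 = (cmod (cinner u' v'))\<^sup>2" by simp
  then show ?thesis by (rule power2_eq_imp_eq) auto
qed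

lemma pos_sphere_eq_of_sum_zero:
  assumes p: "0 < p" and x: "x \<in> schatten_pos_sphere p" and y: "y \<in> schatten_pos_sphere p"
    and zero: "schatten_sum p (x - y) = 0"
  shows "x = y"
proof -
  note A = pos_sphere_diff_compact[OF x y]
  obtain E where E: "diagonalizes E (x - y)" "perp E = {0}" by (rule diagonalization_exists[OF A])
  \<comment> \<open>Without summability the value \<open>0\<close> could be the default of a
    divergent sum.\<close>
  have "(\<lambda>e. \<bar>ev (x - y) e\<bar> powr p) summable_on E"
    by (rule has_sum_imp_summable[OF pos_sphere_diff_sum[OF p x y E(1)]])
  then have S: "((\<lambda>e. \<bar>ev (x - y) e\<bar> powr p) has_sum 0) E"
    using schatten_sum_eq_infsum[OF A E(1), of p] zero has_sum_infsum by metis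
  have "ev (x - y) e = 0" if "e \<in> E" for e
    using finite_sum_le_has_sum[OF S, of "{e}"] that by simp
  then have "(x - y) v \<in> perp E" for v
    by (simp add: perp_def diagonalizes_cinner[OF A(1) E(1)])
  then have "x - y = 0" using E(2) by (intro blinfun_eqI) auto
  then show ?thesis by simp
qed

lemma pos_sphere_eigenvector:
  assumes "0 < p" "x \<in> schatten_pos_sphere p"
  obtains g a where "norm g = 1" "a \<noteq> 0" "x g = a *\<^sub>R g"
proof -
  note x = pos_sphereD[OF assms(2)]
  obtain X where X: "diagonalizes X x" "perp X = {0}" by (rule diagonalization_exists[OF x(2,3)])
  have "\<exists>g\<in>X. ev x g \<noteq> 0"
  proof (rule ccontr)
    assume "\<not> ?thesis"
    then have "((\<lambda>f. ev x f powr p) has_sum 0) X" by (intro has_sum_0) auto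
    then show False using pos_sphere_has_sum[OF assms X(1)] has_sum_unique by fastforce
  qed
  then show ?thesis using that diagonalizesD[OF X(1)] orthonormal_norm by metis
qed

text \<open>Symmetry forces \<open>r u\<close> into the line of \<open>u\<close>: its component
  \<open>w\<close> orthogonal to \<open>u\<close> is killed by \<open>r\<close>, so \<open>w\<close>
  is orthogonal to itself. The unit sum then makes the eigenvalue \<open>1\<close>.\<close>

lemma pos_sphere_eq_rank_one:
  assumes p: "0 < p" and r: "r \<in> schatten_pos_sphere p" and u: "norm u = 1"
    and zero: "\<And>v. cinner v u = 0 \<Longrightarrow> blinfun_apply r v = 0"
  shows "r = rank_one u"
proof -
  note r' = pos_sphereD[OF r]
  define w where "w = r u - cinner (r u) u *\<^sub>C u"
  have wu: "cinner w u = 0"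
    using u by (simp add: w_def cinner.diff_left cinner_scaleC_left cinner_self)
  have "cinner w w = cinner (r u) w - cinner (r u) u * cinner u w"
    by (simp add: w_def cinner.diff_left cinner_scaleC_left)
  also have "cinner (r u) w = 0"
    using zero[OF wu] by (simp only: self_adjointD[OF r'(2)] cinner.zero_right)
  also have "cinner u w = 0" using wu cinner_eq_zero_commute by blast
  finally have "w = 0" by (simp add: cinner_self[of w])
  then have ru: "r u = ev r u *\<^sub>R u"
    using scaleR_scaleC[of "ev r u" u]
    by (simp add: w_def ev_def self_adjoint_cinner_real[OF r'(2)])
  have "diagonalizes {u} r" using u ru zero by (simp add: diagonalizes_def orthonormal_def perp_def)
  then have "((\<lambda>f. ev r f powr p) has_sum 1) {u}" by (rule pos_sphere_has_sum[OF p r])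
  then have "ev r u powr p = 1" using has_sum_unique[OF _ has_sum_finite] by fastforce
  moreover have "ev r u = (ev r u powr p) powr (1 / p)"
    using p ev_nonneg[OF r'(1), of u] by (simp add: powr_powr)
  ultimately have "ev r u = 1" by (metis powr_one_eq_one)
  then have ru1: "r u = u" using ru by simp
  show ?thesis
  proof (rule blinfun_eqI)
    fix v
    have "r (v - cinner v u *\<^sub>C u) = 0"
      using u by (intro zero) (simp add: cinner.diff_left cinner_scaleC_left cinner_self)
    then show "r v = rank_one u v"
      by (simp add: blinfun.diff_right self_adjoint_scaleC[OF r'(2)] ru1 rank_one_apply)
  qed
qed

lemma orthogonal_rank_one:
  assumes "x \<in> schatten_pos_sphere p" "norm u = 1"
  shows "(\<forall>v. blinfun_apply x (blinfun_apply (rank_one u) v) = 0) \<longleftrightarrow> blinfun_apply x u = 0"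
proof -
  have "x (rank_one u v) = cinner v u *\<^sub>C x u" for v
    using self_adjoint_scaleC pos_sphereD[OF assms(1)] by (simp add: rank_one_apply)
  then show ?thesis using assms(2) by (auto simp: cinner_self scaleC.zero_right dest: spec[of _ u])
qed

section \<open>Isometries between positive spheres\<close>

locale sphere_isometry =
  fixes p :: real and V :: "('h::complex_hilbert \<Rightarrow>\<^sub>L 'h) \<Rightarrow> ('k::complex_hilbert \<Rightarrow>\<^sub>L 'k)"
  assumes p: "0 < p"
    and isometry: "schatten_isometry_onto p (schatten_pos_sphere p) (schatten_pos_sphere p) V"
begin

lemma maps: "x \<in> schatten_pos_sphere p \<Longrightarrow> V x \<in> schatten_pos_sphere p"
  using isometry by (auto simp: schatten_isometry_onto_def)

lemma onto: "y \<in> schatten_pos_sphere p \<Longrightarrow> \<exists>x\<in>schatten_pos_sphere p. V x = y"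
  using isometry unfolding schatten_isometry_onto_def by (metis imageE)

lemma sum_diff:
  "x \<in> schatten_pos_sphere p \<Longrightarrow> y \<in> schatten_pos_sphere p \<Longrightarrow>
    schatten_sum p (V x - V y) = schatten_sum p (x - y)"
  using isometry by (simp add: schatten_isometry_onto_def schatten_norm_eq_iff[OF p])

lemma orthogonal_iff:
  assumes x: "x \<in> schatten_pos_sphere p" and y: "y \<in> schatten_pos_sphere p"
  shows "(\<forall>v. blinfun_apply (V x) (blinfun_apply (V y) v) = 0) \<longleftrightarrow> (\<forall>v. blinfun_apply x (blinfun_apply y v) = 0)"
  using orthogonal_of_max_distance[OF p x y] max_distance_of_orthogonal[OF p x y]
    orthogonal_of_max_distance[OF p maps[OF x] maps[OF y]]
    max_distance_of_orthogonal[OF p maps[OF x] maps[OF y]] sum_diff[OF x y]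
  by metis

lemma injective:
  assumes "x \<in> schatten_pos_sphere p" "y \<in> schatten_pos_sphere p" "V x = V y"
  shows "x = y"
  using pos_sphere_eq_of_sum_zero[OF p assms(1,2)] sum_diff[OF assms(1,2)] assms(3)
  by (simp add: schatten_sum_zero)

text \<open>If \<open>V (P u) = Q\<close> had an eigenvector \<open>g\<close> and \<open>V r = P g\<close>, then everything orthogonal to
  \<open>Q\<close> is orthogonal to \<open>P g\<close>, so everything orthogonal to \<open>P u\<close> is orthogonal to \<open>r\<close>; hence
  \<open>r = P u\<close>.\<close>

lemma rank_one_image:
  assumes u: "norm u = 1"
  shows "\<exists>w. norm w = 1 \<and> V (rank_one u) = rank_one w"
proof -
  note Pu = rank_one_in_sphere[OF p u]
  let ?Q = "V (rank_one u)"
  obtain g a where g: "norm g = 1" "a \<noteq> 0" "?Q g = a *\<^sub>R g"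
    by (rule pos_sphere_eigenvector[OF p maps[OF Pu]])
  obtain r where r: "r \<in> schatten_pos_sphere p" "V r = rank_one g"
    using onto[OF rank_one_in_sphere[OF p g(1)]] by blast
  have "r = rank_one u"
  proof (rule pos_sphere_eq_rank_one[OF p r(1) u])
    fix v assume vu: "cinner v u = 0"
    show "r v = 0"
    proof (cases "v = 0")
      case False
      define w where "w = v /\<^sub>R norm v"
      have w: "norm w = 1" "cinner w u = 0" using False vu by (auto simp: w_def cinner.scaleR_left)
      note Pw = rank_one_in_sphere[OF p w(1)]
      have "\<forall>z. rank_one w (rank_one u z) = 0"
        using w(2) cinner_eq_zero_commute[of u w]
        by (simp add: rank_one_apply cinner_scaleC_left scaleC.zero_left)
      then have "V (rank_one w) (?Q g) = 0" using orthogonal_iff[OF Pw Pu] by blast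
      then have "V (rank_one w) g = 0" using g by (simp add: blinfun.scaleR_right)
      then have "\<forall>z. V (rank_one w) (V r z) = 0"
        using orthogonal_rank_one[OF maps[OF Pw] g(1)] r(2)
        by (simp add: rank_one_apply self_adjoint_scaleC[OF pos_sphereD(2)[OF maps[OF Pw]]] scaleC.zero_right)
      then have *: "rank_one w (r z) = 0" for z using orthogonal_iff[OF Pw r(1)] by blast
      have "cinner (r w) (r w) = 0"
        using *[of "r w"] w(1) self_adjointD[OF pos_sphereD(2)[OF r(1)], of "r w" w]
        by (auto simp: rank_one_apply)
      then have "r w = 0" by (simp add: cinner_self)
      then show ?thesis using False by (simp add: w_def blinfun.scaleR_right)
    qed (simp add: blinfun.zero_right)
  qed
  then show ?thesis using r(2) g(1) by metis
qed

text \<open>Applied to the inverse, \<open>rank_one_image\<close> shows that every line is reached,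
  which is the surjectivity required for Wigner's theorem.\<close>

lemma inverse_isometry:
  obtains W where "sphere_isometry p W" "\<And>x. x \<in> schatten_pos_sphere p \<Longrightarrow> W (V x) = x"
    "\<And>y. y \<in> schatten_pos_sphere p \<Longrightarrow> V (W y) = y"
proof -
  define W where "W = inv_into (schatten_pos_sphere p) V"
  have img: "V ` schatten_pos_sphere p = schatten_pos_sphere p"
    using isometry by (simp add: schatten_isometry_onto_def)
  have inj: "inj_on V (schatten_pos_sphere p)" using injective by (auto simp: inj_on_def)
  have WV: "W (V x) = x" if "x \<in> schatten_pos_sphere p" for x
    unfolding W_def by (rule inv_into_f_f[OF inj that])
  have VW: "V (W y) = y" if "y \<in> schatten_pos_sphere p" for y
    unfolding W_def by (rule f_inv_into_f) (use img that in simp)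
  have Wm: "W y \<in> schatten_pos_sphere p" if "y \<in> schatten_pos_sphere p" for y
    unfolding W_def by (rule inv_into_into) (use img that in simp)
  have "sphere_isometry p W"
  proof (unfold_locales, rule p)
    show "schatten_isometry_onto p (schatten_pos_sphere p) (schatten_pos_sphere p) W"
      unfolding schatten_isometry_onto_def
    proof (intro conjI ballI)
      show "W ` schatten_pos_sphere p = schatten_pos_sphere p"
        using Wm WV maps by (metis image_eqI image_subsetI subsetI subset_antisym)
      show "schatten_norm p (W x - W y) = schatten_norm p (x - y)"
        if "x \<in> schatten_pos_sphere p" "y \<in> schatten_pos_sphere p" for x y
        using sum_diff[OF Wm[OF that(1)] Wm[OF that(2)]] VW that
        by (simp add: schatten_norm_eq_iff[OF p])
    qed
  qed
  then show ?thesis using WV VW that by blast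
qed

end

section \<open>Wigner's theorem\<close>

text \<open>Unitary and antiunitary maps at once: \<open>\<sigma>\<close> is the identity or
  conjugation. It is its own inverse, so \<open>inv U\<close> has the same
  \<open>\<sigma>\<close>.\<close>

locale semi_unitary =
  fixes U :: "'h::complex_hilbert \<Rightarrow> 'k::complex_hilbert" and \<sigma> :: "complex \<Rightarrow> complex"
  assumes sigma: "\<sigma> = (\<lambda>c. c) \<or> \<sigma> = cnj"
    and add: "U (u + v) = U u + U v"
    and scale: "U (c *\<^sub>C u) = \<sigma> c *\<^sub>C U u"
    and cinner_image: "cinner (U u) (U v) = \<sigma> (cinner u v)"
    and surj: "surj U"

text \<open>The real part is read off from the expansion of \<open>(cmod (1 + z))^2\<close>; the
  constant \<open>1\<close> will come from the fixed vector \<open>e\<close>.\<close>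

lemma Re_eq_of_cmod_eq:
  assumes "cmod (1 + a) = cmod (1 + b)" "cmod a = cmod b"
  shows "Re a = Re b"
proof -
  have *: "(cmod (1 + z))\<^sup>2 = 1 + 2 * Re z + (cmod z)\<^sup>2" for z
    unfolding cmod_power2 by (simp add: power2_eq_square algebra_simps)
  show ?thesis using *[of a] *[of b] assms by simp
qed

text \<open>Fix a unit vector \<open>e\<close> with image \<open>e'\<close>. For \<open>z\<close> orthogonal to \<open>e\<close>, the phase of \<open>\<Phi> (e + z)\<close> can be
  adjusted to get \<open>e' + V z\<close>. The moduli of \<open>cinner (V z) (V w)\<close> and of \<open>1 + cinner (V z) (V w)\<close> are those
  for \<open>z\<close> and \<open>w\<close>, so \<open>V\<close> preserves the real inner product. Hence \<open>V\<close> is real-linear and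
  \<open>V (\<i> z) = \<plusminus> \<i> V z\<close>, with a sign that cannot depend on \<open>z\<close>.\<close>

lemma wigner_vectors:
  fixes \<Phi> :: "'h::complex_hilbert \<Rightarrow> 'k::complex_hilbert"
  assumes pres: "\<And>u v. cmod (cinner (\<Phi> u) (\<Phi> v)) = cmod (cinner u v)"
    and onto: "\<And>w. \<exists>u c. w = c *\<^sub>C \<Phi> u"
  obtains U \<sigma> where "semi_unitary U \<sigma>" "\<And>u. \<exists>c. \<Phi> u = c *\<^sub>C U u"
\<comment> \<open>The zero space has no unit vector to start from.\<close>
proof (cases "\<forall>u::'h. u = 0")
  case True
  have nrm: "norm (\<Phi> u) = 0" for u
    using pres[of u u] True unfolding cinner_self norm_of_real by simp
  then have \<Phi>0: "\<Phi> u = 0" for u by simp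
  then have w0: "w = 0" for w :: 'k using onto[of w] by (auto simp: scaleC.zero_right)
  have "semi_unitary (\<lambda>_::'h. 0::'k) (\<lambda>c. c)"
  proof
    show "surj (\<lambda>_::'h. 0::'k)" using w0 by (metis surjI)
    show "cinner (0::'k) 0 = cinner u v" for u v :: 'h
      using True[rule_format, of u] by (simp add: cinner.zero_left)
  qed (auto simp: scaleC.zero_right)
  moreover have "\<exists>c. \<Phi> u = c *\<^sub>C 0" for u using \<Phi>0 by (simp add: scaleC.zero_right)
  ultimately show ?thesis using that by blast
next
  case False
  then obtain u0 :: 'h where "u0 \<noteq> 0" by blast
  define e where "e = u0 /\<^sub>R norm u0"
  have e: "norm e = 1" using \<open>u0 \<noteq> 0\<close> by (simp add: e_def)
  define e' where "e' = \<Phi> e"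
  have norm\<Phi>: "norm (\<Phi> u) = norm u" for u
  proof -
    have "(norm (\<Phi> u))\<^sup>2 = (norm u)\<^sup>2"
      using pres[of u u] unfolding cinner_self norm_of_real by simp
    then show ?thesis by (rule power2_eq_imp_eq) auto
  qed
  have e': "norm e' = 1" using norm\<Phi> e by (simp add: e'_def)
  have ee: "cinner e e = 1" "cinner e' e' = 1" using e e' by (simp_all add: cinner_self)
  let ?Z = "{z. cinner z e = 0}"
  have ez: "cinner e z = 0" if "z \<in> ?Z" for z
    using that cinner_eq_zero_commute[of e z] by simp
  have Zadd: "z + w \<in> ?Z" and Zscale: "c *\<^sub>C z \<in> ?Z" and ZscaleR: "r *\<^sub>R z \<in> ?Z"
    if "z \<in> ?Z" "w \<in> ?Z" for z w c r
    using that by (simp_all add: cinner.add_left cinner_scaleC_left cinner.scaleR_left)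
  \<comment> \<open>Of modulus \<open>1\<close>, like \<open>cinner (e + z) e\<close>; multiplying
    \<open>\<Phi> (e + z)\<close> by its conjugate makes the component along \<open>e'\<close>
    exactly \<open>e'\<close>.\<close>
  define k where "k z = cinner (\<Phi> (e + z)) e'" for z
  have k1: "cmod (k z) = 1" if "z \<in> ?Z" for z
    using that pres[of "e + z" e] by (simp add: k_def e'_def cinner.add_left ee)
  have kk: "cnj (k z) * k z = 1" if "z \<in> ?Z" for z
    using k1[OF that] by (metis complex_norm_square mult.commute of_real_1 power_one)
  define V where "V z = cnj (k z) *\<^sub>C \<Phi> (e + z) - e'" for z
  have Ve': "cinner (V z) e' = 0" if "z \<in> ?Z" for z
    using kk[OF that] by (simp add: V_def cinner.diff_left cinner_scaleC_left ee k_def)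
  then have e'V: "cinner e' (V z) = 0" if "z \<in> ?Z" for z
    using that cinner_eq_zero_commute[of e' "V z"] by simp
  have e'V_eq: "e' + V z = cnj (k z) *\<^sub>C \<Phi> (e + z)" for z by (simp add: V_def)
  have mod1: "cmod (1 + cinner (V z) (V w)) = cmod (1 + cinner z w)" if z: "z \<in> ?Z" and w: "w \<in> ?Z" for z w
  proof -
    have "1 + cinner (V z) (V w) = cinner (e' + V z) (e' + V w)"
      by (simp add: cinner.add_left cinner.add_right ee Ve'[OF z] e'V[OF w])
    also have "cmod \<dots> = cmod (cinner (e + z) (e + w))"
      unfolding e'V_eq by (simp add: cinner_scaleC_left cinner_scaleC_right norm_mult k1[OF z] k1[OF w] pres)
    also have "cinner (e + z) (e + w) = 1 + cinner z w"
      using z ez[OF w] by (simp add: cinner.add_left cinner.add_right ee)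
    finally show ?thesis .
  qed
  have normV: "norm (V z) = norm z" if z: "z \<in> ?Z" for z
  proof -
    have "cmod (complex_of_real (1 + (norm (V z))\<^sup>2)) = cmod (complex_of_real (1 + (norm z)\<^sup>2))"
      using mod1[OF z z] unfolding cinner_self by simp
    then have "(norm (V z))\<^sup>2 = (norm z)\<^sup>2" unfolding norm_of_real by simp
    then show ?thesis by (rule power2_eq_imp_eq) auto
  qed
  \<comment> \<open>\<open>V z\<close> was read off from \<open>\<Phi> (e + z)\<close>. As
    \<open>cinner z (e + z)\<close> has modulus \<open>(norm z)^2\<close>, equality in
    Cauchy-Schwarz puts \<open>\<Phi> z\<close> on the same line.\<close>
  have par: "\<exists>c. cmod c = 1 \<and> \<Phi> z = c *\<^sub>C V z" if z: "z \<in> ?Z" for z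
  proof (cases "z = 0")
    case True
    then have "\<Phi> z = 0" "V z = 0" using norm\<Phi>[of z] normV[OF z] by auto
    then show ?thesis by (intro exI[of _ 1]) simp
  next
    case z0: False
    have 0: "cinner (\<Phi> z) e' = 0" using pres[of z e] z by (simp add: e'_def)
    have "cmod (cinner (\<Phi> z) (e' + V z)) = cmod (cinner z (e + z))"
      unfolding e'V_eq by (simp add: cinner_scaleC_right norm_mult k1[OF z] pres)
    then have "cmod (cinner (\<Phi> z) (V z)) = (norm z)\<^sup>2"
      using z 0 by (simp add: cinner.add_right cinner_self norm_power)
    then have "cmod (cinner (\<Phi> z) (V z)) = norm (\<Phi> z) * norm (V z)"
      by (simp add: norm\<Phi> normV[OF z] power2_eq_square)
    moreover have "V z \<noteq> 0" using z0 normV[OF z] by auto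
    ultimately obtain c where c: "\<Phi> z = c *\<^sub>C V z" by (rule cauchy_schwarz_equality_parallel)
    then have "norm z = cmod c * norm z" using norm\<Phi>[of z] normV[OF z] by (simp add: norm_scaleC)
    then have "cmod c = 1" using z0 by simp
    then show ?thesis using c by blast
  qed
  have mod: "cmod (cinner (V z) (V w)) = cmod (cinner z w)" if z: "z \<in> ?Z" and w: "w \<in> ?Z" for z w
  proof -
    obtain a b where "cmod a = 1" "\<Phi> z = a *\<^sub>C V z" "cmod b = 1" "\<Phi> w = b *\<^sub>C V w"
      using par[OF z] par[OF w] by blast
    then show ?thesis using pres[of z w]
      by (simp add: cinner_scaleC_left cinner_scaleC_right norm_mult)
  qed
  have innerV: "inner (V z) (V w) = inner z w" if "z \<in> ?Z" "w \<in> ?Z" for z w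
    unfolding inner_eq_Re_cinner by (rule Re_eq_of_cmod_eq[OF mod1[OF that] mod[OF that]])
  \<comment> \<open>The squared norm of the defect expands into inner products, all of which
    \<open>V\<close> preserves.\<close>
  have Vadd: "V (z + w) = V z + V w" if z: "z \<in> ?Z" and w: "w \<in> ?Z" for z w
  proof -
    note zw = Zadd[OF z w]
    have "(norm (V (z + w) - (V z + V w)))\<^sup>2 = (norm ((z + w) - (z + w)))\<^sup>2"
      unfolding power2_norm_eq_inner
      by (simp only: inner_diff_left inner_diff_right inner_add_left[of "V _"] inner_add_right[of _ "V _"]
          innerV[OF zw zw] innerV[OF zw z] innerV[OF zw w] innerV[OF z zw] innerV[OF w zw]
          innerV[OF z z] innerV[OF z w] innerV[OF w z] innerV[OF w w])
         (simp add: inner_simps inner_commute)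
    then show ?thesis by simp
  qed
  have Vscale: "V (r *\<^sub>R z) = r *\<^sub>R V z" if z: "z \<in> ?Z" for r z
  proof -
    note rz = ZscaleR[OF z z, of r]
    have "(norm (V (r *\<^sub>R z) - r *\<^sub>R V z))\<^sup>2 = 0"
      unfolding power2_norm_eq_inner using rz z
      by (simp add: inner_diff_left inner_diff_right innerV)
    then show ?thesis by simp
  qed
  have Vi: "V (\<i> *\<^sub>C z) = \<i> *\<^sub>C V z \<or> V (\<i> *\<^sub>C z) = - (\<i> *\<^sub>C V z)" if z: "z \<in> ?Z" for z
  proof -
    note iz = Zscale[OF z z, of \<i>]
    \<comment> \<open>Real part \<open>0\<close> and modulus \<open>(norm z)^2\<close> leave two
      values for \<open>q\<close>; each makes \<open>V (\<i> *\<^sub>C z)\<close> equal to one of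
      the two candidates.\<close>
    define q where "q = cinner (V (\<i> *\<^sub>C z)) (V z)"
    have "Re q = 0"
      using innerV[OF iz z] by (simp add: q_def inner_eq_Re_cinner cinner_scaleC_left cinner_self)
    moreover have "cmod q = (norm z)\<^sup>2"
      using mod[OF iz z] by (simp add: q_def cinner_scaleC_left norm_mult cinner_self norm_power)
    ultimately have q: "Im q = (norm z)\<^sup>2 \<or> Im q = - (norm z)\<^sup>2" by (auto simp: cmod_eq_Im)
    have nn: "norm (V (\<i> *\<^sub>C z)) = norm z" "norm (\<i> *\<^sub>C V z) = norm z"
      using normV[OF iz] normV[OF z] by (simp_all add: norm_scaleC)
    have i: "inner (V (\<i> *\<^sub>C z)) (\<i> *\<^sub>C V z) = Im q"
      by (simp add: inner_eq_Re_cinner cinner_scaleC_right q_def)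
    have nd: "(norm (a - b))\<^sup>2 = (norm a)\<^sup>2 + (norm b)\<^sup>2 - 2 * inner a b"
      and ns: "(norm (a + b))\<^sup>2 = (norm a)\<^sup>2 + (norm b)\<^sup>2 + 2 * inner a b" for a b :: 'k
      by (simp_all add: power2_norm_eq_inner inner_simps inner_commute)
    have "(norm (V (\<i> *\<^sub>C z) - \<i> *\<^sub>C V z))\<^sup>2 = 2 * (norm z)\<^sup>2 - 2 * Im q"
      unfolding nd by (simp add: nn i)
    moreover have "(norm (V (\<i> *\<^sub>C z) + \<i> *\<^sub>C V z))\<^sup>2 = 2 * (norm z)\<^sup>2 + 2 * Im q"
      unfolding ns by (simp add: nn i)
    ultimately have "V (\<i> *\<^sub>C z) - \<i> *\<^sub>C V z = 0 \<or> V (\<i> *\<^sub>C z) + \<i> *\<^sub>C V z = 0"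
      using q by (elim disjE) simp_all
    then show ?thesis by (simp only: eq_neg_iff_add_eq_0 right_minus_eq)
  qed
  \<comment> \<open>If \<open>z\<close> and \<open>w\<close> had opposite signs, additivity at
    \<open>z + w\<close>, whose sign is one of the two, would force one of them to satisfy both
    equations.\<close>
  have "(\<forall>z\<in>?Z. V (\<i> *\<^sub>C z) = \<i> *\<^sub>C V z) \<or> (\<forall>z\<in>?Z. V (\<i> *\<^sub>C z) = - (\<i> *\<^sub>C V z))"
  proof (rule ccontr)
    assume "\<not> ?thesis"
    then obtain z w where z: "z \<in> ?Z" "V (\<i> *\<^sub>C z) \<noteq> \<i> *\<^sub>C V z" and w: "w \<in> ?Z" "V (\<i> *\<^sub>C w) \<noteq> - (\<i> *\<^sub>C V w)"
      by blast
    have zi: "V (\<i> *\<^sub>C z) = - (\<i> *\<^sub>C V z)" and wi: "V (\<i> *\<^sub>C w) = \<i> *\<^sub>C V w"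
      using Vi[OF z(1)] z(2) Vi[OF w(1)] w(2) by auto
    have "V (\<i> *\<^sub>C (z + w)) = - (\<i> *\<^sub>C V z) + \<i> *\<^sub>C V w"
      using Vadd[OF Zscale[OF z(1) z(1)] Zscale[OF w(1) w(1)]] by (simp add: scaleC_add_right zi wi)
    moreover have "V (\<i> *\<^sub>C (z + w)) = \<i> *\<^sub>C (V z + V w) \<or> V (\<i> *\<^sub>C (z + w)) = - (\<i> *\<^sub>C (V z + V w))"
      using Vi[OF Zadd[OF z(1) w(1)]] by (simp only: Vadd[OF z(1) w(1)])
    ultimately have "- (\<i> *\<^sub>C V z) = \<i> *\<^sub>C V z \<or> \<i> *\<^sub>C V w = - (\<i> *\<^sub>C V w)"
      by (auto simp: scaleC_add_right)
    then show False using zi wi z(2) w(2) by auto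
  qed
  then obtain \<sigma> :: "complex \<Rightarrow> complex" where \<sigma>: "\<sigma> = (\<lambda>c. c) \<or> \<sigma> = cnj"
    and V\<sigma>: "\<And>z. z \<in> ?Z \<Longrightarrow> V (\<i> *\<^sub>C z) = \<sigma> \<i> *\<^sub>C V z"
  proof
    assume "\<forall>z\<in>?Z. V (\<i> *\<^sub>C z) = \<i> *\<^sub>C V z"
    then show ?thesis using that[of "\<lambda>c. c"] by blast
  next
    assume "\<forall>z\<in>?Z. V (\<i> *\<^sub>C z) = - (\<i> *\<^sub>C V z)"
    then show ?thesis using that[of cnj] by (simp add: scaleC.minus_left)
  qed
  have \<sigma>_add: "\<sigma> (a + b) = \<sigma> a + \<sigma> b" and \<sigma>_mult: "\<sigma> (a * b) = \<sigma> a * \<sigma> b"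
    and \<sigma>_cnj: "\<sigma> (cnj a) = cnj (\<sigma> a)" and \<sigma>_real: "\<sigma> (complex_of_real r) = complex_of_real r"
    and \<sigma>_\<sigma>: "\<sigma> (\<sigma> a) = a" and \<sigma>_mod: "cmod (\<sigma> a) = cmod a" and \<sigma>_0: "\<sigma> a = 0 \<longleftrightarrow> a = 0"
    and \<sigma>_inv: "\<sigma> (inverse a) = inverse (\<sigma> a)"
    for a b r using \<sigma> by auto
  have VscaleC: "V (c *\<^sub>C z) = \<sigma> c *\<^sub>C V z" if z: "z \<in> ?Z" for c z
  proof -
    have iz: "\<i> *\<^sub>C z \<in> ?Z" by (rule Zscale[OF z z])
    have c: "complex_of_real (Re c) + complex_of_real (Im c) * \<i> = c"
      by (simp add: complex_eq_iff)
    have "c *\<^sub>C z = Re c *\<^sub>R z + Im c *\<^sub>R (\<i> *\<^sub>C z)"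
      unfolding scaleR_scaleC[of _ z] scaleR_scaleC[of _ "\<i> *\<^sub>C z"] scaleC_scaleC scaleC_add_left[symmetric] c ..
    then have "V (c *\<^sub>C z) = Re c *\<^sub>R V z + Im c *\<^sub>R (\<sigma> \<i> *\<^sub>C V z)"
      using Vadd[OF ZscaleR[OF z z] ZscaleR[OF iz iz]] by (simp only: Vscale[OF z] Vscale[OF iz] V\<sigma>[OF z])
    also have "\<dots> = \<sigma> (complex_of_real (Re c) + complex_of_real (Im c) * \<i>) *\<^sub>C V z"
      unfolding scaleR_scaleC[of _ "V z"] scaleR_scaleC[of _ "\<sigma> \<i> *\<^sub>C V z"]
      by (simp add: \<sigma>_add \<sigma>_mult \<sigma>_real scaleC_add_left scaleC_scaleC)
    finally show ?thesis by (simp only: c)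
  qed
  have cinnerV: "cinner (V z) (V w) = \<sigma> (cinner z w)" if z: "z \<in> ?Z" and w: "w \<in> ?Z" for z w
  proof -
    have "inner (V z) (\<sigma> \<i> *\<^sub>C V w) = inner z (\<i> *\<^sub>C w)"
      using innerV[OF z Zscale[OF w w, of \<i>]] by (simp only: V\<sigma>[OF w])
    then show ?thesis using innerV[OF z w] \<sigma>
      by (auto simp: inner_eq_Re_cinner cinner_scaleC_right complex_eq_iff cinner.minus_right scaleC.minus_left)
  qed
  define U where "U u = \<sigma> (cinner u e) *\<^sub>C e' + V (u - cinner u e *\<^sub>C e)" for u
  have Z: "u - cinner u e *\<^sub>C e \<in> ?Z" for u by (simp add: cinner.diff_left cinner_scaleC_left ee)
  have Uadd: "U (u + v) = U u + U v" for u v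
  proof -
    have eq: "u + v - cinner (u + v) e *\<^sub>C e = (u - cinner u e *\<^sub>C e) + (v - cinner v e *\<^sub>C e)"
      by (simp add: cinner.add_left scaleC_add_left)
    show ?thesis
      unfolding U_def eq Vadd[OF Z Z] by (simp add: cinner.add_left \<sigma>_add scaleC_add_left)
  qed
  have Uscale: "U (c *\<^sub>C u) = \<sigma> c *\<^sub>C U u" for c u
  proof -
    have eq: "c *\<^sub>C u - cinner (c *\<^sub>C u) e *\<^sub>C e = c *\<^sub>C (u - cinner u e *\<^sub>C e)"
      by (simp add: cinner_scaleC_left scaleC.diff_right scaleC_scaleC)
    show ?thesis
      unfolding U_def eq VscaleC[OF Z]
      by (simp add: cinner_scaleC_left \<sigma>_mult scaleC_add_right scaleC_scaleC)
  qed
  have Ucinner: "cinner (U u) (U v) = \<sigma> (cinner u v)" for u v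
  proof -
    define z w where "z = u - cinner u e *\<^sub>C e" and "w = v - cinner v e *\<^sub>C e"
    have zw: "z \<in> ?Z" "w \<in> ?Z" unfolding z_def w_def by (rule Z)+
    have "cinner (cinner u e *\<^sub>C e + z) (cinner v e *\<^sub>C e + w) = cinner u e * cnj (cinner v e) + cinner z w"
      using zw ez[OF zw(2)]
      by (simp add: cinner.add_left cinner.add_right cinner_scaleC_left cinner_scaleC_right ee)
    then have "cinner u v = cinner u e * cnj (cinner v e) + cinner z w" by (simp add: z_def w_def)
    moreover have "cinner (U u) (U v) = \<sigma> (cinner u e) * cnj (\<sigma> (cinner v e)) + cinner (V z) (V w)"
      unfolding U_def z_def[symmetric] w_def[symmetric]
      by (simp add: cinner.add_left cinner.add_right cinner_scaleC_left cinner_scaleC_right ee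
          Ve'[OF zw(1)] e'V[OF zw(2)])
    ultimately show ?thesis by (simp add: cinnerV[OF zw] \<sigma>_add \<sigma>_mult \<sigma>_cnj)
  qed
  \<comment> \<open>\<open>\<Phi>\<close> is not known to be homogeneous. A vector \<open>u\<close>
    outside \<open>?Z\<close> is a multiple of some \<open>e + z\<close>, and equality in
    Cauchy-Schwarz makes the images of the two parallel.\<close>
  have U\<Phi>: "\<exists>c. \<Phi> u = c *\<^sub>C U u" for u
  proof (cases "cinner u e = 0")
    case True
    then have "U u = V u" using \<sigma>_0[of 0] by (simp add: U_def scaleC.zero_left)
    then show ?thesis using par[of u] True by auto
  next
    case False
    define a where "a = cinner u e"
    define z where "z = inverse a *\<^sub>C (u - a *\<^sub>C e)"
    have zZ: "z \<in> ?Z" unfolding z_def a_def using Zscale[OF Z Z] .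
    have a0: "a \<noteq> 0" using False by (simp add: a_def)
    have u: "u = a *\<^sub>C (e + z)"
      using a0 by (simp add: z_def scaleC_add_right scaleC_scaleC)
    have az: "u - cinner u e *\<^sub>C e = a *\<^sub>C z" using a0 by (simp add: z_def scaleC_scaleC a_def)
    have "U u = \<sigma> a *\<^sub>C (e' + V z)"
      unfolding U_def az VscaleC[OF zZ] by (simp add: scaleC_add_right a_def)
    moreover define d where "d = \<sigma> a * cnj (k z)"
    ultimately have Uu: "U u = d *\<^sub>C \<Phi> (e + z)" by (simp add: e'V_eq scaleC_scaleC)
    have nz: "d \<noteq> 0" using a0 k1[OF zZ] \<sigma>_0[of a] by (auto simp: d_def)
    have "cmod (cinner (\<Phi> u) (\<Phi> (e + z))) = norm (\<Phi> u) * norm (\<Phi> (e + z))"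
      unfolding pres norm\<Phi>
      by (simp add: u cinner_scaleC_left norm_mult cinner_self norm_scaleC norm_power power2_eq_square)
    moreover have "\<Phi> (e + z) \<noteq> 0"
    proof
      assume "\<Phi> (e + z) = 0"
      then have "e + z = 0" using norm\<Phi>[of "e + z"] by simp
      then have "cinner (e + z) e = 0" by (simp add: cinner.zero_left)
      then show False using zZ by (simp add: cinner.add_left ee)
    qed
    ultimately obtain c where c: "\<Phi> u = c *\<^sub>C \<Phi> (e + z)" by (rule cauchy_schwarz_equality_parallel)
    have "\<Phi> u = (c * inverse d) *\<^sub>C U u" using nz by (simp add: c Uu scaleC_scaleC)
    then show ?thesis by blast
  qed
  have "surj U"
  proof (rule surjI)
    fix w
    obtain u c where "w = c *\<^sub>C \<Phi> u" using onto by blast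
    moreover obtain d where "\<Phi> u = d *\<^sub>C U u" using U\<Phi> by blast
    ultimately have "w = U (\<sigma> (c * d) *\<^sub>C u)" by (simp add: Uscale \<sigma>_\<sigma> scaleC_scaleC)
    then show "U (SOME v. U v = w) = w" by (metis (mono_tags, lifting) someI)
  qed
  then have "semi_unitary U \<sigma>"
    by unfold_locales (use \<sigma> Uadd Uscale Ucinner in blast)+
  then show ?thesis using U\<Phi> by (rule that)
qed

text \<open>The argument above evaluates the map at \<open>e + z\<close>, which is not a unit vector
  in general; hence the positively homogeneous extension.\<close>

lemma wigner_unit_vectors:
  fixes \<phi> :: "'h::complex_hilbert \<Rightarrow> 'k::complex_hilbert"
  assumes norm: "\<And>u. norm u = 1 \<Longrightarrow> norm (\<phi> u) = 1"
    and pres: "\<And>u v. norm u = 1 \<Longrightarrow> norm v = 1 \<Longrightarrow> cmod (cinner (\<phi> u) (\<phi> v)) = cmod (cinner u v)"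
    and onto: "\<And>w. norm w = 1 \<Longrightarrow> \<exists>u c. norm u = 1 \<and> w = c *\<^sub>C \<phi> u"
  obtains U \<sigma> where "semi_unitary U \<sigma>" "\<And>u. norm u = 1 \<Longrightarrow> \<exists>c. \<phi> u = c *\<^sub>C U u"
proof -
  define \<Phi> where "\<Phi> u = norm u *\<^sub>R \<phi> (u /\<^sub>R norm u)" for u
  have pres\<Phi>: "cmod (cinner (\<Phi> u) (\<Phi> v)) = cmod (cinner u v)" for u v
  proof (cases "u = 0 \<or> v = 0")
    case False
    then have "cmod (cinner (\<phi> (u /\<^sub>R norm u)) (\<phi> (v /\<^sub>R norm v))) = cmod (cinner (u /\<^sub>R norm u) (v /\<^sub>R norm v))"
      by (intro pres) auto
    then show ?thesis using False
      by (simp add: \<Phi>_def cinner.scaleR_left cinner.scaleR_right field_simps)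
  qed (auto simp: \<Phi>_def cinner.zero_left cinner.zero_right)
  have onto\<Phi>: "\<exists>u c. w = c *\<^sub>C \<Phi> u" for w
  proof (cases "w = 0")
    case True
    then show ?thesis by (intro exI[of _ 0]) (simp add: scaleC.zero_left)
  next
    case False
    then obtain u c where u: "norm u = 1" "w /\<^sub>R norm w = c *\<^sub>C \<phi> u" using onto[of "w /\<^sub>R norm w"] by auto
    have "w = norm w *\<^sub>R (w /\<^sub>R norm w)" using False by simp
    also have "\<dots> = (complex_of_real (norm w) * c) *\<^sub>C \<Phi> u"
      unfolding u(2) using u(1) by (subst scaleR_scaleC) (simp add: \<Phi>_def scaleC_scaleC)
    finally show ?thesis by blast
  qed
  obtain U \<sigma> where U: "semi_unitary U \<sigma>" and *: "\<And>u. \<exists>c. \<Phi> u = c *\<^sub>C U u"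
    using wigner_vectors[of \<Phi>, OF pres\<Phi> onto\<Phi>] by blast
  have "\<exists>c. \<phi> u = c *\<^sub>C U u" if "norm u = 1" for u using *[of u] that by (simp add: \<Phi>_def)
  with U show ?thesis by (rule that)
qed

section \<open>Conjugation by unitary and antiunitary maps\<close>

context semi_unitary
begin

lemma sigma_simps:
  "\<sigma> (\<sigma> c) = c" "Re (\<sigma> c) = Re c" "cmod (\<sigma> c) = cmod c" "\<sigma> (complex_of_real r) = complex_of_real r"
  "\<sigma> (cnj c) = cnj (\<sigma> c)"
  using sigma by auto

lemma scaleR: "U (r *\<^sub>R u) = r *\<^sub>R U u"
  by (simp add: scaleR_scaleC[of r u] scaleR_scaleC[of r "U u"] scale sigma_simps)

lemma zero: "U 0 = 0"
  using add[of 0 0] by simp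

lemma inner_image: "inner (U u) (U v) = inner u v"
  by (simp add: inner_eq_Re_cinner cinner_image sigma_simps)

lemma norm_image: "norm (U u) = norm u"
  by (simp add: norm_eq_sqrt_inner inner_image)

lemma bounded_linear: "bounded_linear U"
  by (rule bounded_linear_intro[of _ 1]) (simp_all add: add scaleR norm_image)

lemma diff: "U (u - v) = U u - U v"
  using add[of "u - v" v] by (simp add: algebra_simps)

lemma eq_iff: "U u = U v \<longleftrightarrow> u = v"
  using norm_image[of "u - v"] by (auto simp: diff)

lemma inj: "inj U"
  by (simp add: inj_def eq_iff)

lemma inv_left: "inv U (U u) = u"
  using inj by simp

lemma inv_right: "U (inv U w) = w"
  using surj by (simp add: surj_f_inv_f)

lemma inv_eq: "inv U w = u \<longleftrightarrow> w = U u"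
  using inv_left inv_right by metis

lemma inv_inv: "inv (inv U) = U"
  using inj surj by (simp add: inv_inv_eq bij_def)

lemma semi_unitary_inv: "semi_unitary (inv U) \<sigma>"
proof
  show "\<sigma> = (\<lambda>c. c) \<or> \<sigma> = cnj" by (rule sigma)
  show "inv U (u + v) = inv U u + inv U v" for u v by (simp add: inv_eq add inv_right)
  show "inv U (c *\<^sub>C u) = \<sigma> c *\<^sub>C inv U u" for c u by (simp add: inv_eq scale inv_right sigma_simps)
  show "cinner (inv U u) (inv U v) = \<sigma> (cinner u v)" for u v
    using cinner_image[of "inv U u" "inv U v"] by (simp add: inv_right sigma_simps)
  show "surj (inv U)" by (rule surjI[of _ U]) (rule inv_left)
qed

text \<open>For antiunitary \<open>U\<close> the values remain complex-linear, since
  \<open>\<sigma>\<close> enters twice, but the dependence on \<open>x\<close> is conjugate-linear.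
  This is why the extension can only be real-linear.\<close>

definition conjugate :: "('h \<Rightarrow>\<^sub>L 'h) \<Rightarrow> ('k \<Rightarrow>\<^sub>L 'k)"
  where "conjugate x = Blinfun (\<lambda>v. U (x (inv U v)))"

lemma conjugate_apply: "blinfun_apply (conjugate x) v = U (blinfun_apply x (inv U v))"
  unfolding conjugate_def
  by (rule bounded_linear_Blinfun_apply[THEN fun_cong])
     (rule bounded_linear_compose[OF bounded_linear
        bounded_linear_compose[OF blinfun.bounded_linear_right semi_unitary.bounded_linear[OF semi_unitary_inv]]])

lemma conjugate_image: "blinfun_apply (conjugate x) (U u) = U (blinfun_apply x u)"
  by (simp add: conjugate_apply inv_left)

lemma conjugate_diff: "conjugate (x - y) = conjugate x - conjugate y"
  by (rule blinfun_eqI) (simp add: conjugate_apply blinfun.diff_left diff)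

lemma conjugate_add: "conjugate (x + y) = conjugate x + conjugate y"
  by (rule blinfun_eqI) (simp add: conjugate_apply blinfun.add_left add)

lemma conjugate_scaleR: "conjugate (r *\<^sub>R x) = r *\<^sub>R conjugate x"
  by (rule blinfun_eqI) (simp add: conjugate_apply blinfun.scaleR_left scaleR)

lemma conjugate_inverse: "semi_unitary.conjugate (inv U) (conjugate x) = x"
  by (rule blinfun_eqI)
     (simp add: semi_unitary.conjugate_apply[OF semi_unitary_inv] inv_inv conjugate_image inv_left)

lemma conjugate_of_inverse: "conjugate (semi_unitary.conjugate (inv U) y) = y"
  by (rule blinfun_eqI)
     (simp add: conjugate_apply semi_unitary.conjugate_apply[OF semi_unitary_inv] inv_inv inv_right)

section \<open>Invariance of compactness, singular values and positivity under conjugation\<close>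

lemma conjugate_complex_linear: "complex_linear x \<Longrightarrow> complex_linear (conjugate x)"
  by (simp add: complex_linear_def conjugate_apply semi_unitary.scale[OF semi_unitary_inv] scale sigma_simps)

lemma conjugate_compact:
  assumes "compact_operator x" shows "compact_operator (conjugate x)"
proof -
  let ?K = "U ` closure (x ` cball 0 1)"
  have K: "compact ?K"
    using assms by (intro compact_continuous_image linear_continuous_on[OF bounded_linear])
      (simp add: compact_operator_def)
  have "conjugate x ` cball 0 1 \<subseteq> ?K"
  proof
    fix w assume "w \<in> conjugate x ` cball 0 1"
    then obtain v where v: "norm v \<le> 1" "w = U (x (inv U v))" by (auto simp: conjugate_apply)
    have "inv U v \<in> cball 0 1" using v(1) semi_unitary.norm_image[OF semi_unitary_inv] by simp
    then have "x (inv U v) \<in> closure (x ` cball 0 1)"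
      by (intro subsetD[OF closure_subset] imageI)
    then show "w \<in> ?K" unfolding v(2) by (rule imageI)
  qed
  then have "compact (closure (conjugate x ` cball 0 1))" by (rule compact_closure_subset[OF K])
  then show ?thesis using assms conjugate_complex_linear by (simp add: compact_operator_def)
qed

lemma cinner_conjugate:
  "cinner (blinfun_apply (conjugate x) u) v = \<sigma> (cinner (blinfun_apply x (inv U u)) (inv U v))"
  by (simp add: cinner_image[symmetric] conjugate_apply inv_right)

lemma conjugate_adjoint:
  assumes "complex_linear x"
  shows "adjoint_operator (conjugate x) = conjugate (adjoint_operator x)"
proof (rule adjoint_operator_eqI)
  fix u v
  have "cinner (conjugate x u) v = \<sigma> (cinner (inv U u) (adjoint_operator x (inv U v)))"
    by (simp add: cinner_conjugate cinner_adjoint[OF assms])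
  also have "\<dots> = cinner u (conjugate (adjoint_operator x) v)"
    by (simp add: cinner_image[symmetric] conjugate_apply inv_right)
  finally show "cinner (conjugate x u) v = cinner u (conjugate (adjoint_operator x) v)" .
qed

text \<open>The eigenvalue \<open>s^2\<close> is real, so \<open>\<sigma>\<close> fixes it even if
  \<open>U\<close> is antiunitary.\<close>

lemma singular_space_conjugate:
  assumes "complex_linear x"
  shows "singular_space (conjugate x) s = U ` singular_space x s"
proof -
  have *: "U u \<in> singular_space (conjugate x) s \<longleftrightarrow> u \<in> singular_space x s" for u
  proof -
    have "complex_of_real (s\<^sup>2) *\<^sub>C U u = U (complex_of_real (s\<^sup>2) *\<^sub>C u)"
      by (simp only: scale sigma_simps)
    then show ?thesis
      by (simp only: singular_space_def mem_Collect_eq conjugate_adjoint[OF assms] blinfun_apply_blinfun_compose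
          conjugate_image eq_iff)
  qed
  show ?thesis
  proof
    show "singular_space (conjugate x) s \<subseteq> U ` singular_space x s"
      using * inv_right by (metis image_eqI subsetI)
  qed (use * in auto)
qed

lemma span_image: "complex_vector.span (U ` B) = U ` complex_vector.span B"
proof -
  \<comment> \<open>Stated for arbitrary \<open>T\<close>, because it is applied to \<open>U\<close>
    and to \<open>inv U\<close>, whose spaces are interchanged.\<close>
  have le: "T ` complex_vector.span A \<subseteq> complex_vector.span (T ` A)"
    if "semi_unitary T \<tau>" for T :: "'c::complex_hilbert \<Rightarrow> 'd::complex_hilbert" and \<tau> A
  proof
    interpret T: semi_unitary T \<tau> by (rule that)
    fix w assume "w \<in> T ` complex_vector.span A"
    then obtain u where u: "u \<in> complex_vector.span A" and w: "w = T u" by blast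
    from u have "T u \<in> complex_vector.span (T ` A)"
    proof (induction rule: complex_vector.span_induct_alt)
      case base
      then show ?case by (simp add: T.zero complex_vector.span_zero)
    next
      case (step c a v)
      then show ?case
        by (simp add: T.add T.scale complex_vector.span_add complex_vector.span_scale complex_vector.span_base)
    qed
    then show "w \<in> complex_vector.span (T ` A)" by (simp add: w)
  qed
  have "complex_vector.span (U ` B) \<subseteq> U ` complex_vector.span B"
  proof
    fix w assume w: "w \<in> complex_vector.span (U ` B)"
    then have "inv U w \<in> complex_vector.span (inv U ` U ` B)"
      using le[OF semi_unitary_inv] by blast
    then have "inv U w \<in> complex_vector.span B" by (simp add: image_image inv_left)
    then show "w \<in> U ` complex_vector.span B" by (rule image_eqI[rotated]) (simp add: inv_right)
  qed
  then show ?thesis using le[OF semi_unitary_axioms] by blast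
qed

lemma dim_image: "cdim (U ` S) = cdim S"
proof -
  obtain B where B: "B \<subseteq> S" "complex_vector.independent B" "S \<subseteq> complex_vector.span B" "card B = cdim S"
    by (rule complex_vector.basis_exists)
  have "complex_vector.independent (U ` B)"
    unfolding complex_vector.dependent_def
  proof (rule notI, elim bexE)
    fix w assume "w \<in> U ` B" and w: "w \<in> complex_vector.span (U ` B - {w})"
    then obtain b where b: "b \<in> B" "w = U b" by blast
    have "U ` B - {w} = U ` (B - {b})" using inj b by (auto simp: eq_iff)
    then have "b \<in> complex_vector.span (B - {b})" using w b(2) by (auto simp: span_image eq_iff)
    then show False using B(2) b(1) by (auto simp: complex_vector.dependent_def)
  qed
  moreover have "U ` B \<subseteq> U ` S" "U ` S \<subseteq> complex_vector.span (U ` B)"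
    using B by (auto simp: span_image)
  ultimately have "card (U ` B) = cdim (U ` S)" by (intro complex_vector.basis_card_eq_dim)
  then show ?thesis using B(4) card_image[OF inj_on_subset[OF inj]] by simp
qed

lemma conjugate_singular:
  assumes "complex_linear x"
  shows "singular_values (conjugate x) = singular_values x" "singular_mult (conjugate x) = singular_mult x"
proof -
  have "U u \<noteq> 0 \<longleftrightarrow> u \<noteq> 0" for u using eq_iff[of u 0] by (simp add: zero)
  then show "singular_values (conjugate x) = singular_values x"
    by (simp add: singular_values_def singular_space_conjugate[OF assms])
  show "singular_mult (conjugate x) = singular_mult x"
    by (rule ext) (simp add: singular_mult_def singular_space_conjugate[OF assms] dim_image)
qed

lemma conjugate_schatten_norm: "complex_linear x \<Longrightarrow> schatten_norm p (conjugate x) = schatten_norm p x"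
  by (simp add: schatten_norm_def conjugate_singular)

lemma conjugate_schatten_class:
  assumes "x \<in> schatten_class p" shows "conjugate x \<in> schatten_class p"
  using assms
  by (simp add: schatten_class_def conjugate_compact) (simp add: compact_operator_def conjugate_singular)

lemma conjugate_positive:
  assumes "positive_operator x" shows "positive_operator (conjugate x)"
  using assms unfolding positive_operator_def
  by (simp add: conjugate_complex_linear cinner_conjugate sigma_simps)
     (metis Reals_cases Reals_of_real sigma_simps(4))

lemma conjugate_pos_sphere:
  assumes "x \<in> schatten_pos_sphere p" shows "conjugate x \<in> schatten_pos_sphere p"
proof -
  have "complex_linear x" using assms by (simp add: schatten_pos_sphere_def positive_operator_def)
  then show ?thesis using assms
    by (simp add: schatten_pos_sphere_def conjugate_schatten_class conjugate_positive conjugate_schatten_norm)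
qed

lemma conjugate_rank_one: "conjugate (rank_one u) = rank_one (U u)"
proof (rule blinfun_eqI)
  fix v
  have "cinner (inv U v) u = \<sigma> (cinner v (U u))"
    using cinner_image[of "inv U v" u] by (simp add: inv_right sigma_simps)
  then show "conjugate (rank_one u) v = rank_one (U u) v"
    by (simp add: conjugate_apply rank_one_apply scale sigma_simps)
qed

lemma conjugate_isometry_onto_class:
  "schatten_isometry_onto p (schatten_class p) (schatten_class p) conjugate"
  unfolding schatten_isometry_onto_def
proof (intro conjI ballI)
  show "conjugate ` schatten_class p = schatten_class p"
  proof
    show "schatten_class p \<subseteq> conjugate ` schatten_class p"
      using conjugate_of_inverse semi_unitary.conjugate_schatten_class[OF semi_unitary_inv]
      by (metis image_eqI subsetI)
  qed (use conjugate_schatten_class in auto)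
  fix x y :: "'h \<Rightarrow>\<^sub>L 'h" assume "x \<in> schatten_class p" "y \<in> schatten_class p"
  then have "complex_linear (x - y)"
    using compact_operator_diff[of x y] by (simp add: schatten_class_def compact_operator_def)
  then show "schatten_norm p (conjugate x - conjugate y) = schatten_norm p (x - y)"
    by (simp add: conjugate_diff[symmetric] conjugate_schatten_norm)
qed

end

section \<open>Perturbation inequalities in finite dimension\<close>

text \<open>For \<open>1 / 2 \<le> b\<close> use \<open>exp y \<ge> 1 + y\<close> at
  \<open>y = p * ln b\<close> and \<open>ln b \<ge> 1 - 1 / b \<ge> (b - 1) - 2 * (b - 1)^2\<close>,
  whence \<open>2 * p\<close>. For smaller \<open>b\<close> one has
  \<open>4 * (b - 1)^2 \<ge> 1\<close>, so the summand \<open>4\<close> makes the left side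
  nonpositive.\<close>

lemma powr_tangent_at_1:
  fixes b p :: real
  assumes p: "0 < p"
  shows "1 + p * (b - 1) - (2 * p + 4) * (b - 1)\<^sup>2 \<le> \<bar>b\<bar> powr p"
proof (cases "1 / 2 \<le> b")
  case True
  have "ln (1 / b) \<le> 1 / b - 1" by (rule ln_le_minus_one) (use True in auto)
  then have "1 - 1 / b \<le> ln b" using True by (simp add: ln_div)
  moreover have "(b - 1) - 2 * (b - 1)\<^sup>2 \<le> 1 - 1 / b"
  proof -
    have "1 - 1 / b - ((b - 1) - 2 * (b - 1)\<^sup>2) = (b - 1)\<^sup>2 * (2 * b - 1) / b"
      using True by (simp add: field_simps power2_eq_square)
    moreover have "0 \<le> (b - 1)\<^sup>2 * (2 * b - 1) / b" using True by auto
    ultimately show ?thesis by simp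
  qed
  ultimately have "p * ((b - 1) - 2 * (b - 1)\<^sup>2) \<le> p * ln b" using p by simp
  moreover have "1 + p * ln b \<le> \<bar>b\<bar> powr p"
    using True exp_ge_add_one_self[of "p * ln b"] by (simp add: powr_def)
  moreover have "0 \<le> (b - 1)\<^sup>2" by simp
  moreover have "p * ((b - 1) - 2 * (b - 1)\<^sup>2) = p * (b - 1) - 2 * p * (b - 1)\<^sup>2"
    "(2 * p + 4) * (b - 1)\<^sup>2 = 2 * p * (b - 1)\<^sup>2 + 4 * (b - 1)\<^sup>2"
    by (simp_all add: algebra_simps)
  ultimately show ?thesis by linarith
next
  case False
  then have "(1 / 2)\<^sup>2 \<le> (1 - b)\<^sup>2" by (intro power_mono) auto
  then have "1 \<le> 4 * (b - 1)\<^sup>2" by (simp add: power2_commute[of 1 b] power_divide)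
  moreover have "p * (b - 1) \<le> 0" using p False by (simp add: mult_le_0_iff)
  moreover have "0 \<le> 2 * p * (b - 1)\<^sup>2" using p by simp
  ultimately have "1 + p * (b - 1) - (2 * p + 4) * (b - 1)\<^sup>2 \<le> 0"
    by (simp add: distrib_right)
  then show ?thesis using powr_ge_zero[of "\<bar>b\<bar>" p] by linarith
qed

text \<open>For \<open>a = 0\<close> the slope \<open>p * \<bar>a\<bar> powr p / a\<close> is \<open>0\<close> by the convention for division.\<close>

lemma powr_tangent:
  fixes a p :: real
  assumes p: "0 < p"
  shows "\<exists>C\<ge>0. \<forall>b. \<bar>a\<bar> powr p + (p * \<bar>a\<bar> powr p / a) * (b - a) - C * (b - a)\<^sup>2 \<le> \<bar>b\<bar> powr p"
proof (cases "a = 0")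
  case True
  then show ?thesis by (intro exI[of _ 0]) simp
next
  case False
  let ?C = "(2 * p + 4) * \<bar>a\<bar> powr p / a\<^sup>2"
  have "\<bar>a\<bar> powr p + (p * \<bar>a\<bar> powr p / a) * (b - a) - ?C * (b - a)\<^sup>2 \<le> \<bar>b\<bar> powr p" for b
  proof -
    have "\<bar>a\<bar> powr p * (1 + p * (b / a - 1) - (2 * p + 4) * (b / a - 1)\<^sup>2) \<le> \<bar>a\<bar> powr p * \<bar>b / a\<bar> powr p"
      by (intro mult_left_mono powr_tangent_at_1 p) simp
    also have "\<dots> = \<bar>b\<bar> powr p"
      using False by (simp add: powr_mult[symmetric] abs_divide)
    also have "\<bar>a\<bar> powr p * (1 + p * (b / a - 1) - (2 * p + 4) * (b / a - 1)\<^sup>2) =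
        \<bar>a\<bar> powr p + (p * \<bar>a\<bar> powr p / a) * (b - a) - ?C * (b - a)\<^sup>2"
      using False by (simp add: field_simps power2_eq_square)
    finally show ?thesis .
  qed
  moreover have "0 \<le> ?C" using p by simp
  ultimately show ?thesis by blast
qed

text \<open>For \<open>p < 2\<close> the constant found in \<open>powr_tangent\<close> blows up as
  \<open>a\<close> tends to \<open>0\<close>. Giving up the slope and an error
  \<open>\<epsilon>\<close> yields one constant for all \<open>a\<close>: uniform continuity covers
  \<open>\<bar>b - a\<bar> < \<delta>\<close>, and beyond that \<open>C = 1 / \<delta>^2\<close>
  makes the quadratic term at least \<open>1\<close>.\<close>

lemma powr_modulus:
  fixes p :: real
  assumes p: "0 < p" and eps: "0 < \<epsilon>"
  shows "\<exists>C\<ge>0. \<forall>a b. \<bar>a\<bar> \<le> 1 \<longrightarrow> \<bar>b\<bar> \<le> 1 \<longrightarrow> \<bar>a\<bar> powr p - \<epsilon> - C * (b - a)\<^sup>2 \<le> \<bar>b\<bar> powr p"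
proof -
  have "continuous_on {-1..1} (\<lambda>t. \<bar>t\<bar> powr p)"
    using p by (intro continuous_on_powr' continuous_intros) auto
  then have "uniformly_continuous_on {-1..1::real} (\<lambda>t. \<bar>t\<bar> powr p)"
    by (intro compact_uniformly_continuous) auto
  then obtain \<delta> where \<delta>: "0 < \<delta>"
    "\<And>a b. \<bar>a\<bar> \<le> 1 \<Longrightarrow> \<bar>b\<bar> \<le> 1 \<Longrightarrow> \<bar>b - a\<bar> < \<delta> \<Longrightarrow> \<bar>\<bar>b\<bar> powr p - \<bar>a\<bar> powr p\<bar> < \<epsilon>"
    using eps unfolding uniformly_continuous_on_def dist_real_def
    by (metis abs_le_iff atLeastAtMost_iff minus_le_iff)
  have "\<bar>a\<bar> powr p - \<epsilon> - 1 / \<delta>\<^sup>2 * (b - a)\<^sup>2 \<le> \<bar>b\<bar> powr p" if ab: "\<bar>a\<bar> \<le> 1" "\<bar>b\<bar> \<le> 1" for a b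
  proof (cases "\<bar>b - a\<bar> < \<delta>")
    case True
    have "0 \<le> 1 / \<delta>\<^sup>2 * (b - a)\<^sup>2" by simp
    then show ?thesis using \<delta>(2)[OF ab True] by linarith
  next
    case False
    then have "\<delta>\<^sup>2 \<le> (b - a)\<^sup>2" using \<delta>(1) by (metis abs_le_square_iff abs_of_pos not_le)
    then have "1 \<le> 1 / \<delta>\<^sup>2 * (b - a)\<^sup>2" using \<delta>(1) by simp
    moreover have "\<bar>a\<bar> powr p \<le> 1" using ab p powr_mono2[of p "\<bar>a\<bar>" 1] by simp
    moreover have "0 \<le> \<bar>b\<bar> powr p" by simp
    ultimately show ?thesis using eps by linarith
  qed
  then show ?thesis by (intro exI[of _ "1 / \<delta>\<^sup>2"]) simp
qed

text \<open>Unlike \<open>diagonalizes\<close>, this says nothing about \<open>A\<close> off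
  \<open>S\<close>: it is spectral data for the restriction to a finite-dimensional reducing
  subspace.\<close>

definition eigenbasis :: "('h::complex_hilbert \<Rightarrow>\<^sub>L 'h) \<Rightarrow> 'h set \<Rightarrow> 'h set \<Rightarrow> bool"
  where "eigenbasis A S E \<longleftrightarrow> finite E \<and> orthonormal E \<and> complex_vector.span E = S \<and>
    (\<forall>e\<in>E. A e = ev A e *\<^sub>R e)"

lemma eigenbasisD:
  assumes "eigenbasis A S E"
  shows "finite E" "orthonormal E" "complex_vector.span E = S" "e \<in> E \<Longrightarrow> A e = ev A e *\<^sub>R e"
    "e \<in> E \<Longrightarrow> e \<in> S" "e \<in> E \<Longrightarrow> norm e = 1"
  using assms complex_vector.span_base[of e E] by (auto simp: eigenbasis_def orthonormal_def)

lemma eigenbasis_apply: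
  assumes "self_adjoint A" "eigenbasis A S E" "v \<in> S"
  shows "blinfun_apply A v = (\<Sum>e\<in>E. (complex_of_real (ev A e) * cinner v e) *\<^sub>C e)"
proof -
  note E = eigenbasisD[OF assms(2)]
  have "A v = A (\<Sum>e\<in>E. cinner v e *\<^sub>C e)"
    using orthonormal_span_expand[OF E(2,1), of v] E(3) assms(3) by simp
  also have "\<dots> = (\<Sum>e\<in>E. (complex_of_real (ev A e) * cinner v e) *\<^sub>C e)"
    unfolding blinfun.sum_right self_adjoint_scaleC[OF assms(1)]
    by (intro sum.cong refl)
       (simp add: E(4) scaleR_scaleC[of "ev A _"] scaleC_scaleC mult.commute)
  finally show ?thesis .
qed

lemma eigenbasis_form:
  assumes "self_adjoint A" "eigenbasis A S E" "v \<in> S"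
  shows "inner (blinfun_apply A v) v = (\<Sum>e\<in>E. ev A e * (cmod (cinner v e))\<^sup>2)"
proof -
  note E = eigenbasisD[OF assms(2)]
  have "cinner (A v) v = cinner (A v) (\<Sum>e\<in>E. cinner v e *\<^sub>C e)"
    using orthonormal_span_expand[OF E(2,1), of v] E(3) assms(3) by simp
  also have "\<dots> = (\<Sum>e\<in>E. (complex_of_real (ev A e) * cinner v e) * cnj (cinner v e))"
    unfolding eigenbasis_apply[OF assms] by (rule cinner_orthonormal_sums[OF E(2,1)])
  also have "\<dots> = complex_of_real (\<Sum>e\<in>E. ev A e * (cmod (cinner v e))\<^sup>2)"
    unfolding of_real_sum by (intro sum.cong refl) (simp add: complex_norm_square[symmetric] mult.assoc)
  finally show ?thesis by (simp only: inner_eq_Re_cinner Re_complex_of_real)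
qed

text \<open>Klein's inequality: the numbers \<open>(cmod (cinner e f))\<^sup>2\<close> form a doubly stochastic matrix, so a
  bound relating \<open>g\<close> at the eigenvalues of \<open>A\<close> and of \<open>B\<close> can be summed against it.\<close>

lemma klein_inequality:
  assumes A: "self_adjoint A" "eigenbasis A S E" and B: "self_adjoint B" "eigenbasis B S F"
    and le: "\<And>e f. e \<in> E \<Longrightarrow> f \<in> F \<Longrightarrow>
      g (ev A e) + l e * (ev B f - ev A e) - \<epsilon> - C * (ev B f - ev A e)\<^sup>2 \<le> g (ev B f)"
  shows "(\<Sum>e\<in>E. g (ev A e)) + (\<Sum>e\<in>E. l e * (inner (blinfun_apply B e) e - inner (blinfun_apply A e) e)) -
    real (card E) * \<epsilon> - C * (\<Sum>e\<in>E. (norm (blinfun_apply B e - blinfun_apply A e))\<^sup>2) \<le> (\<Sum>f\<in>F. g (ev B f))"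
proof -
  note E = eigenbasisD[OF A(2)] and F = eigenbasisD[OF B(2)]
  let ?w = "\<lambda>e f. (cmod (cinner e f))\<^sup>2"
  have wF: "(\<Sum>f\<in>F. ?w e f) = 1" if "e \<in> E" for e
    using parseval[OF F(2,1), of e] E(5,6)[OF that] F(3) by simp
  have wE: "(\<Sum>e\<in>E. ?w e f) = 1" if "f \<in> F" for f
    using parseval[OF E(2,1), of f] F(5,6)[OF that] E(3) by (simp add: cmod_cinner_commute[of _ f])
  have form: "(\<Sum>f\<in>F. ?w e f * ev B f) = inner (B e) e" if "e \<in> E" for e
    using eigenbasis_form[OF B E(5)[OF that]] by (simp add: mult.commute)
  \<comment> \<open>As \<open>e\<close> is an eigenvector of \<open>A\<close>, the component of
    \<open>B e - A e\<close> along \<open>f\<close> is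
    \<open>(ev B f - ev A e) * cinner e f\<close>.\<close>
  have square: "(\<Sum>f\<in>F. ?w e f * (ev B f - ev A e)\<^sup>2) = (norm (B e - A e))\<^sup>2" if e: "e \<in> E" for e
  proof -
    have "A e = ev A e *\<^sub>R (\<Sum>f\<in>F. cinner e f *\<^sub>C f)"
      using orthonormal_span_expand[OF F(2,1), of e] E(5)[OF e] F(3) E(4)[OF e] by simp
    also have "\<dots> = (\<Sum>f\<in>F. (complex_of_real (ev A e) * cinner e f) *\<^sub>C f)"
      by (subst scaleR_scaleC) (simp add: complex_vector.scale_sum_right scaleC_scaleC)
    finally have "B e - A e = (\<Sum>f\<in>F. (complex_of_real (ev B f - ev A e) * cinner e f) *\<^sub>C f)"
      by (simp only: eigenbasis_apply[OF B E(5)[OF e]] sum_subtractf[symmetric] scaleC.diff_left[symmetric]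
          left_diff_distrib[symmetric] of_real_diff)
    then have "(norm (B e - A e))\<^sup>2 = (\<Sum>f\<in>F. (cmod (complex_of_real (ev B f - ev A e) * cinner e f))\<^sup>2)"
      by (simp only: norm_orthonormal_sum[OF F(2,1)])
    also have "\<dots> = (\<Sum>f\<in>F. ?w e f * (ev B f - ev A e)\<^sup>2)"
      unfolding norm_mult norm_of_real power_mult_distrib power2_abs by (simp only: mult.commute)
    finally show ?thesis by simp
  qed
  have "g (ev A e) + l e * (inner (B e) e - inner (A e) e) - \<epsilon> - C * (norm (B e - A e))\<^sup>2 \<le>
      (\<Sum>f\<in>F. ?w e f * g (ev B f))" if e: "e \<in> E" for e
  proof -
    have "(\<Sum>f\<in>F. ?w e f * (g (ev A e) + l e * (ev B f - ev A e) - \<epsilon> - C * (ev B f - ev A e)\<^sup>2)) \<le>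
        (\<Sum>f\<in>F. ?w e f * g (ev B f))"
      by (intro sum_mono mult_left_mono le e) auto
    also have "(\<Sum>f\<in>F. ?w e f * (g (ev A e) + l e * (ev B f - ev A e) - \<epsilon> - C * (ev B f - ev A e)\<^sup>2)) =
        (\<Sum>f\<in>F. ?w e f) * (g (ev A e) - l e * ev A e - \<epsilon>) + l e * (\<Sum>f\<in>F. ?w e f * ev B f) -
        C * (\<Sum>f\<in>F. ?w e f * (ev B f - ev A e)\<^sup>2)"
      unfolding sum_distrib_left sum_distrib_right sum.distrib[symmetric] sum_subtractf[symmetric]
      by (intro sum.cong refl) (simp add: algebra_simps)
    also have "\<dots> = g (ev A e) + l e * (inner (B e) e - inner (A e) e) - \<epsilon> - C * (norm (B e - A e))\<^sup>2"
      unfolding wF[OF e] form[OF e] square[OF e] by (simp add: ev_def algebra_simps)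
    finally show ?thesis .
  qed
  then have "(\<Sum>e\<in>E. g (ev A e) + l e * (inner (B e) e - inner (A e) e) - \<epsilon> - C * (norm (B e - A e))\<^sup>2) \<le>
      (\<Sum>e\<in>E. \<Sum>f\<in>F. ?w e f * g (ev B f))"
    by (rule sum_mono)
  also have "\<dots> = (\<Sum>f\<in>F. (\<Sum>e\<in>E. ?w e f) * g (ev B f))"
    by (subst sum.swap) (simp add: sum_distrib_right)
  also have "\<dots> = (\<Sum>f\<in>F. g (ev B f))" by (simp add: wE)
  finally show ?thesis by (simp add: sum_subtractf sum.distrib sum_distrib_left)
qed

section \<open>Finite-dimensional spans and their unit spheres\<close>

lemma finite_orthonormal_in_span:
  assumes "orthonormal M" "M \<subseteq> complex_vector.span G" "finite G"
  shows "finite M" "card M \<le> card G"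
proof -
  have *: "card N \<le> card G" if "N \<subseteq> M" "finite N" for N
    using complex_vector.independent_span_bound[OF assms(3)
        orthonormal_independent_finite[OF orthonormal_subset[OF assms(1) that(1)] that(2)]]
      that(1) assms(2) by (meson order_trans)
  show "finite M"
  proof (rule ccontr)
    assume "infinite M"
    then obtain N where "N \<subseteq> M" "finite N" "card N = Suc (card G)"
      using infinite_arbitrarily_large by blast
    then show False using *[of N] by simp
  qed
  then show "card M \<le> card G" using *[of M] by simp
qed

lemma closed_span_finite:
  assumes "orthonormal G" "finite G" shows "closed (complex_vector.span G)"
proof -
  have "complex_vector.span G = {v. v = (\<Sum>e\<in>G. cinner v e *\<^sub>C e)}"
  proof
    show "complex_vector.span G \<subseteq> {v. v = (\<Sum>e\<in>G. cinner v e *\<^sub>C e)}"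
      using orthonormal_span_expand[OF assms] by blast
    show "{v. v = (\<Sum>e\<in>G. cinner v e *\<^sub>C e)} \<subseteq> complex_vector.span G"
    proof
      fix v assume "v \<in> {v. v = (\<Sum>e\<in>G. cinner v e *\<^sub>C e)}"
      then have "v = (\<Sum>e\<in>G. cinner v e *\<^sub>C e)" by blast
      also have "\<dots> \<in> complex_vector.span G" by (rule orthonormal_sum_in_span)
      finally show "v \<in> complex_vector.span G" .
    qed
  qed
  moreover have "closed {v. v = (\<Sum>e\<in>G. cinner v e *\<^sub>C e)}"
    by (intro closed_Collect_eq continuous_intros cinner.continuous_on scaleC.continuous_on)
  ultimately show ?thesis by simp
qed

text \<open>Coefficients of unit vectors have modulus at most \<open>1\<close>, so the sphere is a
  closed part of a finite sum of compact discs.\<close>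

lemma compact_unit_sphere_span:
  assumes "orthonormal G" "finite G" shows "compact (complex_vector.span G \<inter> sphere 0 1)"
proof -
  have "\<exists>K. compact K \<and> (\<forall>c. (\<forall>e\<in>F. cmod (c e) \<le> 1) \<longrightarrow> (\<Sum>e\<in>F. c e *\<^sub>C e) \<in> K)" if "finite F" for F :: "'a set"
    using that
  proof (induction F)
    case empty
    then show ?case by (intro exI[of _ "{0}"]) auto
  next
    case (insert f F)
    then obtain K where K: "compact K" "\<And>c. (\<forall>e\<in>F. cmod (c e) \<le> 1) \<Longrightarrow> (\<Sum>e\<in>F. c e *\<^sub>C e) \<in> K" by blast
    let ?K = "{a + b |a b. a \<in> (\<lambda>c. c *\<^sub>C f) ` cball 0 1 \<and> b \<in> K}"
    have "compact ((\<lambda>c. c *\<^sub>C f) ` cball (0::complex) 1)"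
      by (intro compact_continuous_image compact_cball linear_continuous_on scaleC.bounded_linear_left)
    then have "compact ?K" by (rule compact_sums[OF _ K(1)])
    moreover have "(\<Sum>e\<in>insert f F. c e *\<^sub>C e) \<in> ?K" if "\<forall>e\<in>insert f F. cmod (c e) \<le> 1" for c
    proof -
      have "c f *\<^sub>C f \<in> (\<lambda>c. c *\<^sub>C f) ` cball 0 1" using that by (intro imageI) simp
      moreover have "(\<Sum>e\<in>F. c e *\<^sub>C e) \<in> K" using K(2) that by simp
      ultimately show ?thesis using insert.hyps by auto
    qed
    ultimately show ?case by blast
  qed
  from this[OF assms(2)] obtain K where K: "compact K"
    "\<And>c. (\<forall>e\<in>G. cmod (c e) \<le> 1) \<Longrightarrow> (\<Sum>e\<in>G. c e *\<^sub>C e) \<in> K" by blast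
  have "complex_vector.span G \<inter> sphere 0 1 \<subseteq> K"
  proof
    fix v assume v: "v \<in> complex_vector.span G \<inter> sphere 0 1"
    have "cmod (cinner v e) \<le> 1" if "e \<in> G" for e
      using cmod_cinner_le[of v e] v orthonormal_norm[OF assms(1) that] by simp
    then have "(\<Sum>e\<in>G. cinner v e *\<^sub>C e) \<in> K" using K(2)[of "cinner v"] by blast
    then show "v \<in> K" using orthonormal_span_expand[OF assms, of v] v by simp
  qed
  then have "complex_vector.span G \<inter> sphere 0 1 = K \<inter> (complex_vector.span G \<inter> sphere 0 1)" by blast
  moreover have "compact (K \<inter> (complex_vector.span G \<inter> sphere 0 1))"
    by (intro compact_Int_closed K(1) closed_Int closed_span_finite assms)
       (simp add: sphere_def closed_Collect_eq continuous_on_norm_id)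
  ultimately show ?thesis by simp
qed

section \<open>Distances to rank-one projections\<close>

text \<open>The function \<open>F u\<close> is, up to a constant, the Schatten sum of the compression of
  \<open>x - P u\<close> to the finite-dimensional reducing subspace \<open>S\<close>.\<close>

locale compressed_distance =
  fixes p :: real and x :: "'h::complex_hilbert \<Rightarrow>\<^sub>L 'h" and S G :: "'h set"
    and F :: "'h \<Rightarrow> real" and c :: real
  assumes p: "0 < p"
    and pos: "positive_operator x" and comp: "compact_operator x"
    and G: "orthonormal G" "finite G" and span_G: "complex_vector.span G = S"
    and invariant: "v \<in> S \<Longrightarrow> x v \<in> S"
    and le_1: "v \<in> S \<Longrightarrow> norm v = 1 \<Longrightarrow> inner (x v) v \<le> 1"
    and F: "u \<in> S \<Longrightarrow> norm u = 1 \<Longrightarrow> eigenbasis (x - rank_one u) S E \<Longrightarrow>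
      F u = c + (\<Sum>e\<in>E. \<bar>ev (x - rank_one u) e\<bar> powr p)"
begin

lemma sx: "self_adjoint x"
  using pos by (simp add: positive_operator_iff)

lemma self_adjoint_pert: "self_adjoint (x - rank_one u)"
  by (rule self_adjoint_diff[OF sx self_adjoint_rank_one])

lemma scaleC_S: "v \<in> S \<Longrightarrow> a *\<^sub>C v \<in> S" and add_S: "v \<in> S \<Longrightarrow> w \<in> S \<Longrightarrow> v + w \<in> S"
  and diff_S: "v \<in> S \<Longrightarrow> w \<in> S \<Longrightarrow> v - w \<in> S"
  and sum_S: "(\<And>i. i \<in> I \<Longrightarrow> f i \<in> S) \<Longrightarrow> sum f I \<in> S"
  unfolding span_G[symmetric]
  by (simp_all add: complex_vector.span_scale complex_vector.span_add complex_vector.span_diff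
      complex_vector.span_sum)

lemma scaleR_S: "v \<in> S \<Longrightarrow> r *\<^sub>R v \<in> S"
  by (simp add: scaleR_scaleC[of r v] scaleC_S)

lemma subspace_S: "subspace S"
  using add_S scaleR_S complex_vector.span_zero[of G] span_G by (auto simp: subspace_def)

lemma closed_S: "closed S"
  using closed_span_finite[OF G] span_G by simp

lemma pert_apply: "blinfun_apply (x - rank_one u) v = x v - cinner v u *\<^sub>C u"
  by (simp add: blinfun.diff_left rank_one_apply)

lemma eigenbasis_exists:
  assumes "u \<in> S" shows "\<exists>E. eigenbasis (x - rank_one u) S E"
proof -
  let ?A = "x - rank_one u"
  have cA: "compact_operator ?A" by (rule compact_operator_diff[OF comp compact_rank_one])
  have inv: "?A v \<in> S" if "v \<in> S" for v
    unfolding pert_apply using that assms by (intro diff_S invariant scaleC_S)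
  have on: "orthonormal {}" by (simp add: orthonormal_def)
  show ?thesis
  proof (rule spectral_theorem_subspace[OF self_adjoint_pert cA closed_S subspace_S inv on])
    fix M assume M: "orthonormal M" "M \<subseteq> S" "\<And>e. e \<in> M \<Longrightarrow> ?A e = ev ?A e *\<^sub>R e" "S \<inter> perp M = {0}"
    have fin: "finite M" using finite_orthonormal_in_span(1)[OF M(1) _ G(2)] M(2) span_G by simp
    have "complex_vector.span M = S"
    proof
      show "complex_vector.span M \<subseteq> S"
        using complex_vector.span_minimal[of M S] M(2) span_G complex_vector.subspace_span[of G] by simp
      show "S \<subseteq> complex_vector.span M"
      proof
        fix v assume v: "v \<in> S"
        let ?s = "\<Sum>e\<in>M. cinner v e *\<^sub>C e"
        have "v - ?s \<in> S" using v M(2) by (intro diff_S sum_S scaleC_S) auto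
        then have "v - ?s = 0" using perp_remainder[OF M(1) fin, of v] M(4) by blast
        then show "v \<in> complex_vector.span M" using orthonormal_sum_in_span[of "cinner v" M] by simp
      qed
    qed
    then show ?thesis using M fin by (auto simp: eigenbasis_def)
  qed simp_all
qed

text \<open>A difference of two numbers in \<open>[0, 1]\<close>; this brings the eigenvalues into
  the range of \<open>powr_modulus\<close>.\<close>

lemma ev_bound:
  assumes "u \<in> S" "norm u = 1" "e \<in> S" "norm e = 1"
  shows "\<bar>ev (x - rank_one u) e\<bar> \<le> 1"
proof -
  have "ev (x - rank_one u) e = inner (x e) e - (cmod (cinner e u))\<^sup>2"
    by (simp add: ev_def blinfun.diff_left inner_simps form_rank_one)
  moreover have "0 \<le> inner (x e) e" using pos by (simp add: positive_operator_iff)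
  moreover have "inner (x e) e \<le> 1" using le_1 assms by simp
  moreover have "(cmod (cinner e u))\<^sup>2 \<le> 1"
    using cmod_cinner_le[of e u] assms by (simp add: power_le_one)
  moreover have "0 \<le> (cmod (cinner e u))\<^sup>2" by simp
  ultimately show ?thesis by linarith
qed

text \<open>The squared Hilbert-Schmidt norm of \<open>rank_one u - rank_one w\<close>, which is a
  trace and hence independent of \<open>x\<close> and of the basis \<open>E\<close>.\<close>

lemma pert_diff_norm:
  assumes E: "eigenbasis A S E" and u: "u \<in> S" "norm u = 1" and w: "w \<in> S" "norm w = 1"
  shows "(\<Sum>e\<in>E. (norm (blinfun_apply (x - rank_one w) e - blinfun_apply (x - rank_one u) e))\<^sup>2) =
    2 - 2 * (cmod (cinner u w))\<^sup>2"
proof -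
  note E = eigenbasisD[OF E]
  have "complex_of_real (\<Sum>e\<in>E. (norm ((x - rank_one w) e - (x - rank_one u) e))\<^sup>2) =
      (\<Sum>e\<in>E. cinner (cinner e u *\<^sub>C u - cinner e w *\<^sub>C w) (cinner e u *\<^sub>C u - cinner e w *\<^sub>C w))"
    unfolding of_real_sum cinner_self[symmetric] pert_apply by (simp add: algebra_simps)
  also have "\<dots> = (\<Sum>e\<in>E. cinner u e * cnj (cinner u e) + cinner w e * cnj (cinner w e)
      - (cinner w e * cnj (cinner u e)) * cinner u w - (cinner u e * cnj (cinner w e)) * cinner w u)"
  proof (intro sum.cong refl)
    fix e
    show "cinner (cinner e u *\<^sub>C u - cinner e w *\<^sub>C w) (cinner e u *\<^sub>C u - cinner e w *\<^sub>C w) =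
        cinner u e * cnj (cinner u e) + cinner w e * cnj (cinner w e)
        - (cinner w e * cnj (cinner u e)) * cinner u w - (cinner u e * cnj (cinner w e)) * cinner w u"
      using u(2) w(2)
      by (simp add: cinner.diff_left cinner.diff_right cinner_scaleC_left cinner_scaleC_right cinner_self[of u]
          cinner_self[of w] cinner_commute[of u e] cinner_commute[of w e] algebra_simps)
  qed
  also have "\<dots> = cinner u u + cinner w w - cinner w u * cinner u w - cinner u w * cinner w u"
  proof -
    have dot: "(\<Sum>e\<in>E. cinner a e * cnj (cinner b e)) = cinner a b" if "a \<in> S" "b \<in> S" for a b
      using cinner_orthonormal_sums[OF E(2,1), of "cinner a" "cinner b"]
        orthonormal_span_expand[OF E(2,1), of a] orthonormal_span_expand[OF E(2,1), of b] E(3) that by simp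
    show ?thesis
      unfolding sum_subtractf sum.distrib sum_distrib_right[symmetric] by (simp only: dot u(1) w(1))
  qed
  also have "\<dots> = complex_of_real (2 - 2 * (cmod (cinner u w))\<^sup>2)"
    using u(2) w(2) cinner_mult_commute[of u w] by (simp add: cinner_self[of u] cinner_self[of w] mult.commute[of "cinner w u"])
  finally show ?thesis by (simp only: of_real_eq_iff)
qed

lemma one_minus_cinner_le:
  assumes "norm (u::'h) = 1" "norm w = 1"
  shows "1 - (cmod (cinner u w))\<^sup>2 \<le> (norm (u - w))\<^sup>2"
proof -
  have "(norm (u - w))\<^sup>2 = 2 - 2 * inner u w"
    using assms by (simp add: power2_norm_eq_inner[of "u - w"] inner_simps inner_commute[of w u] norm_eq_1)
  moreover have "inner u w \<le> cmod (cinner u w)"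
    by (simp add: inner_eq_Re_cinner complex_Re_le_cmod)
  moreover have "0 \<le> (1 - cmod (cinner u w))\<^sup>2" by simp
  ultimately show ?thesis by (simp add: power2_diff)
qed

text \<open>Klein's inequality with slope \<open>0\<close> and the uniform modulus. Using it with
  \<open>u\<close> and \<open>w\<close> exchanged as well gives continuity of
  \<open>F\<close>.\<close>

lemma F_lower:
  assumes "0 < \<epsilon>"
  shows "\<exists>C\<ge>0. \<forall>u\<in>S. \<forall>w\<in>S. norm u = 1 \<longrightarrow> norm w = 1 \<longrightarrow>
    F u - real (card G) * \<epsilon> - C * (norm (u - w))\<^sup>2 \<le> F w"
proof -
  obtain C where C: "0 \<le> C" "\<And>a b. \<bar>a\<bar> \<le> 1 \<Longrightarrow> \<bar>b\<bar> \<le> 1 \<Longrightarrow>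
      \<bar>a\<bar> powr p - \<epsilon> - C * (b - a)\<^sup>2 \<le> \<bar>b\<bar> powr p"
    using powr_modulus[OF p assms] by blast
  have "F u - real (card G) * \<epsilon> - (2 * C) * (norm (u - w))\<^sup>2 \<le> F w"
    if u: "u \<in> S" "norm u = 1" and w: "w \<in> S" "norm w = 1" for u w
  proof -
    obtain E where E: "eigenbasis (x - rank_one u) S E" using eigenbasis_exists[OF u(1)] by blast
    obtain H where H: "eigenbasis (x - rank_one w) S H" using eigenbasis_exists[OF w(1)] by blast
    have "(\<Sum>e\<in>E. \<bar>ev (x - rank_one u) e\<bar> powr p) +
        (\<Sum>e\<in>E. 0 * (inner ((x - rank_one w) e) e - inner ((x - rank_one u) e) e)) -
        real (card E) * \<epsilon> - C * (\<Sum>e\<in>E. (norm ((x - rank_one w) e - (x - rank_one u) e))\<^sup>2) \<le>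
        (\<Sum>f\<in>H. \<bar>ev (x - rank_one w) f\<bar> powr p)"
    proof (rule klein_inequality[where g = "\<lambda>t. \<bar>t\<bar> powr p", OF self_adjoint_pert E self_adjoint_pert H])
      fix e f assume "e \<in> E" "f \<in> H"
      then have "\<bar>ev (x - rank_one u) e\<bar> \<le> 1" "\<bar>ev (x - rank_one w) f\<bar> \<le> 1"
        using ev_bound[OF u] ev_bound[OF w] eigenbasisD(5,6)[OF E] eigenbasisD(5,6)[OF H] by auto
      from C(2)[OF this]
      show "\<bar>ev (x - rank_one u) e\<bar> powr p + 0 * (ev (x - rank_one w) f - ev (x - rank_one u) e) - \<epsilon> -
          C * (ev (x - rank_one w) f - ev (x - rank_one u) e)\<^sup>2 \<le> \<bar>ev (x - rank_one w) f\<bar> powr p"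
        by simp
    qed
    then have "F u - real (card E) * \<epsilon> - C * (2 - 2 * (cmod (cinner u w))\<^sup>2) \<le> F w"
      using F[OF u E] F[OF w H] unfolding pert_diff_norm[OF E u w] by simp
    moreover have "real (card E) * \<epsilon> \<le> real (card G) * \<epsilon>"
      using finite_orthonormal_in_span(2)[OF eigenbasisD(2)[OF E] _ G(2)] eigenbasisD(5)[OF E] span_G assms
      by (intro mult_right_mono) auto
    moreover have "C * (2 - 2 * (cmod (cinner u w))\<^sup>2) \<le> (2 * C) * (norm (u - w))\<^sup>2"
      using mult_left_mono[OF one_minus_cinner_le[OF u(2) w(2)], of "2 * C"] C(1) by (simp add: algebra_simps)
    ultimately show ?thesis by linarith
  qed
  then show ?thesis using C(1) by (intro exI[of _ "2 * C"]) auto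
qed

lemma F_continuous: "continuous_on (S \<inter> sphere 0 1) F"
  unfolding continuous_on_iff
proof (intro ballI allI impI)
  fix u and \<eta> :: real assume u: "u \<in> S \<inter> sphere 0 1" and \<eta>: "0 < \<eta>"
  \<comment> \<open>Both error terms of \<open>F_lower\<close> get \<open>\<eta> / 2\<close>: this
    choice covers the one with \<open>card G\<close>, and \<open>\<delta>\<close> below covers the
    quadratic one.\<close>
  define \<epsilon> where "\<epsilon> = \<eta> / (2 * (real (card G) + 1))"
  have \<epsilon>: "0 < \<epsilon>" using \<eta> by (simp add: \<epsilon>_def)
  have "real (card G) * \<epsilon> < \<eta> / 2"
    using \<eta> by (simp add: \<epsilon>_def field_simps)
  moreover obtain C where C: "0 \<le> C" "\<And>u w. u \<in> S \<Longrightarrow> w \<in> S \<Longrightarrow> norm u = 1 \<Longrightarrow> norm w = 1 \<Longrightarrow>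
      F u - real (card G) * \<epsilon> - C * (norm (u - w))\<^sup>2 \<le> F w"
    using F_lower[OF \<epsilon>] by blast
  define \<delta> where "\<delta> = sqrt (\<eta> / (2 * (C + 1)))"
  have \<delta>: "0 < \<delta>" "\<delta>\<^sup>2 = \<eta> / (2 * (C + 1))" using \<eta> C(1) by (simp_all add: \<delta>_def)
  have small: "C * (norm (u - w))\<^sup>2 \<le> \<eta> / 2" if "norm (u - w) < \<delta>" for w
  proof -
    have "(norm (u - w))\<^sup>2 \<le> \<delta>\<^sup>2" using that by (intro power_mono) auto
    then have "C * (norm (u - w))\<^sup>2 \<le> (C + 1) * (\<eta> / (2 * (C + 1)))"
      unfolding \<delta>(2)[symmetric] using C(1) by (intro mult_mono) auto
    also have "\<dots> = \<eta> / 2" using C(1) by (simp add: field_simps)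
    finally show ?thesis .
  qed
  have "dist (F w) (F u) < \<eta>" if w: "w \<in> S \<inter> sphere 0 1" and d: "dist w u < \<delta>" for w
  proof -
    have "norm (u - w) < \<delta>" using d by (simp add: dist_norm norm_minus_commute)
    then have "C * (norm (u - w))\<^sup>2 \<le> \<eta> / 2" by (rule small)
    moreover have "F u - real (card G) * \<epsilon> - C * (norm (u - w))\<^sup>2 \<le> F w"
      using C(2)[of u w] u w by simp
    moreover have "F w - real (card G) * \<epsilon> - C * (norm (u - w))\<^sup>2 \<le> F u"
      using C(2)[of w u] u w by (simp add: norm_minus_commute)
    ultimately show ?thesis using \<open>real (card G) * \<epsilon> < \<eta> / 2\<close> unfolding dist_real_def by linarith
  qed
  then show "\<exists>d>0. \<forall>w\<in>S \<inter> sphere 0 1. dist w u < d \<longrightarrow> dist (F w) (F u) < \<eta>" using \<delta>(1) by blast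
qed

text \<open>At a maximum \<open>u\<close> the tangent inequality says that a quadratic form on \<open>S\<close> is nonnegative
  and vanishes at \<open>u\<close>; hence \<open>u\<close> is an eigenvector of \<open>sgn A * \<bar>A\<bar> ^ (p - 1)\<close> for \<open>A = x - P u\<close>.\<close>

lemma maximizer_functional_calculus:
  assumes u: "u \<in> S" "norm u = 1" and E: "eigenbasis (x - rank_one u) S E"
    and max: "\<And>w. w \<in> S \<Longrightarrow> norm w = 1 \<Longrightarrow> F w \<le> F u"
  obtains m where "\<And>e. e \<in> E \<Longrightarrow> cinner u e \<noteq> 0 \<Longrightarrow>
    p * \<bar>ev (x - rank_one u) e\<bar> powr p / ev (x - rank_one u) e = m"
proof -
  let ?a = "\<lambda>e. ev (x - rank_one u) e"
  \<comment> \<open>The derivative of \<open>\<bar>t\<bar> powr p\<close> at a nonzero eigenvalue,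
    and \<open>0\<close> at eigenvalue \<open>0\<close>.\<close>
  define h where "h e = p * \<bar>?a e\<bar> powr p / ?a e" for e
  note E' = eigenbasisD[OF E]
  have "\<forall>e. \<exists>C\<ge>0. \<forall>b. \<bar>?a e\<bar> powr p + h e * (b - ?a e) - C * (b - ?a e)\<^sup>2 \<le> \<bar>b\<bar> powr p"
    unfolding h_def using powr_tangent[OF p] by blast
  then obtain Ce where Ce: "\<And>e. 0 \<le> Ce e"
    "\<And>e b. \<bar>?a e\<bar> powr p + h e * (b - ?a e) - Ce e * (b - ?a e)\<^sup>2 \<le> \<bar>b\<bar> powr p" by metis
  \<comment> \<open>A single constant for all eigenvalues, possible because \<open>E\<close> is
    finite.\<close>
  define C where "C = (\<Sum>e\<in>E. Ce e)"
  have tangent: "\<bar>?a e\<bar> powr p + h e * (b - ?a e) - C * (b - ?a e)\<^sup>2 \<le> \<bar>b\<bar> powr p" if "e \<in> E" for e b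
  proof -
    have "Ce e \<le> C" unfolding C_def using that Ce(1) E'(1) by (intro member_le_sum) auto
    then have "Ce e * (b - ?a e)\<^sup>2 \<le> C * (b - ?a e)\<^sup>2" by (intro mult_right_mono) auto
    then show ?thesis using Ce(2)[of e b] by linarith
  qed
  define m where "m = (\<Sum>e\<in>E. h e * (cmod (cinner u e))\<^sup>2)"
  have ineq: "0 \<le> (\<Sum>e\<in>E. h e * (cmod (cinner w e))\<^sup>2) + (2 * C - m) - 2 * C * (cmod (cinner w u))\<^sup>2"
    if w: "w \<in> S" "norm w = 1" for w
  proof -
    obtain H where H: "eigenbasis (x - rank_one w) S H" using eigenbasis_exists[OF w(1)] by blast
    have "(\<Sum>e\<in>E. \<bar>?a e\<bar> powr p) +
        (\<Sum>e\<in>E. h e * (inner ((x - rank_one w) e) e - inner ((x - rank_one u) e) e)) -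
        real (card E) * 0 - C * (\<Sum>e\<in>E. (norm ((x - rank_one w) e - (x - rank_one u) e))\<^sup>2) \<le>
        (\<Sum>f\<in>H. \<bar>ev (x - rank_one w) f\<bar> powr p)"
      by (rule klein_inequality[where g = "\<lambda>t. \<bar>t\<bar> powr p", OF self_adjoint_pert E self_adjoint_pert H])
         (use tangent in simp)
    then have "(\<Sum>e\<in>E. h e * (inner ((x - rank_one w) e) e - inner ((x - rank_one u) e) e)) \<le>
        C * (2 - 2 * (cmod (cinner u w))\<^sup>2)"
      using F[OF u E] F[OF w H] max[OF w] unfolding pert_diff_norm[OF E u w] by simp
    also have "(\<Sum>e\<in>E. h e * (inner ((x - rank_one w) e) e - inner ((x - rank_one u) e) e)) =
        m - (\<Sum>e\<in>E. h e * (cmod (cinner w e))\<^sup>2)"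
      unfolding m_def sum_subtractf[symmetric]
      by (intro sum.cong refl)
         (simp add: blinfun.diff_left inner_simps form_rank_one cmod_cinner_commute[of w] cmod_cinner_commute[of u]
           right_diff_distrib)
    finally show ?thesis by (simp add: cmod_cinner_commute[of w u] right_diff_distrib)
  qed
  \<comment> \<open>The right side of \<open>ineq\<close> made homogeneous, with the identity
    carrying the constant term. At \<open>u\<close> its form is
    \<open>m + (2 * C - m) - 2 * C = 0\<close>.\<close>
  define D where "D = (\<Sum>e\<in>E. h e *\<^sub>R rank_one e) + ((2 * C - m) *\<^sub>R id_blinfun - (2 * C) *\<^sub>R rank_one u)"
  have Dv: "D v = (\<Sum>e\<in>E. h e *\<^sub>R (cinner v e *\<^sub>C e)) + ((2 * C - m) *\<^sub>R v - (2 * C) *\<^sub>R (cinner v u *\<^sub>C u))" for v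
    by (simp add: D_def blinfun.add_left blinfun.diff_left blinfun.sum_left blinfun.scaleR_left rank_one_apply)
  have sym: "inner (D v) w = inner v (D w)" for v w
  proof -
    have "self_adjoint (id_blinfun :: 'h \<Rightarrow>\<^sub>L 'h)" by (simp add: self_adjoint_def)
    then have "self_adjoint D" unfolding D_def
      by (intro self_adjoint_add self_adjoint_sum self_adjoint_diff self_adjoint_scaleR self_adjoint_rank_one)
    then show ?thesis by (rule self_adjoint_inner)
  qed
  have Dform: "inner (D v) v = (\<Sum>e\<in>E. h e * (cmod (cinner v e))\<^sup>2) + (2 * C - m) * (norm v)\<^sup>2 -
      2 * C * (cmod (cinner v u))\<^sup>2" for v
    by (simp add: D_def blinfun.add_left blinfun.diff_left blinfun.sum_left blinfun.scaleR_left inner_simps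
        inner_sum_left form_rank_one power2_norm_eq_inner)
  have DS: "D v \<in> S" if "v \<in> S" for v
    unfolding Dv using that u(1) E'(5) by (intro add_S diff_S sum_S scaleR_S scaleC_S) auto
  have Dpos: "0 \<le> inner (D v) v" if v: "v \<in> S" for v
  proof (cases "v = 0")
    case False
    define w where "w = v /\<^sub>R norm v"
    have w: "w \<in> S" "norm w = 1" using v False by (auto simp: w_def scaleR_S)
    have "0 \<le> inner (D w) w" using ineq[OF w] w(2) by (simp add: Dform)
    moreover have "inner (D v) v = (norm v)\<^sup>2 * inner (D w) w"
      using False by (simp add: w_def blinfun.scaleR_right power2_eq_square field_simps)
    ultimately show ?thesis by simp
  qed (simp add: blinfun.zero_right)
  have "inner (D u) u = 0" using u(2) by (simp add: Dform m_def cinner_self)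
  then have Du: "D u = 0" by (intro zero_form_imp_zero[OF sym subspace_S DS Dpos u(1)])
  \<comment> \<open>\<open>D u = 0\<close> says that \<open>u\<close> is an eigenvector, for
    \<open>m\<close>, of the operator with eigenvalues \<open>h\<close> on \<open>E\<close>; the
    coefficients along \<open>e\<close> are compared.\<close>
  have "h e = m" if e: "e \<in> E" "cinner u e \<noteq> 0" for e
  proof -
    have "(\<Sum>f\<in>E. h f *\<^sub>R (cinner u f *\<^sub>C f)) = m *\<^sub>R u"
      using Du u(2) by (simp add: Dv cinner_self algebra_simps)
    then have "(\<Sum>f\<in>E. (complex_of_real (h f) * cinner u f) *\<^sub>C f) = m *\<^sub>R u"
      by (simp add: scaleR_scaleC[of "h _"] scaleC_scaleC)
    then have "complex_of_real (h e) * cinner u e = complex_of_real m * cinner u e"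
      using cinner_orthonormal_sum[OF E'(2,1) e(1), of "\<lambda>f. complex_of_real (h f) * cinner u f"]
      by (simp only: cinner_scaleR_left)
    then show ?thesis using e(2) by simp
  qed
  then show ?thesis using that unfolding h_def by blast
qed

text \<open>\<open>A = x - P u\<close> has at most one negative eigenvalue, and its form is nonpositive at \<open>u\<close>.\<close>

lemma maximizer_is_eigenvector:
  assumes u: "u \<in> S" "norm u = 1" and max: "\<And>w. w \<in> S \<Longrightarrow> norm w = 1 \<Longrightarrow> F w \<le> F u"
  shows "\<exists>a. x u = a *\<^sub>R u"
proof -
  obtain E where E: "eigenbasis (x - rank_one u) S E" using eigenbasis_exists[OF u(1)] by blast
  let ?A = "x - rank_one u" and ?a = "\<lambda>e. ev (x - rank_one u) e"
  note E' = eigenbasisD[OF E]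
  obtain m where m: "\<And>e. e \<in> E \<Longrightarrow> cinner u e \<noteq> 0 \<Longrightarrow> p * \<bar>?a e\<bar> powr p / ?a e = m"
    using maximizer_functional_calculus[OF u E max] by metis
  have xu: "x u = ?A u + u" using u(2) by (simp add: pert_apply cinner_self)
  have Au: "?A u = (\<Sum>e\<in>E. (complex_of_real (?a e) * cinner u e) *\<^sub>C e)"
    by (rule eigenbasis_apply[OF self_adjoint_pert E u(1)])
  have uE: "u = (\<Sum>e\<in>E. cinner u e *\<^sub>C e)"
    using orthonormal_span_expand[OF E'(2,1), of u] E'(3) u(1) by simp
  have formA: "inner (?A v) v = inner (x v) v - (cmod (cinner v u))\<^sup>2" for v
    by (simp add: blinfun.diff_left inner_simps form_rank_one)
  obtain e1 where e1: "e1 \<in> E" "cinner u e1 \<noteq> 0"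
  proof (rule ccontr)
    assume "\<not> thesis"
    then have "\<forall>e\<in>E. cinner u e = 0" using that by blast
    then have "u = 0" using uE by (simp add: scaleC.zero_left)
    then show False using u(2) by simp
  qed
  \<comment> \<open>Only the sign of \<open>m\<close> is exploited: for \<open>p = 1\<close> the
    slope carries nothing else. If \<open>?a e = 0\<close>, the quotient, and so \<open>m\<close>,
    is \<open>0\<close> by the convention for division.\<close>
  have sgn: "sgn (?a e) = sgn m" if "e \<in> E" "cinner u e \<noteq> 0" for e
  proof (cases "?a e = 0")
    case False
    then have "0 < p * \<bar>?a e\<bar> powr p" using p by simp
    then have "sgn m = 1 / sgn (?a e)" using m[OF that] by (metis sgn_divide sgn_pos)
    then show ?thesis using False by (simp add: sgn_if)
  qed (use m[OF that] in simp)
  consider "m = 0" | "m > 0" | "m < 0" by linarith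
  then show ?thesis
  proof cases
    case 1
    then have "?a e = 0" if "e \<in> E" "cinner u e \<noteq> 0" for e using sgn[OF that] by (simp add: sgn_zero_iff)
    then have "?A u = 0" unfolding Au by (intro sum.neutral) (auto simp: scaleC.zero_left)
    then show ?thesis using xu by (intro exI[of _ 1]) simp
  next
    case 2
    then have a: "0 < ?a e" if "e \<in> E" "cinner u e \<noteq> 0" for e using sgn[OF that] by (simp add: sgn_1_pos)
    have "0 < (\<Sum>e\<in>E. ?a e * (cmod (cinner u e))\<^sup>2)"
    proof (rule sum_pos2[OF E'(1) e1(1)])
      show "0 < ?a e1 * (cmod (cinner u e1))\<^sup>2" using a[OF e1] e1(2) by simp
      show "0 \<le> ?a e * (cmod (cinner u e))\<^sup>2" if "e \<in> E" for e
        using a[OF that] by (cases "cinner u e = 0") auto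
    qed
    also have "\<dots> = inner (?A u) u" by (rule eigenbasis_form[OF self_adjoint_pert E u(1), symmetric])
    also have "\<dots> \<le> 0" unfolding formA using le_1[OF u] u(2) by (simp add: cinner_self)
    finally show ?thesis by simp
  next
    case 3
    then have a: "?a e < 0" if "e \<in> E" "cinner u e \<noteq> 0" for e using sgn[OF that] by (simp add: sgn_1_neg)
    have only: "cinner u e = 0" if e: "e \<in> E" "e \<noteq> e1" for e
    proof (rule ccontr)
      assume ne: "cinner u e \<noteq> 0"
      \<comment> \<open>The combination of \<open>e1\<close> and \<open>e\<close> orthogonal to
        \<open>u\<close>, where the forms of \<open>?A\<close> and \<open>x\<close> agree. Two
        negative eigenvalues make the first negative, against positivity of
        \<open>x\<close>.\<close>
      define v where "v = cinner e u *\<^sub>C e1 - cinner e1 u *\<^sub>C e"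
      have vS: "v \<in> S" unfolding v_def using E'(5) e e1 by (intro diff_S scaleC_S)
      have vu: "cinner v u = 0" by (simp add: v_def cinner.diff_left cinner_scaleC_left)
      have 0: "cinner e e1 = 0" "cinner e1 e = 0" using E'(2) e e1(1) by (auto simp: orthonormal_def)
      have ve1: "cinner v e1 = cinner e u"
        using E'(6)[OF e1(1)] 0 by (simp add: v_def cinner.diff_left cinner_scaleC_left cinner_self)
      have nonpos: "?a f * (cmod (cinner v f))\<^sup>2 \<le> 0" if f: "f \<in> E" for f
      proof (cases "f = e1 \<or> f = e")
        case True
        then have "?a f < 0" using a[OF e1] a[OF e(1) ne] by auto
        then show ?thesis by (simp add: mult_le_0_iff)
      next
        case False
        then have "cinner e1 f = 0" "cinner e f = 0" using E'(2) f e e1(1) by (auto simp: orthonormal_def)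
        then show ?thesis by (simp add: v_def cinner.diff_left cinner_scaleC_left)
      qed
      have "0 \<le> inner (?A v) v"
        unfolding formA vu using pos by (simp add: positive_operator_iff)
      also have "\<dots> = (\<Sum>f\<in>E. ?a f * (cmod (cinner v f))\<^sup>2)"
        by (rule eigenbasis_form[OF self_adjoint_pert E vS])
      also have "\<dots> = ?a e1 * (cmod (cinner v e1))\<^sup>2 + (\<Sum>f\<in>E - {e1}. ?a f * (cmod (cinner v f))\<^sup>2)"
        by (rule sum.remove[OF E'(1) e1(1)])
      also have "\<dots> \<le> ?a e1 * (cmod (cinner v e1))\<^sup>2"
        using sum_nonpos[of "E - {e1}" "\<lambda>f. ?a f * (cmod (cinner v f))\<^sup>2"] nonpos by simp
      finally have "0 \<le> ?a e1 * (cmod (cinner e u))\<^sup>2" by (simp only: ve1)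
      moreover have "cinner e u \<noteq> 0" using ne cinner_eq_zero_commute[of u e] by simp
      ultimately show False using a[OF e1] by (simp add: zero_le_mult_iff)
    qed
    have "u = cinner u e1 *\<^sub>C e1"
      by (subst uE, subst sum.remove[OF E'(1) e1(1)]) (simp add: only scaleC.zero_left)
    moreover have "?A u = (complex_of_real (?a e1) * cinner u e1) *\<^sub>C e1"
      unfolding Au by (subst sum.remove[OF E'(1) e1(1)]) (simp add: only scaleC.zero_left)
    ultimately have "?A u = ?a e1 *\<^sub>R u"
      by (metis scaleC_scaleC scaleR_scaleC)
    then show ?thesis using xu by (intro exI[of _ "?a e1 + 1"]) (simp add: scaleR_add_left)
  qed
qed

end

section \<open>Isometries fixing the rank-one projections\<close>

text \<open>In an eigenbasis of \<open>x\<close> through \<open>u\<close>, subtracting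
  \<open>rank_one u\<close> only changes the eigenvalue \<open>a\<close> at \<open>u\<close> to
  \<open>a - 1\<close>; the other eigenvectors contribute \<open>1 - a powr p\<close>.\<close>

lemma pos_sphere_diff_at_eigenvector:
  assumes p: "0 < p" and x: "x \<in> schatten_pos_sphere p" and u: "norm u = 1" "blinfun_apply x u = a *\<^sub>R u"
  shows "0 \<le> a" "a \<le> 1" "schatten_sum p (x - rank_one u) = 1 - a powr p + (1 - a) powr p"
proof -
  note x' = pos_sphereD[OF x]
  have ev: "ev x u = a" by (rule ev_eqI[OF u(2,1)])
  then show a0: "0 \<le> a" using ev_nonneg[OF x'(1), of u] by simp
  have "orthonormal {u}" using u(1) by (simp add: orthonormal_def)
  moreover have "x e = ev x e *\<^sub>R e" if "e \<in> {u}" for e using that u(2) ev by simp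
  ultimately obtain X where X: "{u} \<subseteq> X" "diagonalizes X x" "perp X = {0}"
    by (rule spectral_theorem[OF x'(2,3)])
  note XD = diagonalizesD[OF X(2)]
  have ins: "insert u (X - {u}) = X" using X(1) by auto
  note S = pos_sphere_has_sum[OF p x X(2)]
  define r where "r = (\<Sum>\<^sub>\<infinity>f\<in>X - {u}. ev x f powr p)"
  have "(\<lambda>f. ev x f powr p) summable_on X - {u}"
    by (rule summable_on_subset[OF has_sum_imp_summable[OF S]]) auto
  then have r: "((\<lambda>f. ev x f powr p) has_sum r) (X - {u})" by (simp add: r_def)
  have "((\<lambda>f. ev x f powr p) has_sum (a powr p + r)) X"
    using has_sum_insert[OF _ r, of u] ins by (simp add: ev)
  then have req: "r = 1 - a powr p" using has_sum_unique[OF S] by fastforce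
  have "0 \<le> r" unfolding r_def by (intro infsum_nonneg) simp
  then have "a powr p \<le> 1" using req by simp
  then show a1: "a \<le> 1" using p gr_one_powr[of a p] by linarith
  have eu: "cinner e u = 0" if "e \<in> X - {u}" for e
    using orthonormal_cinner[OF XD(1), of e u] X(1) that by auto
  have A1: "(x - rank_one u) e = ev x e *\<^sub>R e" if "e \<in> X - {u}" for e
    using that XD(2)[of e] eu[OF that] by (simp add: blinfun.diff_left rank_one_apply scaleC.zero_left)
  have A2: "(x - rank_one u) u = (a - 1) *\<^sub>R u"
    using u by (simp add: blinfun.diff_left rank_one_unit scaleR_diff_left)
  have ev1: "ev (x - rank_one u) e = ev x e" if "e \<in> X - {u}" for e
    by (rule ev_eqI[OF A1[OF that]]) (use that orthonormal_norm[OF XD(1)] in auto)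
  have ev2: "ev (x - rank_one u) u = a - 1" by (rule ev_eqI[OF A2 u(1)])
  have dA: "diagonalizes X (x - rank_one u)"
    unfolding diagonalizes_def
  proof (intro conjI ballI XD(1))
    show "(x - rank_one u) e = ev (x - rank_one u) e *\<^sub>R e" if "e \<in> X" for e
      using A1[of e] A2 ev1[of e] ev2 that by (cases "e = u") auto
    show "(x - rank_one u) v = 0" if "v \<in> perp X" for v using that X(3) by (simp add: blinfun.zero_right)
  qed
  have "((\<lambda>f. \<bar>ev (x - rank_one u) f\<bar> powr p) has_sum r) (X - {u})"
    by (rule has_sum_cong[THEN iffD1, OF _ r]) (simp add: ev1 ev_nonneg[OF x'(1)])
  then have "((\<lambda>f. \<bar>ev (x - rank_one u) f\<bar> powr p) has_sum ((1 - a) powr p + r)) X"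
    using has_sum_insert[of u "X - {u}" "\<lambda>f. \<bar>ev (x - rank_one u) f\<bar> powr p" r] ins a1 by (simp add: ev2)
  then have "(\<Sum>\<^sub>\<infinity>f\<in>X. \<bar>ev (x - rank_one u) f\<bar> powr p) = (1 - a) powr p + r" by (rule infsumI)
  then show "schatten_sum p (x - rank_one u) = 1 - a powr p + (1 - a) powr p"
    using schatten_sum_eq_infsum[OF pos_sphere_diff_compact[OF x rank_one_in_sphere[OF p u(1)]] dA, of p] req
    by simp
qed

text \<open>Both \<open>- a powr p\<close> and \<open>(1 - a) powr p\<close> are strictly decreasing
  on \<open>[0, 1]\<close>.\<close>

lemma eigenvalue_determined:
  fixes a b p :: real
  assumes "0 < p" "0 \<le> a" "a \<le> 1" "0 \<le> b" "b \<le> 1"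
    and "1 - a powr p + (1 - a) powr p = 1 - b powr p + (1 - b) powr p"
  shows "a = b"
proof (rule ccontr)
  assume "a \<noteq> b"
  then consider "a < b" | "b < a" by linarith
  then show False
  proof cases
    case 1
    then have "a powr p < b powr p" "(1 - b) powr p < (1 - a) powr p"
      using assms by (auto intro: powr_less_mono2)
    then show False using assms by simp
  next
    case 2
    then have "b powr p < a powr p" "(1 - a) powr p < (1 - b) powr p"
      using assms by (auto intro: powr_less_mono2)
    then show False using assms by simp
  qed
qed

lemma pos_sphere_form_le_1:
  assumes p: "0 < p" and x: "x \<in> schatten_pos_sphere p" and v: "norm v = 1"
  shows "inner (blinfun_apply x v) v \<le> 1"
proof -
  note x' = pos_sphereD[OF x]
  obtain X where X: "diagonalizes X x" "perp X = {0}" by (rule diagonalization_exists[OF x'(2,3)])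
  have "ev x e \<le> 1" if "e \<in> X" for e
  proof -
    have "ev x e powr p \<le> 1" using finite_sum_le_has_sum[OF pos_sphere_has_sum[OF p x X(1)], of "{e}"] that by simp
    then show ?thesis using p gr_one_powr[of "ev x e" p] by linarith
  qed
  then have "v \<in> perp {e \<in> X. ev x e > 1}" by (fastforce simp: perp_def)
  from form_le_perp_large[OF x'(2,3) X(1) _ this] show ?thesis using v by simp
qed

section \<open>Finite-rank elements are determined by their distances\<close>

lemma orthonormal_basis_exists:
  assumes X: "finite X" and T: "complex_vector.subspace T" "T \<subseteq> complex_vector.span X"
  obtains G where "finite G" "orthonormal G" "complex_vector.span G = T"
proof -
  have "orthonormal {}" by (simp add: orthonormal_def)
  then obtain G where G: "orthonormal G" "\<And>e. e \<in> G \<Longrightarrow> e \<in> T"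
    and max: "\<And>v. v \<in> perp G \<Longrightarrow> norm v = 1 \<Longrightarrow> v \<notin> T"
    by (rule orthonormal_extend[where Q = "\<lambda>e. e \<in> T"]) auto
  have GT: "G \<subseteq> T" using G(2) by blast
  have fin: "finite G" using finite_orthonormal_in_span(1)[OF G(1) _ X] GT T(2) by blast
  have span: "complex_vector.span G \<subseteq> T" by (rule complex_vector.span_minimal[OF GT T(1)])
  have "T \<subseteq> complex_vector.span G"
  proof
    fix v assume v: "v \<in> T"
    define s where "s = (\<Sum>e\<in>G. cinner v e *\<^sub>C e)"
    have s: "s \<in> complex_vector.span G" unfolding s_def by (rule orthonormal_sum_in_span)
    have r: "v - s \<in> T" using v s span complex_vector.subspace_diff[OF T(1)] by blast
    have "v - s = 0"
    proof (rule ccontr)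
      assume ne: "v - s \<noteq> 0"
      define w where "w = complex_of_real (inverse (norm (v - s))) *\<^sub>C (v - s)"
      have "w \<in> T" unfolding w_def by (rule complex_vector.subspace_scale[OF T(1) r])
      moreover have "w \<in> perp G"
        unfolding w_def s_def by (rule scaleC_perp[OF perp_remainder[OF G(1) fin]])
      moreover have "norm w = 1" using ne by (simp add: w_def norm_scaleC norm_inverse)
      ultimately show False using max by blast
    qed
    then show "v \<in> complex_vector.span G" using s by simp
  qed
  then show ?thesis using that fin G(1) span by blast
qed

lemma perp_span:
  assumes "t \<in> perp X" "v \<in> complex_vector.span X"
  shows "cinner t v = 0"
  using assms(2)
proof (induction rule: complex_vector.span_induct_alt)
  case base
  then show ?case by (rule cinner.zero_right)
next
  case (step c e v)
  then show ?case using assms(1) by (simp add: cinner.add_right cinner_scaleC_right perp_def)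
qed

text \<open>As \<open>u\<close> is orthogonal to \<open>M\<close>, the projection leaves the
  eigenvectors in \<open>M\<close> untouched. Their contribution is the constant \<open>c\<close> of
  \<open>compressed_distance\<close>.\<close>

lemma schatten_sum_split:
  assumes X: "finite X" "orthonormal X" and y: "self_adjoint y" "compact_operator y"
    and ker: "\<And>v. v \<in> perp X \<Longrightarrow> blinfun_apply y v = 0"
    and M: "finite M" "orthonormal M" "M \<subseteq> complex_vector.span X" "\<And>e. e \<in> M \<Longrightarrow> blinfun_apply y e = ev y e *\<^sub>R e"
    and u: "u \<in> complex_vector.span X \<inter> perp M"
    and E: "eigenbasis (y - rank_one u) (complex_vector.span X \<inter> perp M) E"
  shows "schatten_sum p (y - rank_one u) = (\<Sum>e\<in>M. \<bar>ev y e\<bar> powr p) + (\<Sum>e\<in>E. \<bar>ev (y - rank_one u) e\<bar> powr p)"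
proof -
  let ?A = "y - rank_one u"
  note E' = eigenbasisD[OF E]
  have EM: "E \<subseteq> perp M" using E'(5) by auto
  have eu: "cinner e u = 0" if "e \<in> M" for e
    using u that cinner_eq_zero_commute[of u e] by (auto simp: perp_def)
  have AM: "?A e = ev y e *\<^sub>R e" if "e \<in> M" for e
    using M(4)[OF that] eu[OF that] by (simp add: blinfun.diff_left rank_one_apply scaleC.zero_left)
  have evM: "ev ?A e = ev y e" if "e \<in> M" for e
    by (rule ev_eqI[OF AM[OF that]]) (rule orthonormal_norm[OF M(2) that])
  have "diagonalizes (M \<union> E) ?A"
    unfolding diagonalizes_def
  proof (intro conjI ballI)
    show "orthonormal (M \<union> E)" by (rule orthonormal_Un[OF M(2) E'(2) EM])
    show "?A e = ev ?A e *\<^sub>R e" if "e \<in> M \<union> E" for e using that AM evM E'(4) by auto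
    fix v assume v: "v \<in> perp (M \<union> E)"
    \<comment> \<open>The component in the span of \<open>X\<close> lies in the span of
      \<open>E\<close> and is orthogonal to \<open>E\<close>, hence is \<open>0\<close>; so
      \<open>v\<close> lies in \<open>perp X\<close>, where \<open>y\<close> and
      \<open>rank_one u\<close> vanish.\<close>
    define s where "s = (\<Sum>e\<in>X. cinner v e *\<^sub>C e)"
    have t: "v - s \<in> perp X" unfolding s_def by (rule perp_remainder[OF X(2,1)])
    have sS: "s \<in> complex_vector.span X" unfolding s_def by (rule orthonormal_sum_in_span)
    have s0: "cinner s e = 0" if "e \<in> M \<union> E" for e
    proof -
      have "e \<in> complex_vector.span X" using that M(3) E'(5) by auto
      then have "cinner (v - s) e = 0" by (rule perp_span[OF t])
      then show ?thesis using perpD[OF v that] by (simp add: cinner.diff_left)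
    qed
    then have "s \<in> complex_vector.span X \<inter> perp M" using sS by (simp add: perp_def)
    moreover have "s \<in> perp E" using s0 by (simp add: perp_def)
    ultimately have "s = 0" using span_Int_perp[OF E'(2,1), of s] E'(3) by simp
    then have "v \<in> perp X" using t by simp
    then show "?A v = 0"
      using ker[of v] perp_span[of v X u] u by (simp add: blinfun.diff_left rank_one_apply scaleC.zero_left)
  qed
  then have "schatten_sum p ?A = (\<Sum>e\<in>M \<union> E. \<bar>ev ?A e\<bar> powr p)"
    by (intro schatten_sum_finite) (use y M(1) E'(1) in
        \<open>auto intro: self_adjoint_diff self_adjoint_rank_one compact_operator_diff compact_rank_one\<close>)
  also have "\<dots> = (\<Sum>e\<in>M. \<bar>ev ?A e\<bar> powr p) + (\<Sum>e\<in>E. \<bar>ev ?A e\<bar> powr p)"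
    by (rule sum.union_disjoint) (use M(1) E'(1) EM orthonormal_disjoint_perp[OF M(2)] in auto)
  finally show ?thesis by (simp add: evM)
qed

text \<open>A maximal orthonormal set of common eigenvectors with equal eigenvalues exhausts the support:
  on its complement the common distance function \<open>u \<mapsto> \<parallel>x - P u\<parallel>\<close> attains its maximum, at a further
  common eigenvector.\<close>

lemma finite_rank_determined:
  assumes p: "0 < p" and x: "x \<in> schatten_pos_sphere p" and y: "y \<in> schatten_pos_sphere p"
    and X: "finite X" "diagonalizes X x"
    and ker: "\<And>u. norm u = 1 \<Longrightarrow> blinfun_apply x u = 0 \<Longrightarrow> blinfun_apply y u = 0"
    and dist: "\<And>u. norm u = 1 \<Longrightarrow> schatten_sum p (y - rank_one u) = schatten_sum p (x - rank_one u)"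
  shows "y = x"
proof -
  note x' = pos_sphereD[OF x] and y' = pos_sphereD[OF y] and onX = diagonalizesD(1)[OF X(2)]
  let ?S = "complex_vector.span X"
  have kx: "x v = 0" if "v \<in> perp X" for v by (rule diagonalizesD(3)[OF X(2) that])
  have ky: "y v = 0" if v: "v \<in> perp X" for v
  proof (cases "v = 0")
    case False
    then have "y (v /\<^sub>R norm v) = 0" using kx[OF v] by (intro ker) (auto simp: blinfun.scaleR_right)
    then show ?thesis using False by (simp add: blinfun.scaleR_right)
  qed (simp add: blinfun.zero_right)
  have range: "z v \<in> ?S" if z: "self_adjoint z" "\<And>v. v \<in> perp X \<Longrightarrow> z v = 0" for z v
  proof -
    define s where "s = (\<Sum>e\<in>X. cinner (z v) e *\<^sub>C e)"
    have r: "z v - s \<in> perp X" unfolding s_def by (rule perp_remainder[OF onX X(1)])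
    have s: "s \<in> ?S" unfolding s_def by (rule orthonormal_sum_in_span)
    have "cinner (z v - s) (z v - s) = cinner (z v - s) (z v)"
      using perp_span[OF r s] by (simp add: cinner.diff_right)
    also have "\<dots> = cinner (z (z v - s)) v" by (simp add: self_adjointD[OF z(1)])
    also have "\<dots> = 0" by (simp add: z(2)[OF r] cinner.zero_left)
    finally show ?thesis using s by (simp add: cinner_self)
  qed
  have "orthonormal {}" by (simp add: orthonormal_def)
  then obtain M where M: "orthonormal M"
      "\<And>e. e \<in> M \<Longrightarrow> e \<in> ?S \<and> x e = ev x e *\<^sub>R e \<and> y e = ev x e *\<^sub>R e"
    and max: "\<And>v. v \<in> perp M \<Longrightarrow> norm v = 1 \<Longrightarrow> \<not> (v \<in> ?S \<and> x v = ev x v *\<^sub>R v \<and> y v = ev x v *\<^sub>R v)"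
    by (rule orthonormal_extend[where Q = "\<lambda>e. e \<in> ?S \<and> x e = ev x e *\<^sub>R e \<and> y e = ev x e *\<^sub>R e"]) auto
  have MS: "M \<subseteq> ?S" using M(2) by blast
  have finM: "finite M" by (rule finite_orthonormal_in_span(1)[OF M(1) MS X(1)])
  have evy: "ev y e = ev x e" if "e \<in> M" for e
    using M(2)[OF that] orthonormal_norm[OF M(1) that] by (intro ev_eqI) auto
  let ?T = "?S \<inter> perp M"
  have "complex_vector.subspace ?T"
    unfolding complex_vector.subspace_def
    by (auto simp: complex_vector.span_zero complex_vector.span_add complex_vector.span_scale perp_def
        cinner.zero_left cinner.add_left cinner_scaleC_left)
  then obtain G where G: "finite G" "orthonormal G" "complex_vector.span G = ?T"
    by (rule orthonormal_basis_exists[OF X(1)]) auto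
  define F where "F u = schatten_sum p (x - rank_one u)" for u
  define c where "c = (\<Sum>e\<in>M. \<bar>ev x e\<bar> powr p)"
  \<comment> \<open>One pair \<open>F\<close>, \<open>c\<close> serves both operators, since their
    distances and their eigenvalues on \<open>M\<close> agree; a maximizer of \<open>F\<close> is
    then an eigenvector of both.\<close>
  have sec: "compressed_distance p z ?T G F c"
    if z: "z \<in> schatten_pos_sphere p" and kz: "\<And>v. v \<in> perp X \<Longrightarrow> z v = 0"
      and zM: "\<And>e. e \<in> M \<Longrightarrow> z e = ev z e *\<^sub>R e" and evz: "\<And>e. e \<in> M \<Longrightarrow> ev z e = ev x e"
      and zF: "\<And>u. norm u = 1 \<Longrightarrow> F u = schatten_sum p (z - rank_one u)" for z
  proof
    note z' = pos_sphereD[OF z]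
    show "0 < p" "positive_operator z" "compact_operator z" "orthonormal G" "finite G"
      "complex_vector.span G = ?T"
      by (fact p z'(1,3) G)+
    show "z v \<in> ?T" if "v \<in> ?T" for v
      using range[OF z'(2) kz] eigenvector_perp_invariant[OF z'(2) zM] that by blast
    show "inner (z v) v \<le> 1" if "norm v = 1" for v by (rule pos_sphere_form_le_1[OF p z that])
    show "F u = c + (\<Sum>e\<in>E. \<bar>ev (z - rank_one u) e\<bar> powr p)"
      if "u \<in> ?T" "norm u = 1" "eigenbasis (z - rank_one u) ?T E" for u E
      using schatten_sum_split[OF X(1) onX z'(2,3) kz finM M(1) MS zM that(1,3), of p] zF[OF that(2)]
      by (simp add: c_def evz)
  qed
  interpret cx: compressed_distance p x ?T G F c
    by (rule sec[OF x kx]) (use M(2) in \<open>auto simp: F_def\<close>)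
  interpret cy: compressed_distance p y ?T G F c
    by (rule sec[OF y ky]) (use M(2) evy dist in \<open>auto simp: F_def\<close>)
  have T0: "?T = {0}"
  proof (rule ccontr)
    assume "?T \<noteq> {0}"
    then obtain v where v: "v \<in> ?T" "v \<noteq> 0" using subspace_0[OF cx.subspace_S] by blast
    have "v /\<^sub>R norm v \<in> ?T \<inter> sphere 0 1" using cx.scaleR_S[OF v(1)] v(2) by auto
    then have ne: "?T \<inter> sphere 0 1 \<noteq> {}" by blast
    have "compact (?T \<inter> sphere 0 1)" using compact_unit_sphere_span[OF G(2,1)] G(3) by simp
    from continuous_attains_sup[OF this ne cx.F_continuous]
    obtain u where u: "u \<in> ?T" "norm u = 1" and umax: "\<And>w. w \<in> ?T \<Longrightarrow> norm w = 1 \<Longrightarrow> F w \<le> F u"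
      by auto
    obtain a where a: "x u = a *\<^sub>R u" using cx.maximizer_is_eigenvector[OF u umax] by blast
    obtain b where b: "y u = b *\<^sub>R u" using cy.maximizer_is_eigenvector[OF u umax] by blast
    note A = pos_sphere_diff_at_eigenvector[OF p x u(2) a] and B = pos_sphere_diff_at_eigenvector[OF p y u(2) b]
    have "a = b"
      by (rule eigenvalue_determined[OF p A(1,2) B(1,2)]) (use A(3) B(3) dist[OF u(2)] in simp)
    then show False using max[of u] u a b ev_eqI[OF a u(2)] by simp
  qed
  have "x v = y v" for v
  proof -
    define r where "r = v - (\<Sum>e\<in>M. cinner v e *\<^sub>C e)"
    have r: "r \<in> perp M" unfolding r_def by (rule perp_remainder[OF M(1) finM])
    define s where "s = (\<Sum>e\<in>X. cinner r e *\<^sub>C e)"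
    have t: "r - s \<in> perp X" unfolding s_def by (rule perp_remainder[OF onX X(1)])
    have sS: "s \<in> ?S" unfolding s_def by (rule orthonormal_sum_in_span)
    have "cinner s e = 0" if "e \<in> M" for e
    proof -
      have "cinner (r - s) e = 0" using perp_span[OF t] that MS by blast
      then show ?thesis using perpD[OF r that] by (simp add: cinner.diff_left)
    qed
    then have "s \<in> ?T" using sS by (simp add: perp_def)
    then have "s = 0" using T0 by blast
    then have "x r = 0" "y r = 0" using kx ky t by simp_all
    moreover have "z v = (\<Sum>e\<in>M. cinner v e *\<^sub>C z e) + z r" if "self_adjoint z" for z :: "'a \<Rightarrow>\<^sub>L 'a"
      by (simp add: r_def blinfun.diff_right blinfun.sum_right self_adjoint_scaleC[OF that])
    ultimately show ?thesis using x'(2) y'(2) M(2) by simp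
  qed
  then show ?thesis by (intro blinfun_eqI) simp
qed

section \<open>Approximation by finite-rank elements\<close>

lemma schatten_sum_minus_commute:
  assumes "x \<in> schatten_pos_sphere p" "y \<in> schatten_pos_sphere p"
  shows "schatten_sum p (y - x) = schatten_sum p (x - y)"
proof -
  obtain E where E: "diagonalizes E (x - y)" "perp E = {0}"
    by (rule diagonalization_exists[OF pos_sphere_diff_compact[OF assms]])
  have E': "diagonalizes E (y - x)" using diagonalizes_uminus[OF E(1)] by simp
  have "ev (y - x) e = - ev (x - y) e" for e using ev_minus[of "x - y" e] by simp
  then show ?thesis
    using schatten_sum_eq_infsum[OF pos_sphere_diff_compact[OF assms] E(1), of p]
      schatten_sum_eq_infsum[OF pos_sphere_diff_compact[OF assms(2,1)] E', of p] by simp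
qed

text \<open>Each eigenvalue of the difference is at most \<open>\<epsilon>\<close> in modulus.
  Forms, unlike distances for \<open>p < 1\<close>, can be added, so this replaces the triangle
  inequality in the density argument.\<close>

lemma pos_sphere_diff_form_le:
  assumes p: "0 < p" and x: "x \<in> schatten_pos_sphere p" and y: "y \<in> schatten_pos_sphere p"
    and \<epsilon>: "0 < \<epsilon>" and le: "schatten_sum p (x - y) \<le> \<epsilon> powr p"
  shows "\<bar>inner (blinfun_apply (x - y) v) v\<bar> \<le> \<epsilon> * (norm v)\<^sup>2"
proof -
  have *: "inner ((a - b) v) v \<le> \<epsilon> * (norm v)\<^sup>2"
    if a: "a \<in> schatten_pos_sphere p" and b: "b \<in> schatten_pos_sphere p"
      and le: "schatten_sum p (a - b) \<le> \<epsilon> powr p" for a b :: "'a \<Rightarrow>\<^sub>L 'a"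
  proof -
    note A = pos_sphere_diff_compact[OF a b]
    obtain E where E: "diagonalizes E (a - b)" "perp E = {0}" by (rule diagonalization_exists[OF A])
    have sum: "((\<lambda>e. \<bar>ev (a - b) e\<bar> powr p) has_sum schatten_sum p (a - b)) E"
      using has_sum_imp_summable[OF pos_sphere_diff_sum[OF p a b E(1)]]
        schatten_sum_eq_infsum[OF A E(1), of p] has_sum_infsum by metis
    have "ev (a - b) e \<le> \<epsilon>" if "e \<in> E" for e
    proof -
      have "\<bar>ev (a - b) e\<bar> powr p \<le> schatten_sum p (a - b)"
        using finite_sum_le_has_sum[OF sum, of "{e}"] that by simp
      then have "\<bar>ev (a - b) e\<bar> powr p \<le> \<epsilon> powr p" using le by simp
      then show ?thesis using \<epsilon> p powr_less_mono2[of p \<epsilon> "\<bar>ev (a - b) e\<bar>"] by fastforce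
    qed
    then have "v \<in> perp {e \<in> E. ev (a - b) e > \<epsilon>}" by (fastforce simp: perp_def)
    then show ?thesis by (rule form_le_perp_large[OF A E(1) less_imp_le[OF \<epsilon>]])
  qed
  have "inner ((y - x) v) v = - inner ((x - y) v) v" by (simp add: blinfun.diff_left inner_simps)
  then show ?thesis using *[OF x y le] *[OF y x] le schatten_sum_minus_commute[OF x y] by simp
qed

text \<open>Truncate the spectrum to \<open>F\<close> and divide by the norm \<open>c\<close> of the
  truncation to return to the sphere. The retained eigenvectors contribute
  \<open>(1 - c) powr p\<close> to the distance sum, the discarded ones \<open>1 - s F\<close>; both
  tend to \<open>0\<close> as \<open>s F\<close> tends to \<open>1\<close>.\<close>

lemma finite_rank_approximation:
  assumes p: "0 < p" and x: "x \<in> schatten_pos_sphere p" and \<epsilon>: "0 < \<epsilon>"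
  obtains y F where "y \<in> schatten_pos_sphere p" "finite F" "diagonalizes F y"
    "schatten_sum p (x - y) \<le> \<epsilon>"
proof -
  note x' = pos_sphereD[OF x]
  obtain X where X: "diagonalizes X x" "perp X = {0}" by (rule diagonalization_exists[OF x'(2,3)])
  note S = pos_sphere_has_sum[OF p x X(1)] and XD = diagonalizesD[OF X(1)]
  define s where "s F = (\<Sum>f\<in>F. ev x f powr p)" for F
  have s_le: "s F \<le> 1" if "finite F" "F \<subseteq> X" for F
    unfolding s_def by (rule finite_sum_le_has_sum[OF S that]) simp
  have s_nn: "0 \<le> s F" for F unfolding s_def by (intro sum_nonneg) simp
  have lim: "(s \<longlongrightarrow> 1) (finite_subsets_at_top X)" using S unfolding has_sum_def s_def .
  \<comment> \<open>The distance sum computed at the end, taken in advance to choose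
    \<open>F\<close>. The base tends to \<open>0\<close>, so continuity of \<open>powr\<close> needs
    it to be nonnegative.\<close>
  have "((\<lambda>F. (1 - s F powr (1 / p)) powr p + (1 - s F)) \<longlongrightarrow> (1 - 1 powr (1 / p)) powr p + (1 - 1))
      (finite_subsets_at_top X)"
  proof (intro tendsto_add tendsto_diff tendsto_const lim tendsto_powr')
    have "eventually (\<lambda>F. 0 \<le> 1 - s F powr (1 / p)) (finite_subsets_at_top X)"
      by (rule eventually_finite_subsets_at_top_weakI)
         (use s_le s_nn p powr_mono2[of "1 / p" "s _" 1] in auto)
    then show "1 - 1 powr (1 / p) \<noteq> 0 \<or> 0 < p \<and> (\<forall>\<^sub>F F in finite_subsets_at_top X. 0 \<le> 1 - s F powr (1 / p))"
      using p by blast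
  qed simp_all
  then have "((\<lambda>F. (1 - s F powr (1 / p)) powr p + (1 - s F)) \<longlongrightarrow> 0) (finite_subsets_at_top X)" by simp
  then have "eventually (\<lambda>F. (1 - s F powr (1 / p)) powr p + (1 - s F) < \<epsilon>) (finite_subsets_at_top X)"
    using \<epsilon> by (rule order_tendstoD)
  moreover have "eventually (\<lambda>F. 0 < s F) (finite_subsets_at_top X)"
    using lim by (rule order_tendstoD) simp
  moreover have "eventually (\<lambda>F. finite F \<and> F \<subseteq> X) (finite_subsets_at_top X)"
    by (rule eventually_finite_subsets_at_top_weakI) simp
  ultimately have "eventually (\<lambda>F. (1 - s F powr (1 / p)) powr p + (1 - s F) < \<epsilon> \<and> 0 < s F \<and> finite F \<and> F \<subseteq> X)
      (finite_subsets_at_top X)" by eventually_elim simp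
  then obtain F where F: "(1 - s F powr (1 / p)) powr p + (1 - s F) < \<epsilon>" "0 < s F" "finite F" "F \<subseteq> X"
    using eventually_happens' finite_subsets_at_top_neq_bot by blast
  define c where "c = s F powr (1 / p)"
  have c: "0 < c" "c \<le> 1" "c powr p = s F"
    using F(2) p s_le[OF F(3,4)] s_nn[of F] powr_mono2[of "1 / p" "s F" 1] by (auto simp: c_def powr_powr)
  define y where "y = (\<Sum>f\<in>F. (ev x f / c) *\<^sub>R rank_one f)"
  have onF: "orthonormal F" by (rule orthonormal_subset[OF XD(1) F(4)])
  have yv: "y v = (\<Sum>f\<in>F. (complex_of_real (ev x f / c) * cinner v f) *\<^sub>C f)" for v
    by (simp add: y_def blinfun.sum_left blinfun.scaleR_left rank_one_apply scaleR_scaleC[of "_ / _"] scaleC_scaleC)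
  have yF: "y f = (ev x f / c) *\<^sub>R f" if f: "f \<in> F" for f
  proof -
    have "y f = (\<Sum>g\<in>F. if g = f then complex_of_real (ev x f / c) *\<^sub>C f else 0)"
      unfolding yv by (intro sum.cong refl) (use f in \<open>auto simp: orthonormal_cinner[OF onF f] scaleC.zero_left\<close>)
    then show ?thesis using F(3) f by (simp add: scaleR_scaleC[of _ f])
  qed
  have y0: "y v = 0" if "v \<in> perp F" for v
    unfolding yv by (intro sum.neutral) (use that in \<open>auto simp: perp_def scaleC.zero_left\<close>)
  have evF: "ev y f = ev x f / c" if "f \<in> F" for f
    by (rule ev_eqI[OF yF[OF that] orthonormal_norm[OF onF that]])
  have dy: "diagonalizes F y" using onF yF evF y0 by (simp add: diagonalizes_def)
  have y_pos: "positive_operator y"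
    unfolding positive_operator_iff
  proof
    show "self_adjoint y" unfolding y_def
      by (intro self_adjoint_sum self_adjoint_scaleR self_adjoint_rank_one)
    show "\<forall>u. 0 \<le> inner (y u) u"
      unfolding y_def blinfun.sum_left inner_sum_left
      using ev_nonneg[OF x'(1)] c(1)
      by (auto intro!: sum_nonneg simp: blinfun.scaleR_left form_rank_one)
  qed
  have y_comp: "compact_operator y"
  proof -
    \<comment> \<open>The factor is absorbed into the vector as \<open>sqrt r\<close>.\<close>
    have scaled: "compact_operator (r *\<^sub>R rank_one f)" if "0 \<le> r" for r f
    proof -
      have "r *\<^sub>R rank_one f = rank_one (sqrt r *\<^sub>R f)"
        by (rule blinfun_eqI)
           (use that in \<open>simp add: blinfun.scaleR_left rank_one_apply cinner.scaleR_right scaleC.scaleR_left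
             scaleC.scaleR_right\<close>)
      then show ?thesis by (simp add: compact_rank_one)
    qed
    show ?thesis unfolding y_def
      using ev_nonneg[OF x'(1)] c(1) by (intro compact_operator_sum scaled) simp
  qed
  have "((\<lambda>f. ev y f powr p) has_sum 1) F"
  proof (rule has_sum_finiteI[OF F(3)])
    have "(\<Sum>f\<in>F. ev y f powr p) = (\<Sum>f\<in>F. ev x f powr p / c powr p)"
      by (intro sum.cong refl) (use c(1) ev_nonneg[OF x'(1)] in \<open>simp add: evF powr_divide\<close>)
    also have "\<dots> = s F / c powr p" by (simp add: s_def sum_divide_distrib)
    finally show "1 = (\<Sum>f\<in>F. ev y f powr p)" using c F(2) by simp
  qed
  then have y: "y \<in> schatten_pos_sphere p" by (rule pos_sphereI[OF p y_pos y_comp dy])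
  have AF: "(x - y) f = (ev x f - ev x f / c) *\<^sub>R f" if "f \<in> F" for f
    using XD(2)[of f] yF[OF that] that F(4) by (auto simp: blinfun.diff_left scaleR_diff_left)
  have AX: "(x - y) f = ev x f *\<^sub>R f" if f: "f \<in> X - F" for f
  proof -
    have "f \<in> perp F" using orthonormal_cinner[OF XD(1), of f] f F(4) by (auto simp: perp_def)
    then show ?thesis using XD(2)[of f] f by (simp add: blinfun.diff_left y0)
  qed
  have evAF: "ev (x - y) f = ev x f - ev x f / c" if "f \<in> F" for f
    by (rule ev_eqI[OF AF[OF that] orthonormal_norm[OF onF that]])
  have evAX: "ev (x - y) f = ev x f" if "f \<in> X - F" for f
    by (rule ev_eqI[OF AX[OF that]]) (use that orthonormal_norm[OF XD(1)] in auto)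
  have dA: "diagonalizes X (x - y)"
    unfolding diagonalizes_def
  proof (intro conjI ballI XD(1))
    show "(x - y) f = ev (x - y) f *\<^sub>R f" if "f \<in> X" for f
      using AF[of f] AX[of f] evAF[of f] evAX[of f] that by (cases "f \<in> F") auto
    show "(x - y) v = 0" if "v \<in> perp X" for v using that X(2) by (simp add: blinfun.zero_right)
  qed
  have 1: "((\<lambda>f. \<bar>ev (x - y) f\<bar> powr p) has_sum ((1 - c) powr p)) F"
  proof (rule has_sum_finiteI[OF F(3)])
    have "(\<Sum>f\<in>F. \<bar>ev (x - y) f\<bar> powr p) = (\<Sum>f\<in>F. ev x f powr p * ((1 - c) / c) powr p)"
    proof (intro sum.cong refl)
      fix f assume f: "f \<in> F"
      have nn: "0 \<le> ev x f" "0 \<le> (1 - c) / c" using c ev_nonneg[OF x'(1)] by simp_all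
      have "ev (x - y) f = - (ev x f * ((1 - c) / c))" using c(1) by (simp add: evAF[OF f] field_simps)
      then have "\<bar>ev (x - y) f\<bar> = ev x f * ((1 - c) / c)"
        using mult_nonneg_nonneg[OF nn] by linarith
      then show "\<bar>ev (x - y) f\<bar> powr p = ev x f powr p * ((1 - c) / c) powr p"
        by (simp only: powr_mult)
    qed
    also have "\<dots> = s F * ((1 - c) / c) powr p" by (simp add: s_def sum_distrib_right)
    also have "\<dots> = (1 - c) powr p" using c F(2) by (simp add: powr_divide)
    finally show "(1 - c) powr p = (\<Sum>f\<in>F. \<bar>ev (x - y) f\<bar> powr p)" by simp
  qed
  have 2: "((\<lambda>f. \<bar>ev (x - y) f\<bar> powr p) has_sum (1 - s F)) (X - F)"
  proof -
    have "((\<lambda>f. ev x f powr p) has_sum (1 - s F)) (X - F)"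
      by (rule has_sum_Diff[OF S _ F(4)]) (simp add: s_def F(3))
    then show ?thesis
      by (rule has_sum_cong[THEN iffD1, rotated]) (simp add: evAX ev_nonneg[OF x'(1)])
  qed
  have "((\<lambda>f. \<bar>ev (x - y) f\<bar> powr p) has_sum ((1 - c) powr p + (1 - s F))) (F \<union> (X - F))"
    by (rule has_sum_Un_disjoint[OF 1 2]) auto
  moreover have "F \<union> (X - F) = X" using F(4) by auto
  ultimately have "schatten_sum p (x - y) = (1 - c) powr p + (1 - s F)"
    using schatten_sum_eq_infsum[OF pos_sphere_diff_compact[OF x y] dA, of p] infsumI by metis
  then show ?thesis using that[OF y F(3) dy] F(1) by (simp add: c_def)
qed

text \<open>For finite rank, \<open>W\<close> preserves the distances to the projections and,
  through orthogonality to \<open>rank_one u\<close>, the kernel. A general \<open>x\<close> and its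
  image are both close to a fixed finite-rank \<open>y\<close>, so the form of their difference
  vanishes.\<close>

lemma sphere_isometry_fixing_rank_one:
  fixes W :: "('h::complex_hilbert \<Rightarrow>\<^sub>L 'h) \<Rightarrow> ('h \<Rightarrow>\<^sub>L 'h)"
  assumes "sphere_isometry p W" and fixed: "\<And>u. norm u = 1 \<Longrightarrow> W (rank_one u) = rank_one u"
    and x: "x \<in> schatten_pos_sphere p"
  shows "W x = x"
proof -
  interpret sphere_isometry p W by fact
  have finite_rank: "W y = y" if y: "y \<in> schatten_pos_sphere p" "finite Y" "diagonalizes Y y" for y Y
  proof (rule finite_rank_determined[OF p y(1) maps[OF y(1)] y(2,3)])
    fix u :: 'h assume u: "norm u = 1"
    note Pu = rank_one_in_sphere[OF p u]
    show "schatten_sum p (W y - rank_one u) = schatten_sum p (y - rank_one u)"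
      using sum_diff[OF y(1) Pu] by (simp add: fixed[OF u])
    show "W y u = 0" if "y u = 0"
      using orthogonal_iff[OF y(1) Pu] orthogonal_rank_one[OF y(1) u] orthogonal_rank_one[OF maps[OF y(1)] u] that
      by (simp add: fixed[OF u])
  qed
  have small: "\<bar>inner ((W x - x) v) v\<bar> \<le> 2 * \<epsilon> * (norm v)\<^sup>2" if \<epsilon>: "0 < \<epsilon>" for \<epsilon> v
  proof -
    obtain y Y where y: "y \<in> schatten_pos_sphere p" "finite Y" "diagonalizes Y y"
      "schatten_sum p (x - y) \<le> \<epsilon> powr p"
      by (rule finite_rank_approximation[OF p x, of "\<epsilon> powr p"]) (use \<epsilon> in auto)
    have "schatten_sum p (W x - y) = schatten_sum p (x - y)"
      using sum_diff[OF x y(1)] finite_rank[OF y(1-3)] by simp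
    then have "\<bar>inner ((W x - y) v) v\<bar> \<le> \<epsilon> * (norm v)\<^sup>2"
      using y(4) by (intro pos_sphere_diff_form_le[OF p maps[OF x] y(1) \<epsilon>]) simp
    moreover have "\<bar>inner ((x - y) v) v\<bar> \<le> \<epsilon> * (norm v)\<^sup>2"
      by (rule pos_sphere_diff_form_le[OF p x y(1) \<epsilon> y(4)])
    moreover have "inner ((W x - x) v) v = inner ((W x - y) v) v - inner ((x - y) v) v"
      by (simp add: blinfun.diff_left inner_simps)
    ultimately show ?thesis by (simp add: algebra_simps)
  qed
  have form: "inner ((W x - x) v) v = 0" for v
  proof (rule ccontr)
    assume ne: "inner ((W x - x) v) v \<noteq> 0"
    define q where "q = \<bar>inner ((W x - x) v) v\<bar>"
    have q: "0 < q" using ne by (simp add: q_def)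
    define d where "d = (norm v)\<^sup>2 + 1"
    have d: "0 < d" by (simp add: d_def add_nonneg_pos)
    \<comment> \<open>Makes \<open>2 * \<epsilon> * d\<close> equal to \<open>q / 2\<close>; the
      summand \<open>1\<close> in \<open>d\<close> keeps it positive for
      \<open>v = 0\<close>.\<close>
    define \<epsilon> where "\<epsilon> = q / (4 * d)"
    have "0 < \<epsilon>" using q d by (simp add: \<epsilon>_def)
    then have "q \<le> 2 * \<epsilon> * (norm v)\<^sup>2" unfolding q_def by (rule small)
    also have "\<dots> \<le> 2 * \<epsilon> * d" using \<open>0 < \<epsilon>\<close> by (simp add: d_def)
    also have "\<dots> = q / 2" using d by (simp add: \<epsilon>_def)
    finally show False using q by simp
  qed
  have "(W x - x) v = 0" for v
    by (rule zero_form_imp_zero[of "W x - x" UNIV])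
       (use form self_adjoint_inner[OF pos_sphere_diff_compact(1)[OF maps[OF x] x]] in auto)
  then have "W x - x = 0" by (intro blinfun_eqI) simp
  then show ?thesis by simp
qed

section \<open>Extension of the isometry to the whole Schatten class\<close>

lemma rank_one_eq_imp_parallel:
  assumes "norm w = 1" "rank_one w = rank_one z" shows "w = cinner w z *\<^sub>C z"
  using rank_one_unit(1)[OF assms(1)] assms(2) rank_one_apply by metis

theorem proposition4p2:
  fixes p :: real
    and V0 :: "('h::complex_hilbert \<Rightarrow>\<^sub>L 'h) \<Rightarrow> ('k::complex_hilbert \<Rightarrow>\<^sub>L 'k)"
  assumes "0 < p"
    and "schatten_isometry_onto p (schatten_pos_sphere p) (schatten_pos_sphere p) V0"
  shows "\<exists>T :: ('h \<Rightarrow>\<^sub>L 'h) \<Rightarrow> ('k \<Rightarrow>\<^sub>L 'k).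
    real_linear_on (schatten_class p) T \<and>
    schatten_isometry_onto p (schatten_class p) (schatten_class p) T \<and>
    (\<forall>x \<in> schatten_pos_sphere p. T x = V0 x)"
proof -
  interpret V: sphere_isometry p V0 by unfold_locales fact+
  obtain V' where V': "sphere_isometry p V'" "\<And>y. y \<in> schatten_pos_sphere p \<Longrightarrow> V0 (V' y) = y"
    using V.inverse_isometry by metis
  obtain \<phi> where \<phi>: "\<And>u. norm u = 1 \<Longrightarrow> norm (\<phi> u) = 1"
      "\<And>u. norm u = 1 \<Longrightarrow> V0 (rank_one u) = rank_one (\<phi> u)"
    using V.rank_one_image by metis
  \<comment> \<open>The vector \<open>\<phi> u\<close> is an arbitrary choice on its line; Wigner's
    theorem tolerates the phase, and \<open>rank_one\<close> does not see it.\<close>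
  obtain U \<sigma> where "semi_unitary U \<sigma>" and U: "\<And>u. norm u = 1 \<Longrightarrow> \<exists>c. \<phi> u = c *\<^sub>C U u"
  proof (rule wigner_unit_vectors)
    show "norm (\<phi> u) = 1" if "norm u = 1" for u by (rule \<phi>(1)[OF that])
    show "cmod (cinner (\<phi> u) (\<phi> v)) = cmod (cinner u v)" if u: "norm u = 1" and v: "norm v = 1" for u v
      using V.sum_diff[OF rank_one_in_sphere[OF assms(1) u] rank_one_in_sphere[OF assms(1) v]]
      by (intro rank_one_diff_sum_eq_imp[OF assms(1) \<phi>(1)[OF u] \<phi>(1)[OF v] u v])
         (simp add: \<phi>(2) u v)
    \<comment> \<open>The inverse isometry sends \<open>rank_one w\<close> to some
      \<open>rank_one u\<close>, so \<open>w\<close> lies on the line of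
      \<open>\<phi> u\<close>.\<close>
    show "\<exists>u c. norm u = 1 \<and> w = c *\<^sub>C \<phi> u" if w: "norm w = 1" for w
    proof -
      obtain u where u: "norm u = 1" "V' (rank_one w) = rank_one u"
        using sphere_isometry.rank_one_image[OF V'(1) w] by blast
      have "rank_one w = rank_one (\<phi> u)"
        using V'(2)[OF rank_one_in_sphere[OF assms(1) w]] u \<phi>(2) by simp
      then show ?thesis using rank_one_eq_imp_parallel[OF w] u(1) by blast
    qed
  qed (erule that)
  then interpret U: semi_unitary U \<sigma> by simp
  interpret U': semi_unitary "inv U" \<sigma> by (rule U.semi_unitary_inv)
  have T_rank_one: "U.conjugate (rank_one u) = V0 (rank_one u)" if u: "norm u = 1" for u
  proof -
    obtain c where c: "\<phi> u = c *\<^sub>C U u" using U[OF u] by blast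
    then have "cmod c = 1" using \<phi>(1)[OF u] u by (simp add: norm_scaleC U.norm_image)
    then show ?thesis by (simp add: U.conjugate_rank_one \<phi>(2)[OF u] c rank_one_scaleC)
  qed
  \<comment> \<open>The candidate extension is undone on the sphere: \<open>W\<close> fixes all
    rank-one projections, hence every point, and so \<open>U.conjugate\<close> agrees with
    \<open>V0\<close> there.\<close>
  define W where "W x = U'.conjugate (V0 x)" for x
  have "schatten_isometry_onto p (schatten_pos_sphere p) (schatten_pos_sphere p) W"
    unfolding schatten_isometry_onto_def
  proof (intro conjI ballI)
    show "W ` schatten_pos_sphere p = schatten_pos_sphere p"
    proof
      show "W ` schatten_pos_sphere p \<subseteq> schatten_pos_sphere p"
        using U'.conjugate_pos_sphere V.maps by (auto simp: W_def)
      show "schatten_pos_sphere p \<subseteq> W ` schatten_pos_sphere p"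
      proof
        fix y assume "y \<in> (schatten_pos_sphere p :: ('h \<Rightarrow>\<^sub>L 'h) set)"
        then obtain x where "x \<in> schatten_pos_sphere p" "V0 x = U.conjugate y"
          using V.onto[OF U.conjugate_pos_sphere] by blast
        then show "y \<in> W ` schatten_pos_sphere p"
          by (intro image_eqI[of _ _ x]) (simp_all add: W_def U.conjugate_inverse)
      qed
    qed
    fix x y :: "'h \<Rightarrow>\<^sub>L 'h" assume xy: "x \<in> schatten_pos_sphere p" "y \<in> schatten_pos_sphere p"
    have "complex_linear (V0 x - V0 y)"
      by (rule self_adjoint_complex_linear[OF pos_sphere_diff_compact(1)[OF V.maps[OF xy(1)] V.maps[OF xy(2)]]])
    then have "schatten_norm p (W x - W y) = schatten_norm p (V0 x - V0 y)"
      by (simp add: W_def U'.conjugate_diff[symmetric] U'.conjugate_schatten_norm)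
    also have "\<dots> = schatten_norm p (x - y)"
      using V.sum_diff[OF xy] by (simp add: schatten_norm_eq_iff[OF assms(1)])
    finally show "schatten_norm p (W x - W y) = schatten_norm p (x - y)" .
  qed
  then have W: "sphere_isometry p W" by (unfold_locales, intro assms(1))
  have "W x = x" if "x \<in> schatten_pos_sphere p" for x
    by (rule sphere_isometry_fixing_rank_one[OF W _ that])
       (simp add: W_def T_rank_one[symmetric] U.conjugate_inverse)
  then have "U.conjugate x = V0 x" if "x \<in> schatten_pos_sphere p" for x
    using that U.conjugate_of_inverse[of "V0 x"] by (simp add: W_def)
  moreover have "real_linear_on (schatten_class p) U.conjugate"
    by (simp add: real_linear_on_def U.conjugate_add U.conjugate_scaleR)
  ultimately show ?thesis using U.conjugate_isometry_onto_class by blast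
qed

end
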